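(* Let $(M,g)$ be an $n$-dimensional compact Riemannian manifold with boundary $\partial M$. Suppose that the boundary $\partial M$ has nonnegative mean curvature with respect to the outward normal and that the Ricci curvature of $M$ satisfies $$\mathrm{Ric}(M)\geq (n-1)\kappa$$ for some constant $\kappa<0$. Let $d=2r$, where $r=\max_{x\in M}\mathrm{dist}(x,\partial M)$. Then the first Dirichlet eigenvalue $\lambda$ of the Laplacian $\Delta$ of $M$ satisfies $$\lambda \geq \frac{1}{1-(n-1)\kappa/(2\lambda)}\,\frac{\pi^2}{d^2}>0,$$ and $\lambda$ has the lower bound $$\lambda \geq \frac12(n-1)\kappa+\frac{\pi^2}{d^2}.$$
   Context: $\mathrm{dist}(\cdot,\cdot)$ is the Riemannian distance on $M$; $d$ is called the diameter of the largest interior ball in $M$. The bound $\mathrm{Ric}(M)\ge (n-1)\kappa$ means $\mathrm{Ric}(X,X)\geq (n-1)\kappa\, g(X,X)$ for all tangent vectors $X$. The first Dirichlet eigenvalue $\lambda$ is the smallest number for which there is a nonzero function $v$ with $\Delta v=-\lambda v$ in $M$ and $v=0$ on $\partial M$, where $\Delta$ is the Laplacian with the sign convention $\Delta=\mathrm{div}\,\nabla$. The mean curvature of $\partial M$ with respect to the outward unit normal $e_n$ is $m=\sum_{i=1}^{n-1}g(\nabla_{e_i}e_n,e_i)$, where $e_1,\dots,e_{n-1}$ is a local orthonormal frame of $\partial M$ (so the boundary of a Euclidean ball has positive mean curvature). *)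

theory Defs
  imports "HOL-Analysis.Analysis"
begin

section \<open>Calculus on the model half-space\<close>

text \<open>
  Manifolds with boundary are modelled on the half-space \<open>x\<^sub>k \<ge> 0\<close> of \<open>real ^ 'n\<close>, for an
  arbitrary but fixed coordinate index \<open>k\<close>. Derivatives are taken within the half-space, hence
  are one-sided in direction \<open>k\<close> at points with \<open>x\<^sub>k = 0\<close>; they are unique there since the
  half-space is convex with nonempty interior.
\<close>

definition half_space :: "'n::finite \<Rightarrow> (real ^ 'n) set" where
  "half_space k = {x. 0 \<le> x $ k}"

definition partial :: "'n::finite \<Rightarrow> 'n \<Rightarrow> (real ^ 'n \<Rightarrow> real) \<Rightarrow> real ^ 'n \<Rightarrow> real" where
  "partial k i f y = frechet_derivative f (at y within half_space k) (axis i 1)"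

text \<open>
  Here \<open>S\<close> is always a relatively open subset of the half-space, so that the values of \<open>f\<close>
  outside \<open>S\<close> do not matter.
\<close>

primrec Ck_on :: "'n::finite \<Rightarrow> nat \<Rightarrow> (real ^ 'n) set \<Rightarrow> (real ^ 'n \<Rightarrow> real) \<Rightarrow> bool" where
  "Ck_on k 0 S f \<longleftrightarrow> continuous_on S f"
| "Ck_on k (Suc m) S f \<longleftrightarrow>
     (\<forall>y\<in>S. f differentiable (at y within half_space k)) \<and> (\<forall>i. Ck_on k m S (partial k i f))"

definition smooth_on :: "'n::finite \<Rightarrow> (real ^ 'n) set \<Rightarrow> (real ^ 'n \<Rightarrow> real) \<Rightarrow> bool" where
  "smooth_on k S f \<longleftrightarrow> (\<forall>m. Ck_on k m S f)"

section \<open>Riemannian geometry in one chart\<close>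

text \<open>
  In local coordinates a metric is a matrix-valued function \<open>G\<close>, with \<open>G y $ i $ j\<close> equal to
  \<open>g(\<partial>\<^sub>i, \<partial>\<^sub>j)\<close>, and a vector field is given by its components with respect to the \<open>\<partial>\<^sub>i\<close>.
\<close>

definition metric_ip :: "real ^ 'n ^ 'n \<Rightarrow> real ^ 'n \<Rightarrow> real ^ 'n::finite \<Rightarrow> real" where
  "metric_ip A X Y = X \<bullet> (A *v Y)"

definition sym_pos_def :: "real ^ 'n ^ 'n::finite \<Rightarrow> bool" where
  "sym_pos_def A \<longleftrightarrow> transpose A = A \<and> (\<forall>X. X \<noteq> 0 \<longrightarrow> 0 < metric_ip A X X)"

definition christoffel ::
  "'n::finite \<Rightarrow> (real ^ 'n \<Rightarrow> real ^ 'n ^ 'n) \<Rightarrow> 'n \<Rightarrow> 'n \<Rightarrow> 'n \<Rightarrow> real ^ 'n \<Rightarrow> real" where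
  "christoffel k G l i j y =
     (\<Sum>m\<in>UNIV. matrix_inv (G y) $ l $ m *
        (partial k i (\<lambda>z. G z $ j $ m) y + partial k j (\<lambda>z. G z $ i $ m) y
         - partial k m (\<lambda>z. G z $ i $ j) y)) / 2"

text \<open>The Levi-Civita derivative, at \<open>y\<close> and in direction \<open>V\<close>, of the vector field \<open>X\<close>.\<close>

definition cov_deriv ::
  "'n::finite \<Rightarrow> (real ^ 'n \<Rightarrow> real ^ 'n ^ 'n) \<Rightarrow> real ^ 'n \<Rightarrow> real ^ 'n \<Rightarrow> (real ^ 'n \<Rightarrow> real ^ 'n)
    \<Rightarrow> real ^ 'n" where
  "cov_deriv k G y V X =
     (\<chi> l. \<Sum>i\<in>UNIV. V $ i *
        (partial k i (\<lambda>z. X z $ l) y + (\<Sum>j\<in>UNIV. christoffel k G l i j y * X y $ j)))"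

definition gradient ::
  "'n::finite \<Rightarrow> (real ^ 'n \<Rightarrow> real ^ 'n ^ 'n) \<Rightarrow> (real ^ 'n \<Rightarrow> real) \<Rightarrow> real ^ 'n \<Rightarrow> real ^ 'n" where
  "gradient k G f y = matrix_inv (G y) *v (\<chi> j. partial k j f y)"

definition divergence ::
  "'n::finite \<Rightarrow> (real ^ 'n \<Rightarrow> real ^ 'n ^ 'n) \<Rightarrow> (real ^ 'n \<Rightarrow> real ^ 'n) \<Rightarrow> real ^ 'n \<Rightarrow> real" where
  "divergence k G X y = (\<Sum>i\<in>UNIV. cov_deriv k G y (axis i 1) X $ i)"

definition laplacian ::
  "'n::finite \<Rightarrow> (real ^ 'n \<Rightarrow> real ^ 'n ^ 'n) \<Rightarrow> (real ^ 'n \<Rightarrow> real) \<Rightarrow> real ^ 'n \<Rightarrow> real" where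
  "laplacian k G f y = divergence k G (gradient k G f) y"

text \<open>
  The \<open>l\<close>-th component of \<open>R(\<partial>\<^sub>a, \<partial>\<^sub>b) \<partial>\<^sub>j\<close>, where
  \<open>R(X,Y) Z = \<nabla>\<^sub>X \<nabla>\<^sub>Y Z - \<nabla>\<^sub>Y \<nabla>\<^sub>X Z - \<nabla>\<^bsub>[X,Y]\<^esub> Z\<close>. The Ricci tensor is
  \<open>Ric(Y,Z) = trace (X \<mapsto> R(X,Y) Z)\<close>, which is positive on round spheres.
\<close>

definition riemann ::
  "'n::finite \<Rightarrow> (real ^ 'n \<Rightarrow> real ^ 'n ^ 'n) \<Rightarrow> 'n \<Rightarrow> 'n \<Rightarrow> 'n \<Rightarrow> 'n \<Rightarrow> real ^ 'n \<Rightarrow> real" where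
  "riemann k G l a b j y =
     partial k a (christoffel k G l b j) y - partial k b (christoffel k G l a j) y
     + (\<Sum>m\<in>UNIV. christoffel k G l a m y * christoffel k G m b j y
                   - christoffel k G l b m y * christoffel k G m a j y)"

definition ricci ::
  "'n::finite \<Rightarrow> (real ^ 'n \<Rightarrow> real ^ 'n ^ 'n) \<Rightarrow> real ^ 'n \<Rightarrow> real ^ 'n ^ 'n" where
  "ricci k G y = (\<chi> b j. \<Sum>a\<in>UNIV. riemann k G a a b j y)"

text \<open>
  Since \<open>x\<^sub>k \<ge> 0\<close> on the manifold, the outward unit normal is \<open>- \<nabla>x\<^sub>k / |\<nabla>x\<^sub>k|\<close>. The formula
  extends it to a vector field on the whole chart; only derivatives tangent to the boundary are
  used below, and these do not depend on the extension.
\<close>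

definition outward_normal ::
  "'n::finite \<Rightarrow> (real ^ 'n \<Rightarrow> real ^ 'n ^ 'n) \<Rightarrow> real ^ 'n \<Rightarrow> real ^ 'n" where
  "outward_normal k G y =
     - (1 / sqrt (matrix_inv (G y) $ k $ k)) *\<^sub>R (matrix_inv (G y) *v axis k 1)"

lemma outward_normal:
  assumes "sym_pos_def (G y)"
  shows "metric_ip (G y) (outward_normal k G y) (outward_normal k G y) = 1"
    and "\<And>X. X $ k = 0 \<Longrightarrow> metric_ip (G y) X (outward_normal k G y) = 0"
    and "outward_normal k G y $ k < 0"
proof -
  let ?A = "G y" and ?B = "matrix_inv (G y)" and ?e = "axis k 1 :: real ^ 'a"
  let ?N = "outward_normal k G y"
  have pos: "0 < X \<bullet> (?A *v X)" if "X \<noteq> 0" for X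
    using assms that by (auto simp: sym_pos_def_def metric_ip_def)
  have "X = 0" if "?A *v X = 0" for X
    using pos[of X] that by force
  then have "invertible ?A"
    using matrix_left_invertible_ker invertible_left_inverse by blast
  then have AB: "?A ** ?B = mat 1"
    unfolding invertible_def matrix_inv_def by (metis (mono_tags, lifting) someI_ex)
  have ABe: "?A *v (?B *v ?e) = ?e"
    by (simp add: matrix_vector_mul_assoc AB)
  have Be: "(?B *v ?e) $ k = ?B $ k $ k"
    by (simp add: matrix_vector_mul_component inner_axis)
  have "?B *v ?e \<noteq> 0"
    using ABe by (metis axis_eq_0_iff matrix_vector_mult_0_right zero_neq_one)
  from pos[OF this] have Bkk: "0 < ?B $ k $ k"
    by (simp add: ABe Be inner_axis)
  have AN: "?A *v ?N = (- (1 / sqrt (?B $ k $ k))) *\<^sub>R ?e"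
    by (simp add: outward_normal_def matrix_vector_mult_scaleR ABe
          flip: scaleR_minus_left)
  have Nk: "?N $ k = - sqrt (?B $ k $ k)"
    using Bkk by (simp add: outward_normal_def Be real_div_sqrt)
  show "metric_ip ?A ?N ?N = 1"
    using Bkk by (simp add: metric_ip_def AN inner_axis Nk)
  show "metric_ip ?A X ?N = 0" if "X $ k = 0" for X
    using that by (simp add: metric_ip_def AN inner_axis)
  show "?N $ k < 0"
    using Bkk by (simp add: Nk)
qed

definition boundary_frame ::
  "'n::finite \<Rightarrow> (real ^ 'n \<Rightarrow> real ^ 'n ^ 'n) \<Rightarrow> real ^ 'n \<Rightarrow> (real ^ 'n) set \<Rightarrow> bool" where
  "boundary_frame k G y E \<longleftrightarrow>
     finite E \<and> card E = CARD('n) - 1 \<and> (\<forall>e\<in>E. e $ k = 0) \<and>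
     (\<forall>e\<in>E. \<forall>f\<in>E. metric_ip (G y) e f = (if e = f then 1 else 0))"

text \<open>The value is a trace over the tangent space of the boundary, so the frame is immaterial.\<close>

definition mean_curvature ::
  "'n::finite \<Rightarrow> (real ^ 'n \<Rightarrow> real ^ 'n ^ 'n) \<Rightarrow> real ^ 'n \<Rightarrow> real" where
  "mean_curvature k G y =
     (\<Sum>e\<in>(SOME E. boundary_frame k G y E).
        metric_ip (G y) (cov_deriv k G y e (outward_normal k G)) e)"

section \<open>Compact Riemannian manifolds with boundary\<close>

record ('m, 'n) chart =
  source :: "'m set"
  coord :: "'m \<Rightarrow> real ^ 'n"

definition target :: "('m, 'n::finite) chart \<Rightarrow> (real ^ 'n) set" where
  "target c = coord c ` source c"

definition param :: "('m, 'n::finite) chart \<Rightarrow> real ^ 'n \<Rightarrow> 'm" where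
  "param c = inv_into (source c) (coord c)"

definition is_chart :: "'m topology \<Rightarrow> 'n::finite \<Rightarrow> ('m, 'n) chart \<Rightarrow> bool" where
  "is_chart T k c \<longleftrightarrow>
     openin T (source c) \<and> openin (top_of_set (half_space k)) (target c) \<and>
     homeomorphic_map (subtopology T (source c)) (top_of_set (target c)) (coord c)"

text \<open>
  The metric tensor is given by its component matrices in the charts of the atlas, as functions
  of the coordinates; the components in two charts are related by the tensor transformation law.
\<close>

record ('m, 'n) riem_structure =
  mtop :: "'m topology"
  idx :: "'n"
  atlas :: "('m, 'n) chart set"
  metric :: "('m, 'n) chart \<Rightarrow> real ^ 'n \<Rightarrow> real ^ 'n ^ 'n"

text \<open>
  Second countability need not be required, as it follows from compactness.
\<close>

definition compact_riemannian_manifold_with_boundary ::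
  "('m, 'n::finite) riem_structure \<Rightarrow> bool" where
  "compact_riemannian_manifold_with_boundary M \<longleftrightarrow>
     compact_space (mtop M) \<and> Hausdorff_space (mtop M) \<and>
     (\<forall>c\<in>atlas M. is_chart (mtop M) (idx M) c) \<and>
     (\<Union>c\<in>atlas M. source c) = topspace (mtop M) \<and>
     (\<forall>c\<in>atlas M. \<forall>i j. smooth_on (idx M) (target c) (\<lambda>y. metric M c y $ i $ j)) \<and>
     (\<forall>c\<in>atlas M. \<forall>y\<in>target c. sym_pos_def (metric M c y)) \<and>
     (\<forall>c\<in>atlas M. \<forall>c'\<in>atlas M.
        let S = coord c ` (source c \<inter> source c'); \<tau> = coord c' \<circ> param c in
          (\<forall>a. smooth_on (idx M) S (\<lambda>y. \<tau> y $ a)) \<and>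
          (\<forall>y\<in>S. let J = matrix (frechet_derivative \<tau> (at y within half_space (idx M)))
                 in metric M c y = transpose J ** metric M c' (\<tau> y) ** J))"

definition bdry :: "('m, 'n::finite) riem_structure \<Rightarrow> 'm set" where
  "bdry M = {p. \<exists>c\<in>atlas M. p \<in> source c \<and> coord c p $ idx M = 0}"

text \<open>
  \<open>is_curve_length M p q L\<close>: some piecewise \<open>C\<^sup>1\<close> curve from \<open>p\<close> to \<open>q\<close> has length \<open>L\<close>. The curve is
  subdivided such that each piece is \<open>C\<^sup>1\<close> up to its end points and stays within one chart, where
  \<open>\<gamma>\<close> is its coordinate expression. The values of \<open>\<gamma>\<close> outside the unit interval play no role.
\<close>

inductive is_curve_length ::
  "('m, 'n::finite) riem_structure \<Rightarrow> 'm \<Rightarrow> 'm \<Rightarrow> real \<Rightarrow> bool" for M where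
  const: "p \<in> topspace (mtop M) \<Longrightarrow> is_curve_length M p p 0"
| append: "\<lbrakk>is_curve_length M p q L; c \<in> atlas M;
     \<gamma> C1_differentiable_on {0..1}; \<gamma> ` {0..1} \<subseteq> target c; param c (\<gamma> 0) = q\<rbrakk> \<Longrightarrow>
   is_curve_length M p (param c (\<gamma> 1))
     (L + integral {0..1} (\<lambda>t. let V = vector_derivative \<gamma> (at t)
                                in sqrt (metric_ip (metric M c (\<gamma> t)) V V)))"

text \<open>The distance is infinite if there is no connecting curve.\<close>

definition riem_dist :: "('m, 'n::finite) riem_structure \<Rightarrow> 'm \<Rightarrow> 'm \<Rightarrow> ereal" where
  "riem_dist M p q = (INF L\<in>{L. is_curve_length M p q L}. ereal L)"

definition dist_to_bdry :: "('m, 'n::finite) riem_structure \<Rightarrow> 'm \<Rightarrow> ereal" where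
  "dist_to_bdry M p = (INF q\<in>bdry M. riem_dist M p q)"

definition is_inradius :: "('m, 'n::finite) riem_structure \<Rightarrow> real \<Rightarrow> bool" where
  "is_inradius M r \<longleftrightarrow>
     (\<exists>p\<in>topspace (mtop M). dist_to_bdry M p = ereal r) \<and>
     (\<forall>p\<in>topspace (mtop M). dist_to_bdry M p \<le> ereal r)"

definition nonneg_mean_curvature :: "('m, 'n::finite) riem_structure \<Rightarrow> bool" where
  "nonneg_mean_curvature M \<longleftrightarrow>
     (\<forall>c\<in>atlas M. \<forall>p\<in>source c \<inter> bdry M.
        0 \<le> mean_curvature (idx M) (metric M c) (coord c p))"

definition ricci_ge :: "('m, 'n::finite) riem_structure \<Rightarrow> real \<Rightarrow> bool" where
  "ricci_ge M K \<longleftrightarrow>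
     (\<forall>c\<in>atlas M. \<forall>y\<in>target c. \<forall>X.
        metric_ip (ricci (idx M) (metric M c) y) X X \<ge> K * metric_ip (metric M c y) X X)"

definition smooth_function :: "('m, 'n::finite) riem_structure \<Rightarrow> ('m \<Rightarrow> real) \<Rightarrow> bool" where
  "smooth_function M v \<longleftrightarrow> (\<forall>c\<in>atlas M. smooth_on (idx M) (target c) (v \<circ> param c))"

definition dirichlet_eigenvalue :: "('m, 'n::finite) riem_structure \<Rightarrow> real \<Rightarrow> bool" where
  "dirichlet_eigenvalue M \<mu> \<longleftrightarrow>
     (\<exists>v. smooth_function M v \<and> (\<exists>p\<in>topspace (mtop M). v p \<noteq> 0) \<and>
        (\<forall>c\<in>atlas M. \<forall>p\<in>source c.
           laplacian (idx M) (metric M c) (v \<circ> param c) (coord c p) = - \<mu> * v p) \<and>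
        (\<forall>p\<in>bdry M. v p = 0))"

definition first_dirichlet_eigenvalue :: "('m, 'n::finite) riem_structure \<Rightarrow> real \<Rightarrow> bool" where
  "first_dirichlet_eigenvalue M \<mu> \<longleftrightarrow>
     dirichlet_eigenvalue M \<mu> \<and> (\<forall>\<mu>'. dirichlet_eigenvalue M \<mu>' \<longrightarrow> \<mu> \<le> \<mu>')"

end

theory Submission
  imports Defs
begin

text \<open>
  Write \<open>c = - (n - 1) \<kappa>\<close> and let \<open>v\<close> be an eigenfunction with \<open>\<bar>v\<bar> \<le> V\<close>. The gradient of \<open>v\<close> is compared
  with that of a one-dimensional profile: \<open>|\<nabla>v|\<^sup>2 < z(v)\<close>, where \<open>z\<close> satisfies a strict differential
  inequality. Otherwise let \<open>\<alpha> \<ge> 1\<close> be the maximum of \<open>|\<nabla>v|\<^sup>2 / z(v)\<close>. Then \<open>P = |\<nabla>v|\<^sup>2 - \<alpha> z(v)\<close> has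
  maximum \<open>0\<close>. At a maximum point on the boundary the outward derivative of \<open>P\<close> is minus twice the mean
  curvature times \<open>|\<nabla>v|\<^sup>2\<close>, so it vanishes, and also there \<open>P\<close> has a critical point with
  \<open>\<Delta>P \<le> 0\<close>. Bochner's formula, with \<open>|Hess v|\<^sup>2\<close> bounded below by the square of the eigenvalue
  belonging to \<open>\<nabla>v\<close>, gives \<open>\<Delta>P > 0\<close>, a contradiction.

  Hence, if \<open>\<theta>' = 1 / sqrt z\<close>, the function \<open>\<theta>(v)\<close> is 1-Lipschitz along curves. Following curves from a
  maximum point of \<open>\<bar>v\<bar>\<close> to the boundary yields \<open>r \<ge> \<theta>(V)\<close>. For \<open>\<lambda> \<le> 0\<close> there are profiles with \<open>\<theta>(V)\<close>
  arbitrarily large, which is absurd, so \<open>\<lambda> > 0\<close>. For \<open>\<lambda> > 0\<close> and \<open>a\<^sup>2 > \<lambda> + c / 2\<close> every number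
  below \<open>\<pi> / (2 a)\<close> is attained as \<open>\<theta>(V)\<close>, whence \<open>\<lambda> + c / 2 \<ge> (\<pi> / (2 r))\<^sup>2\<close>.
\<close>

section \<open>Calculus on the half-space up to the boundary\<close>

lemma axis_in_half_space: "y \<in> half_space k \<Longrightarrow> 0 \<le> t \<Longrightarrow> y + t *\<^sub>R axis i 1 \<in> half_space k"
  by (auto simp: half_space_def axis_def)

text \<open>Even at a boundary point each coordinate direction can be followed inside the half-space
  for small positive times, which is enough to determine a derivative within it.\<close>

lemma half_space_derivative_unique:
  fixes f :: "real ^ 'n::finite \<Rightarrow> 'b::real_normed_vector"
  assumes "(f has_derivative D) (at y within half_space k)"
    and "(f has_derivative D') (at y within half_space k)" and "y \<in> half_space k"
  shows "D = D'"
proof (rule frechet_derivative_unique_within[OF assms(1,2)])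
  fix b :: "real ^ 'n" and e :: real
  assume b: "b \<in> Basis" and e: "0 < e"
  then obtain i where "b = axis i 1"
    by (auto simp: Basis_vec_def)
  then have "y + (e/2) *\<^sub>R b \<in> half_space k"
    using axis_in_half_space[OF assms(3)] e by simp
  then show "\<exists>d. 0 < \<bar>d\<bar> \<and> \<bar>d\<bar> < e \<and> y + d *\<^sub>R b \<in> half_space k"
    using e by (intro exI[of _ "e/2"]) auto
qed

text \<open>By uniqueness, the choice hidden in \<open>frechet_derivative\<close> can be evaluated
  from whichever derivative the usual rules produce.\<close>

lemma partial_eq:
  assumes "(f has_derivative D) (at y within half_space k)" and "y \<in> half_space k"
  shows "partial k i f y = D (axis i 1)"
proof -
  have "(f has_derivative frechet_derivative f (at y within half_space k)) (at y within half_space k)"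
    using assms(1) differentiable_def frechet_derivative_works by blast
  then show ?thesis
    using half_space_derivative_unique[OF _ assms] by (simp add: partial_def)
qed

lemma has_derivative_partial:
  assumes "f differentiable (at y within half_space k)"
  shows "(f has_derivative (\<lambda>X. \<Sum>i\<in>UNIV. X $ i * partial k i f y)) (at y within half_space k)"
proof -
  let ?D = "frechet_derivative f (at y within half_space k)"
  have D: "(f has_derivative ?D) (at y within half_space k)"
    using assms frechet_derivative_works by blast
  then have lin: "linear ?D"
    by (rule has_derivative_linear)
  have "?D X = (\<Sum>i\<in>UNIV. X $ i * partial k i f y)" for X
  proof -
    have "?D X = ?D (\<Sum>i\<in>UNIV. X $ i *\<^sub>R axis i 1)"
      using basis_expansion[of X] by (simp add: scalar_mult_eq_scaleR)
    then show ?thesis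
      by (simp add: linear_sum[OF lin] linear_scale[OF lin] partial_def)
  qed
  then have "?D = (\<lambda>X. \<Sum>i\<in>UNIV. X $ i * partial k i f y)" by blast
  with D show ?thesis by simp
qed

lemma partial_const [simp]: "y \<in> half_space k \<Longrightarrow> partial k i (\<lambda>_. c) y = 0"
  using partial_eq[OF has_derivative_const] by blast

lemma partial_add:
  assumes "y \<in> half_space k" "f differentiable (at y within half_space k)"
    "g differentiable (at y within half_space k)"
  shows "partial k i (\<lambda>z. f z + g z) y = partial k i f y + partial k i g y"
  using partial_eq[OF has_derivative_add[OF has_derivative_partial[OF assms(2)]
      has_derivative_partial[OF assms(3)]] assms(1)]
  by (simp add: axis_def if_distrib if_distribR cong: if_cong)

lemma partial_mult:
  assumes "y \<in> half_space k" "f differentiable (at y within half_space k)"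
    "g differentiable (at y within half_space k)"
  shows "partial k i (\<lambda>z. f z * g z) y = partial k i f y * g y + f y * partial k i g y"
  using partial_eq[OF has_derivative_mult[OF has_derivative_partial[OF assms(2)]
      has_derivative_partial[OF assms(3)]] assms(1)]
  by (simp add: axis_def if_distrib if_distribR cong: if_cong)

lemma partial_diff:
  assumes "y \<in> half_space k" "f differentiable (at y within half_space k)"
    "g differentiable (at y within half_space k)"
  shows "partial k i (\<lambda>z. f z - g z) y = partial k i f y - partial k i g y"
  using partial_eq[OF has_derivative_diff[OF has_derivative_partial[OF assms(2)]
      has_derivative_partial[OF assms(3)]] assms(1)]
  by (simp add: axis_def if_distrib if_distribR cong: if_cong)

lemma partial_sum:
  assumes "y \<in> half_space k" "\<And>j. j \<in> J \<Longrightarrow> f j differentiable (at y within half_space k)"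
  shows "partial k i (\<lambda>z. \<Sum>j\<in>J. f j z) y = (\<Sum>j\<in>J. partial k i (f j) y)"
proof -
  have "((\<lambda>z. \<Sum>j\<in>J. f j z) has_derivative (\<lambda>X. \<Sum>j\<in>J. \<Sum>i\<in>UNIV. X $ i * partial k i (f j) y))
    (at y within half_space k)"
    by (rule has_derivative_sum) (use assms(2) has_derivative_partial in blast)
  from partial_eq[OF this assms(1)] show ?thesis
    by (simp add: axis_def if_distrib if_distribR cong: if_cong)
qed

lemma has_derivative_real_compose:
  fixes f :: "real ^ 'n::finite \<Rightarrow> real"
  assumes "(h has_real_derivative h') (at (f y))" "(f has_derivative D) (at y within T)"
  shows "((\<lambda>z. h (f z)) has_derivative (\<lambda>X. h' * D X)) (at y within T)"
  using has_derivative_compose[OF assms(2), of h "\<lambda>x. h' * x"] assms(1)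
  by (simp add: has_field_derivative_def)

lemma partial_compose:
  assumes "y \<in> half_space k" "f differentiable (at y within half_space k)"
    "(h has_real_derivative h') (at (f y))"
  shows "partial k i (\<lambda>z. h (f z)) y = h' * partial k i f y"
  using partial_eq[OF has_derivative_real_compose[where f=f and y=y, OF assms(3) has_derivative_partial[OF assms(2)]] assms(1)]
  by (simp add: axis_def if_distrib if_distribR cong: if_cong)

lemma differentiable_compose_real:
  fixes f :: "real ^ 'n::finite \<Rightarrow> real"
  assumes "f differentiable (at y within T)" "(h has_real_derivative h') (at (f y))"
  shows "(\<lambda>z. h (f z)) differentiable (at y within T)"
  using assms has_derivative_real_compose unfolding differentiable_def by metis

text \<open>The parameter set \<open>T\<close> is left free because at a boundary point only a
  one-sided interval such as \<open>{0..e}\<close> may stay in the half-space.\<close>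

lemma line_derivative:
  fixes f :: "real ^ 'n::finite \<Rightarrow> real"
  assumes "f differentiable (at (p + s *\<^sub>R X) within half_space k)"
    and "\<And>t. t \<in> T \<Longrightarrow> p + t *\<^sub>R X \<in> half_space k"
  shows "((\<lambda>t. f (p + t *\<^sub>R X)) has_real_derivative (\<Sum>i\<in>UNIV. X $ i * partial k i f (p + s *\<^sub>R X)))
    (at s within T)"
proof -
  have 1: "((\<lambda>t. p + t *\<^sub>R X) has_derivative (\<lambda>t. t *\<^sub>R X)) (at s within T)"
    by (auto intro!: derivative_eq_intros)
  have 2: "(f has_derivative (\<lambda>X'. \<Sum>i\<in>UNIV. X' $ i * partial k i f (p + s *\<^sub>R X)))
      (at (p + s *\<^sub>R X) within (\<lambda>t. p + t *\<^sub>R X) ` T)"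
    using has_derivative_partial[OF assms(1)] by (rule has_derivative_subset) (use assms(2) in auto)
  have "((\<lambda>t. f (p + t *\<^sub>R X)) has_derivative
      (\<lambda>t. \<Sum>i\<in>UNIV. (t *\<^sub>R X) $ i * partial k i f (p + s *\<^sub>R X))) (at s within T)"
    using has_derivative_in_compose[OF 1 2] .
  moreover have "(\<lambda>t. \<Sum>i\<in>UNIV. (t *\<^sub>R X) $ i * partial k i f (p + s *\<^sub>R X))
      = (*) (\<Sum>i\<in>UNIV. X $ i * partial k i f (p + s *\<^sub>R X))"
    by (auto simp: fun_eq_iff sum_distrib_left ac_simps)
  ultimately show ?thesis
    by (simp add: has_field_derivative_def)
qed

lemma eventually_relatively_open:
  assumes "openin (top_of_set H) S" "y \<in> S"
  obtains e where "0 < e" "\<And>z. z \<in> H \<Longrightarrow> dist z y < e \<Longrightarrow> z \<in> S"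
  using assms unfolding openin_euclidean_subtopology_iff by blast

text \<open>A derivative within \<open>H\<close> depends only on values in a relative neighbourhood,
  so formulas valid only on a chart image can be differentiated there.\<close>

lemma differentiable_cong_open:
  assumes S: "openin (top_of_set H) S" "y \<in> S" and eq: "\<And>z. z \<in> S \<Longrightarrow> f z = g z"
    and f: "(f has_derivative D) (at y within H)"
  shows "(g has_derivative D) (at y within H)"
proof -
  obtain e where "0 < e" "\<And>z. z \<in> H \<Longrightarrow> dist z y < e \<Longrightarrow> z \<in> S"
    using eventually_relatively_open[OF S] by blast
  moreover have "y \<in> H" using S openin_imp_subset by blast
  ultimately show ?thesis
    using has_derivative_transform_within[OF f] eq by metis
qed

section \<open>Smooth functions on a relatively open subset of the half-space\<close>

locale half_chart =
  fixes k :: "'n::finite" and S :: "(real ^ 'n) set"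
  assumes openS: "openin (top_of_set (half_space k)) S"
begin

abbreviation "H \<equiv> half_space k"
abbreviation "smooth \<equiv> smooth_on k S"
abbreviation "pd \<equiv> partial k"

lemma S_sub: "y \<in> S \<Longrightarrow> y \<in> H"
  using openS openin_imp_subset by blast

lemma diff_cong:
  assumes "y \<in> S" "\<And>z. z \<in> S \<Longrightarrow> f z = g z" "f differentiable (at y within H)"
  shows "g differentiable (at y within H)"
proof -
  obtain D where "(f has_derivative D) (at y within H)"
    using assms(3) unfolding differentiable_def by blast
  from differentiable_cong_open[OF openS assms(1) _ this] show ?thesis
    using assms(2) unfolding differentiable_def by blast
qed

text \<open>Both functions have the same derivatives at \<open>y\<close>, if any, so the choice
  operator behind \<open>frechet_derivative\<close> yields the same value for both.\<close>

lemma partial_cong: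
  assumes "y \<in> S" "\<And>z. z \<in> S \<Longrightarrow> f z = g z"
  shows "pd i f y = pd i g y"
proof -
  have "(f has_derivative D) (at y within H) \<longleftrightarrow> (g has_derivative D) (at y within H)" for D
    using differentiable_cong_open[OF openS assms(1)] assms(2) by metis
  then show ?thesis
    by (simp add: partial_def frechet_derivative_def)
qed

text \<open>The rules for sums, products and inverses determine partial derivatives only on
  \<open>S\<close>, so the inductions on the order of differentiability pass through this
  congruence.\<close>

lemma Ck_cong:
  assumes "\<And>z. z \<in> S \<Longrightarrow> f z = g z" "Ck_on k m S f"
  shows "Ck_on k m S g"
  using assms
proof (induction m arbitrary: f g)
  case 0
  then show ?case by (metis Ck_on.simps(1) continuous_on_cong)
next
  case (Suc m)
  have "Ck_on k m S (pd i g)" for i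
    by (rule Suc.IH[of "pd i f"]) (use Suc.prems in \<open>auto intro: partial_cong\<close>)
  moreover have "g differentiable (at y within H)" if "y \<in> S" for y
    using diff_cong[OF that Suc.prems(1)] Suc.prems(2) that by simp
  ultimately show ?case by simp
qed

lemma Ck_SucD:
  assumes "Ck_on k (Suc m) S f" shows "Ck_on k m S f"
  using assms
proof (induction m arbitrary: f)
  case 0
  then have "f differentiable (at y within S)" if "y \<in> S" for y
    using that S_sub by (metis Ck_on.simps(2) differentiable_within_subset subsetI)
  then show ?case
    by (simp add: continuous_on_eq_continuous_within differentiable_imp_continuous_within)
next
  case (Suc m)
  then show ?case by auto
qed

lemma Ck_const: "Ck_on k m S (\<lambda>_. c)"
proof (induction m arbitrary: c)
  case (Suc m)
  have "Ck_on k m S (pd i (\<lambda>_. c))" for i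
    by (rule Ck_cong[OF _ Suc[of 0]]) (simp add: S_sub)
  then show ?case by simp
qed simp

lemma Ck_add: "Ck_on k m S f \<Longrightarrow> Ck_on k m S g \<Longrightarrow> Ck_on k m S (\<lambda>y. f y + g y)"
proof (induction m arbitrary: f g)
  case 0
  then show ?case by (auto intro: continuous_intros)
next
  case (Suc m)
  have "Ck_on k m S (pd i (\<lambda>y. f y + g y))" for i
    by (rule Ck_cong[OF _ Suc.IH[of "pd i f" "pd i g"]])
      (use Suc.prems in \<open>auto simp: partial_add S_sub\<close>)
  then show ?case using Suc.prems by (auto intro: derivative_intros)
qed

lemma Ck_mult: "Ck_on k m S f \<Longrightarrow> Ck_on k m S g \<Longrightarrow> Ck_on k m S (\<lambda>y. f y * g y)"
proof (induction m arbitrary: f g)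
  case 0
  then show ?case by (auto intro: continuous_intros)
next
  case (Suc m)
  have "Ck_on k m S (\<lambda>y. pd i f y * g y + f y * pd i g y)" for i
    using Suc.prems by (intro Ck_add Suc.IH) (auto intro: Ck_SucD simp del: Ck_on.simps(2), auto)
  then have "Ck_on k m S (pd i (\<lambda>y. f y * g y))" for i
    by (rule Ck_cong[rotated]) (use Suc.prems in \<open>auto simp: partial_mult S_sub\<close>)
  then show ?case using Suc.prems by (auto intro: derivative_intros)
qed

text \<open>The induction hypothesis first makes \<open>inverse (f y)\<close> itself of order
  \<open>m\<close>; its partial derivatives are then products of functions of that order.\<close>

lemma Ck_inverse: "Ck_on k m S f \<Longrightarrow> (\<And>y. y \<in> S \<Longrightarrow> f y \<noteq> 0) \<Longrightarrow> Ck_on k m S (\<lambda>y. inverse (f y))"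
proof (induction m arbitrary: f)
  case 0
  then show ?case by (auto intro!: continuous_intros)
next
  case (Suc m)
  have inv: "Ck_on k m S (\<lambda>y. inverse (f y))"
    using Suc.IH Suc.prems Ck_SucD by blast
  have d: "(inverse has_real_derivative - (inverse (f y) * inverse (f y))) (at (f y))" if "y \<in> S" for y
    using Suc.prems(2)[OF that] by (auto intro!: derivative_eq_intros)
  have "Ck_on k m S (\<lambda>y. (- 1) * ((inverse (f y) * inverse (f y)) * pd i f y))" for i
    using Suc.prems by (intro Ck_mult inv Ck_const) auto
  then have "Ck_on k m S (pd i (\<lambda>y. inverse (f y)))" for i
    by (rule Ck_cong[rotated]) (use Suc.prems in \<open>auto simp: partial_compose[OF S_sub _ d]\<close>)
  then show ?case using Suc.prems d differentiable_compose_real by fastforce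
qed

lemma smooth_cong: "smooth f \<Longrightarrow> (\<And>z. z \<in> S \<Longrightarrow> f z = g z) \<Longrightarrow> smooth g"
  unfolding smooth_on_def using Ck_cong by blast

lemma smooth_const [intro]: "smooth (\<lambda>_. c)"
  unfolding smooth_on_def using Ck_const by blast

lemma smooth_add [intro]: "smooth f \<Longrightarrow> smooth g \<Longrightarrow> smooth (\<lambda>y. f y + g y)"
  unfolding smooth_on_def using Ck_add by blast

lemma smooth_mult [intro]: "smooth f \<Longrightarrow> smooth g \<Longrightarrow> smooth (\<lambda>y. f y * g y)"
  unfolding smooth_on_def using Ck_mult by blast

lemma smooth_inverse: "smooth f \<Longrightarrow> (\<And>y. y \<in> S \<Longrightarrow> f y \<noteq> 0) \<Longrightarrow> smooth (\<lambda>y. inverse (f y))"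
  unfolding smooth_on_def using Ck_inverse by blast

lemma smooth_minus [intro]: "smooth f \<Longrightarrow> smooth (\<lambda>y. - f y)"
  using smooth_mult[OF smooth_const[of "-1"]] by fastforce

lemma smooth_diff [intro]: "smooth f \<Longrightarrow> smooth g \<Longrightarrow> smooth (\<lambda>y. f y - g y)"
  using smooth_add[OF _ smooth_minus] by fastforce

lemma smooth_divide: "smooth f \<Longrightarrow> smooth g \<Longrightarrow> (\<And>y. y \<in> S \<Longrightarrow> g y \<noteq> 0) \<Longrightarrow> smooth (\<lambda>y. f y / g y)"
  using smooth_mult[OF _ smooth_inverse] by (simp add: divide_inverse)

lemma smooth_sum [intro]: "(\<And>j. j \<in> J \<Longrightarrow> smooth (f j)) \<Longrightarrow> smooth (\<lambda>y. \<Sum>j\<in>J. f j y)"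
  by (induction J rule: infinite_finite_induct) auto

lemma smooth_prod [intro]: "(\<And>j. j \<in> J \<Longrightarrow> smooth (f j)) \<Longrightarrow> smooth (\<lambda>y. \<Prod>j\<in>J. f j y)"
  by (induction J rule: infinite_finite_induct) auto

lemma smooth_partial [intro]: "smooth f \<Longrightarrow> smooth (pd i f)"
  unfolding smooth_on_def by (metis Ck_on.simps(2))

lemma smooth_differentiable: "smooth f \<Longrightarrow> y \<in> S \<Longrightarrow> f differentiable (at y within H)"
  unfolding smooth_on_def by (metis Ck_on.simps(2))

lemma smooth_continuous: "smooth f \<Longrightarrow> continuous_on S f"
  unfolding smooth_on_def by (metis Ck_on.simps(1))

text \<open>Two applications of the mean value theorem, first in direction \<open>i\<close> and then
  in direction \<open>j\<close>. Only positive increments occur, so that a small square fits into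
  the half-space at boundary points too.\<close>

lemma mixed_difference:
  assumes f: "smooth f" and h: "0 < h"
    and sub: "\<And>s t. 0 \<le> s \<Longrightarrow> s \<le> h \<Longrightarrow> 0 \<le> t \<Longrightarrow> t \<le> h \<Longrightarrow> y + t *\<^sub>R axis j 1 + s *\<^sub>R axis i 1 \<in> S"
  shows "\<exists>s t. 0 < s \<and> s < h \<and> 0 < t \<and> t < h \<and>
    f (y + h *\<^sub>R axis j 1 + h *\<^sub>R axis i 1) - f (y + h *\<^sub>R axis j 1) - f (y + h *\<^sub>R axis i 1) + f y
      = h * h * pd j (pd i f) (y + t *\<^sub>R axis j 1 + s *\<^sub>R axis i 1)"
proof -
  have axs: "(\<Sum>l\<in>UNIV. (axis i 1 :: real ^ 'n) $ l * c l) = c i" for i and c :: "'n \<Rightarrow> real"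
    by (simp add: axis_def if_distrib if_distribR cong: if_cong)
  have d1: "((\<lambda>s. f (y + t *\<^sub>R axis j 1 + s *\<^sub>R axis i 1)) has_real_derivative
      pd i f (y + t *\<^sub>R axis j 1 + s *\<^sub>R axis i 1)) (at s within {0..h})"
    if "0 \<le> t" "t \<le> h" "0 \<le> s" "s \<le> h" for s t
    using line_derivative[of f "y + t *\<^sub>R axis j 1" s "axis i 1" k "{0..h}"]
      smooth_differentiable[OF f sub[of s t]] S_sub sub that by (simp add: axs)
  \<comment> \<open>\<open>?w\<close> is the increment of \<open>f\<close> across the square in
    direction \<open>j\<close>; thus \<open>?w h - ?w 0\<close> is the second difference.\<close>
  let ?w = "\<lambda>s. f (y + h *\<^sub>R axis j 1 + s *\<^sub>R axis i 1) - f (y + 0 *\<^sub>R axis j 1 + s *\<^sub>R axis i 1)"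
  let ?w' = "\<lambda>s. pd i f (y + h *\<^sub>R axis j 1 + s *\<^sub>R axis i 1) - pd i f (y + 0 *\<^sub>R axis j 1 + s *\<^sub>R axis i 1)"
  have "(?w has_derivative (\<lambda>x. ?w' s * x)) (at s within {0..h})" if "0 \<le> s" "s \<le> h" for s
    using DERIV_diff[OF d1[of h s] d1[of 0 s]] that h by (simp add: has_field_derivative_def)
  then obtain s where s: "0 < s" "s < h" "?w h - ?w 0 = ?w' s * (h - 0)"
    using mvt_simple[OF h, of ?w "\<lambda>s x. ?w' s * x"] by auto
  have d2: "((\<lambda>t. pd i f ((y + s *\<^sub>R axis i 1) + t *\<^sub>R axis j 1)) has_real_derivative
      pd j (pd i f) ((y + s *\<^sub>R axis i 1) + t *\<^sub>R axis j 1)) (at t within {0..h})"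
    if "0 \<le> t" "t \<le> h" for t
  proof -
    have eq: "(y + s *\<^sub>R axis i 1) + t *\<^sub>R axis j 1 = y + t *\<^sub>R axis j 1 + s *\<^sub>R axis i 1" for t
      by (simp add: add_ac)
    show ?thesis
      using line_derivative[of "pd i f" "y + s *\<^sub>R axis i 1" t "axis j 1" k "{0..h}"]
        smooth_differentiable[OF smooth_partial[OF f] sub[of s t]] S_sub sub s that
      unfolding eq by (simp add: axs)
  qed
  obtain t where t: "0 < t" "t < h" "pd i f ((y + s *\<^sub>R axis i 1) + h *\<^sub>R axis j 1) -
      pd i f ((y + s *\<^sub>R axis i 1) + 0 *\<^sub>R axis j 1) = pd j (pd i f) ((y + s *\<^sub>R axis i 1) + t *\<^sub>R axis j 1) * (h - 0)"
    using mvt_simple[OF h, of "\<lambda>t. pd i f ((y + s *\<^sub>R axis i 1) + t *\<^sub>R axis j 1)"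
      "\<lambda>t x. pd j (pd i f) ((y + s *\<^sub>R axis i 1) + t *\<^sub>R axis j 1) * x"] d2
    by (auto simp: has_field_derivative_def)
  have "?w h - ?w 0 = h * h * pd j (pd i f) (y + t *\<^sub>R axis j 1 + s *\<^sub>R axis i 1)"
    using s(3) t(3) by (simp add: add_ac)
  then show ?thesis
    using s t by (intro exI[of _ s] exI[of _ t]) (simp add: algebra_simps)
qed

text \<open>Schwarz's theorem up to the boundary: the second difference is symmetric in
  \<open>i\<close> and \<open>j\<close>, hence equal to \<open>h * h\<close> times either mixed
  derivative at some nearby point, and both mixed derivatives are continuous.\<close>

lemma partial_commute:
  assumes f: "smooth f" and y: "y \<in> S"
  shows "pd i (pd j f) y = pd j (pd i f) y"
proof -
  obtain e where e: "0 < e" "\<And>z. z \<in> H \<Longrightarrow> dist z y < e \<Longrightarrow> z \<in> S"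
    using eventually_relatively_open[OF openS y] by blast
  define A B where "A = pd i (pd j f)" and "B = pd j (pd i f)"
  have cont: "continuous_on S A" "continuous_on S B"
    unfolding A_def B_def using f by (auto intro: smooth_continuous)
  have dist: "dist (y + t *\<^sub>R axis j 1 + s *\<^sub>R axis i 1) y \<le> \<bar>t\<bar> + \<bar>s\<bar>" for s t :: real and i j :: 'n
    using norm_triangle_ineq[of "t *\<^sub>R axis j (1::real)" "s *\<^sub>R axis i 1"] by (simp add: dist_norm)
  have "\<bar>A y - B y\<bar> < \<epsilon> + \<epsilon>" if eps: "\<epsilon> > 0" for \<epsilon>
  proof -
    obtain a where a: "0 < a" "\<And>z. z \<in> S \<Longrightarrow> dist z y < a \<Longrightarrow> dist (A z) (A y) < \<epsilon>"
      using cont(1) y eps unfolding continuous_on_iff by blast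
    obtain b where b: "0 < b" "\<And>z. z \<in> S \<Longrightarrow> dist z y < b \<Longrightarrow> dist (B z) (B y) < \<epsilon>"
      using cont(2) y eps unfolding continuous_on_iff by blast
    \<comment> \<open>One third leaves room for displacements up to \<open>2 * h\<close> within all
      three radii.\<close>
    define h where "h = min e (min a b) / 3"
    have h: "0 < h" "2 * h < e" "2 * h < a" "2 * h < b"
      using e a b by (auto simp: h_def)
    have in_S: "y + t *\<^sub>R axis j 1 + s *\<^sub>R axis i 1 \<in> S" if "0 \<le> s" "s \<le> h" "0 \<le> t" "t \<le> h" for s t i j
      using that h dist[of t j s i] S_sub[OF y] by (intro e) (auto intro!: axis_in_half_space)
    obtain s t where st: "0 < s" "s < h" "0 < t" "t < h"
      "f (y + h *\<^sub>R axis j 1 + h *\<^sub>R axis i 1) - f (y + h *\<^sub>R axis j 1) - f (y + h *\<^sub>R axis i 1) + f y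
      = h * h * B (y + t *\<^sub>R axis j 1 + s *\<^sub>R axis i 1)"
      unfolding B_def using mixed_difference[OF f h(1) in_S] by blast
    obtain s' t' where st': "0 < s'" "s' < h" "0 < t'" "t' < h"
      "f (y + h *\<^sub>R axis i 1 + h *\<^sub>R axis j 1) - f (y + h *\<^sub>R axis i 1) - f (y + h *\<^sub>R axis j 1) + f y
      = h * h * A (y + t' *\<^sub>R axis i 1 + s' *\<^sub>R axis j 1)"
      unfolding A_def using mixed_difference[OF f h(1) in_S] by blast
    have eq: "y + h *\<^sub>R axis i 1 + h *\<^sub>R axis j 1 = y + h *\<^sub>R axis j 1 + h *\<^sub>R axis i (1::real)"
      by (simp add: add_ac)
    have "h * h * A (y + t' *\<^sub>R axis i 1 + s' *\<^sub>R axis j 1) = h * h * B (y + t *\<^sub>R axis j 1 + s *\<^sub>R axis i 1)"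
      using st(5) st'(5) unfolding eq by linarith
    then have "A (y + t' *\<^sub>R axis i 1 + s' *\<^sub>R axis j 1) = B (y + t *\<^sub>R axis j 1 + s *\<^sub>R axis i 1)"
      using h(1) by simp
    moreover have "dist (A (y + t' *\<^sub>R axis i 1 + s' *\<^sub>R axis j 1)) (A y) < \<epsilon>"
      using dist[of t' i s' j] st' h by (intro a in_S) auto
    moreover have "dist (B (y + t *\<^sub>R axis j 1 + s *\<^sub>R axis i 1)) (B y) < \<epsilon>"
      using dist[of t j s i] st h by (intro b in_S) auto
    ultimately show ?thesis
      by (simp add: dist_real_def)
  qed
  \<comment> \<open>With half the difference as \<epsilon> the strict bound fails unless the
    difference is zero.\<close>
  from this[of "\<bar>A y - B y\<bar> / 2"] show ?thesis
    unfolding A_def B_def by force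
qed

section \<open>First- and second-order conditions at a maximum up to the boundary\<close>

text \<open>At a boundary point only directions pointing into the half-space are admissible.\<close>

lemma line_in_S:
  assumes y: "y \<in> S" and X: "0 < y $ k \<or> 0 \<le> X $ k"
  obtains e where "0 < e" "\<And>t. 0 \<le> t \<Longrightarrow> t \<le> e \<Longrightarrow> y + t *\<^sub>R X \<in> S"
proof -
  obtain a where a: "0 < a" "\<And>z. z \<in> H \<Longrightarrow> dist z y < a \<Longrightarrow> z \<in> S"
    using eventually_relatively_open[OF openS y] by blast
  define N where "N = norm X + 1"
  have N: "0 < N" "norm X < N" by (auto simp: N_def add_nonneg_pos)
  \<comment> \<open>\<open>a / N\<close> keeps the segment in the ball; if \<open>X\<close> points
    outward, \<open>y $ k / N\<close> also keeps the \<open>k\<close>-th coordinate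
    nonnegative.\<close>
  define e where "e = (if 0 \<le> X $ k then a / N else min (a / N) (y $ k / N))"
  have "0 < e" using N a X by (auto simp: e_def)
  moreover have "y + t *\<^sub>R X \<in> S" if t: "0 \<le> t" "t \<le> e" for t
  proof (rule a)
    have "t \<le> a / N" using t by (auto simp: e_def split: if_splits)
    then have "t * N \<le> a" using N by (simp add: field_simps)
    show "dist (y + t *\<^sub>R X) y < a"
    proof (cases "t = 0")
      case False
      then have "t * norm X < t * N" using N t by simp
      then show ?thesis using \<open>t * N \<le> a\<close> t by (simp add: dist_norm)
    qed (use a in simp)
    have y0: "0 \<le> y $ k" using S_sub[OF y] by (simp add: half_space_def)
    show "y + t *\<^sub>R X \<in> H"
    proof (cases "0 \<le> X $ k")
      case True
      then show ?thesis using y0 t by (simp add: half_space_def)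
    next
      case False
      then have "t \<le> y $ k / N" using t by (simp add: e_def)
      then have "t * N \<le> y $ k" using N by (simp add: field_simps)
      moreover have "\<bar>X $ k\<bar> \<le> N" using component_le_norm_cart[of X k] N by simp
      then have "t * \<bar>X $ k\<bar> \<le> t * N" using t by (intro mult_left_mono)
      ultimately show ?thesis using False by (simp add: half_space_def)
    qed
  qed
  ultimately show ?thesis using that by blast
qed

text \<open>A positive one-sided derivative along an admissible ray would make \<open>P\<close>
  exceed its maximum just after the start.\<close>

lemma max_first_order:
  assumes y: "y \<in> S" and P: "P differentiable (at y within H)"
    and max: "\<And>z. z \<in> S \<Longrightarrow> P z \<le> P y" and X: "0 < y $ k \<or> 0 \<le> X $ k"
  shows "(\<Sum>i\<in>UNIV. X $ i * pd i P y) \<le> 0"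
proof (rule ccontr)
  assume neg: "\<not> ?thesis"
  obtain e where e: "0 < e" "\<And>t. 0 \<le> t \<Longrightarrow> t \<le> e \<Longrightarrow> y + t *\<^sub>R X \<in> S"
    using line_in_S[OF y X] by blast
  have "((\<lambda>t. P (y + t *\<^sub>R X)) has_real_derivative (\<Sum>i\<in>UNIV. X $ i * pd i P (y + 0 *\<^sub>R X)))
      (at 0 within {0..e})"
    by (rule line_derivative) (use P e S_sub in auto)
  from has_real_derivative_pos_inc_right[OF this] neg
  obtain d where d: "0 < d" "\<And>h. 0 < h \<Longrightarrow> h \<in> {0..e} \<Longrightarrow> h < d \<Longrightarrow> P (y + 0 *\<^sub>R X) < P (y + h *\<^sub>R X)"
    by (auto simp: not_le)
  have "P y < P (y + (min e d / 2) *\<^sub>R X)"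
    using d(2)[of "min e d / 2"] e d(1) by simp
  then show False
    using max[OF e(2), of "min e d / 2"] e(1) d(1) by force
qed

text \<open>The derivative \<open>u\<close> of \<open>P\<close> along the ray vanishes at the start.
  If the second derivative were positive, \<open>u\<close> would be positive just afterwards, and
  the mean value theorem would make \<open>P\<close> exceed \<open>P y\<close>.\<close>

lemma max_second_order_aux:
  assumes y: "y \<in> S" and P: "\<And>z. z \<in> S \<Longrightarrow> P differentiable (at z within H)"
    and dP: "\<And>i. pd i P differentiable (at y within H)" and crit: "\<And>i. pd i P y = 0"
    and max: "\<And>z. z \<in> S \<Longrightarrow> P z \<le> P y" and X: "0 < y $ k \<or> 0 \<le> X $ k"
  shows "(\<Sum>i\<in>UNIV. \<Sum>j\<in>UNIV. X $ i * X $ j * pd j (pd i P) y) \<le> 0"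
proof (rule ccontr)
  assume neg: "\<not> ?thesis"
  obtain e where e: "0 < e" "\<And>t. 0 \<le> t \<Longrightarrow> t \<le> e \<Longrightarrow> y + t *\<^sub>R X \<in> S"
    using line_in_S[OF y X] by blast
  define u where "u t = (\<Sum>i\<in>UNIV. X $ i * pd i P (y + t *\<^sub>R X))" for t
  have p: "((\<lambda>t. P (y + t *\<^sub>R X)) has_real_derivative u t) (at t within {0..e})" if "0 \<le> t" "t \<le> e" for t
    unfolding u_def by (rule line_derivative) (use P e S_sub that in auto)
  have "((\<lambda>t. pd i P (y + t *\<^sub>R X)) has_real_derivative (\<Sum>j\<in>UNIV. X $ j * pd j (pd i P) (y + 0 *\<^sub>R X)))
      (at 0 within {0..e})" for i
    by (rule line_derivative) (use dP e S_sub in auto)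
  then have "(u has_real_derivative (\<Sum>i\<in>UNIV. X $ i * (\<Sum>j\<in>UNIV. X $ j * pd j (pd i P) (y + 0 *\<^sub>R X))))
      (at 0 within {0..e})"
    unfolding u_def by (intro DERIV_sum DERIV_cmult)
  from has_real_derivative_pos_inc_right[OF this] neg
  obtain d where d: "0 < d" "\<And>h. 0 < h \<Longrightarrow> h \<in> {0..e} \<Longrightarrow> h < d \<Longrightarrow> u 0 < u h"
    by (auto simp: not_le sum_distrib_left mult.assoc)
  have u0: "u 0 = 0" by (simp add: u_def crit)
  define h where "h = min e d / 2"
  have h: "0 < h" "h \<le> e" "h < d" using e d by (auto simp: h_def)
  have "((\<lambda>t. P (y + t *\<^sub>R X)) has_derivative (\<lambda>x. u t * x)) (at t within {0..h})" if "0 \<le> t" "t \<le> h" for t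
    using p[of t] that h by (auto simp: has_field_derivative_def intro: has_derivative_subset)
  then obtain t where t: "0 < t" "t < h" "P (y + h *\<^sub>R X) - P (y + 0 *\<^sub>R X) = u t * (h - 0)"
    using mvt_simple[OF h(1), of "\<lambda>t. P (y + t *\<^sub>R X)" "\<lambda>t x. u t * x"] by auto
  then have "0 < u t * h"
    using d(2)[of t] h u0 by auto
  then show False
    using t max[OF e(2), of h] h by auto
qed

text \<open>The quadratic form is even in \<open>X\<close>, and at least one of \<open>X\<close> and
  \<open>- X\<close> does not point out of the half-space. Hence at a critical maximum the whole
  Hessian is nonpositive, even on the boundary.\<close>

lemma max_second_order:
  assumes y: "y \<in> S" and P: "\<And>z. z \<in> S \<Longrightarrow> P differentiable (at z within H)"
    and dP: "\<And>i. pd i P differentiable (at y within H)" and crit: "\<And>i. pd i P y = 0"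
    and max: "\<And>z. z \<in> S \<Longrightarrow> P z \<le> P y"
  shows "(\<Sum>i\<in>UNIV. \<Sum>j\<in>UNIV. X $ i * X $ j * pd j (pd i P) y) \<le> 0"
proof (cases "0 \<le> X $ k")
  case True
  then show ?thesis using max_second_order_aux[OF y P dP crit max] by blast
next
  case False
  then show ?thesis using max_second_order_aux[OF y P dP crit max, where X = "- X"] by simp
qed

end

section \<open>Linear algebra of positive definite matrices\<close>

lemma metric_ip_add_left: "metric_ip A (X + Y) Z = metric_ip A X Z + metric_ip A Y Z"
  by (simp add: metric_ip_def inner_left_distrib)

lemma metric_ip_add_right: "metric_ip A X (Y + Z) = metric_ip A X Y + metric_ip A X Z"
  by (simp add: metric_ip_def inner_right_distrib matrix_vector_right_distrib)

lemma metric_ip_scale_left: "metric_ip A (a *\<^sub>R X) Y = a * metric_ip A X Y"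
  by (simp add: metric_ip_def)

lemma metric_ip_scale_right: "metric_ip A X (a *\<^sub>R Y) = a * metric_ip A X Y"
  by (simp add: metric_ip_def matrix_vector_mult_scaleR)

lemma metric_ip_zero [simp]: "metric_ip A 0 X = 0" "metric_ip A X 0 = 0"
  by (simp_all add: metric_ip_def)

lemma metric_ip_minus: "metric_ip A (- X) Y = - metric_ip A X Y" "metric_ip A X (- Y) = - metric_ip A X Y"
  using metric_ip_scale_left[of A "-1"] metric_ip_scale_right[of A X "-1"] by auto

lemma metric_ip_diff_right: "metric_ip A X (Y - Z) = metric_ip A X Y - metric_ip A X Z"
  using metric_ip_add_right[of A X Y "- Z"] by (simp add: metric_ip_minus)

lemma metric_ip_sum_right: "metric_ip A X (\<Sum>e\<in>B. f e) = (\<Sum>e\<in>B. metric_ip A X (f e))"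
  by (induction B rule: infinite_finite_induct) (auto simp: metric_ip_add_right)

lemmas metric_ip_linear = metric_ip_add_left metric_ip_add_right metric_ip_scale_left
  metric_ip_scale_right metric_ip_minus metric_ip_diff_right metric_ip_sum_right

lemma metric_ip_expand: "metric_ip A X Y = (\<Sum>i\<in>UNIV. \<Sum>j\<in>UNIV. A $ i $ j * X $ i * Y $ j)"
  by (simp add: metric_ip_def inner_vec_def matrix_vector_mult_def sum_distrib_left ac_simps)

section \<open>Orthonormal frames and traces\<close>

definition orthonormal_on :: "real ^ 'n ^ 'n::finite \<Rightarrow> (real ^ 'n) set \<Rightarrow> bool" where
  "orthonormal_on A B \<longleftrightarrow>
     finite B \<and> (\<forall>e\<in>B. \<forall>f\<in>B. metric_ip A e f = (if e = f then 1 else 0))"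

locale pos_def =
  fixes A :: "real ^ 'n ^ 'n::finite"
  assumes spd: "sym_pos_def A"
begin

abbreviation "ip \<equiv> metric_ip A"

lemma pos: "X \<noteq> 0 \<Longrightarrow> 0 < ip X X"
  using spd by (simp add: sym_pos_def_def)

lemma nonneg: "0 \<le> ip X X"
  using pos[of X] by (cases "X = 0") auto

lemma sym: "A $ i $ j = A $ j $ i"
proof -
  have "transpose A $ i $ j = A $ i $ j" using spd by (simp add: sym_pos_def_def)
  then show ?thesis by (simp add: transpose_def)
qed

lemma ip_sym: "ip X Y = ip Y X"
  unfolding metric_ip_expand by (subst sum.swap) (simp add: sym ac_simps)

lemma inverse_right: "A ** matrix_inv A = mat 1" and inverse_left: "matrix_inv A ** A = mat 1"
proof -
  have "X = 0" if "A *v X = 0" for X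
    using pos[of X] that by (auto simp: metric_ip_def)
  then have "invertible A"
    using matrix_left_invertible_ker invertible_left_inverse by blast
  then show "A ** matrix_inv A = mat 1" "matrix_inv A ** A = mat 1"
    unfolding invertible_def matrix_inv_def by (metis (mono_tags, lifting) someI_ex)+
qed

lemma mul_inv: "A *v (matrix_inv A *v X) = X" "matrix_inv A *v (A *v X) = X"
  by (simp_all add: matrix_vector_mul_assoc inverse_right inverse_left)

lemma inverse_right_sum: "(\<Sum>m\<in>UNIV. A $ i $ m * matrix_inv A $ m $ j) = (if i = j then 1 else 0)"
  using arg_cong[OF inverse_right, of "\<lambda>M. M $ i $ j"] by (simp add: matrix_matrix_mult_def mat_def)

lemma det_nz: "det A \<noteq> 0"
  using inverse_right det_mul[of A "matrix_inv A"] by auto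

lemma orthonormal_insert_unit:
  assumes B: "orthonormal_on A B" and N: "ip N N = 1" "\<And>e. e \<in> B \<Longrightarrow> ip e N = 0"
  shows "orthonormal_on A (insert N B)"
proof -
  have N': "ip N e = 0" if "e \<in> B" for e
    using N(2)[OF that] by (simp add: ip_sym)
  have "N \<notin> B" using N(2)[of N] N(1) by auto
  then show ?thesis
    using B N N' unfolding orthonormal_on_def by auto
qed

lemma orthonormal_insert:
  assumes B: "orthonormal_on A B" and y: "y \<noteq> 0" "\<And>e. e \<in> B \<Longrightarrow> ip e y = 0"
  defines "y' \<equiv> (1 / sqrt (ip y y)) *\<^sub>R y"
  shows "orthonormal_on A (insert y' B)" and "y' \<notin> B"
proof -
  have 1: "ip y' y' = 1"
    using pos[OF y(1)] by (simp add: y'_def metric_ip_linear)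
  have 2: "ip e y' = 0" if "e \<in> B" for e
    using y(2)[OF that] by (simp add: y'_def metric_ip_linear)
  show "y' \<notin> B" using 1 2[of y'] by auto
  show "orthonormal_on A (insert y' B)"
    using orthonormal_insert_unit[OF B 1 2] .
qed

text \<open>Pairing a linear relation with a member of \<open>B\<close> isolates its
  coefficient.\<close>

lemma orthonormal_card:
  assumes B: "orthonormal_on A B" and V: "subspace V" "B \<subseteq> V"
  shows "independent B" and "card B \<le> dim V"
proof -
  have fin: "finite B" using B by (simp add: orthonormal_on_def)
  have "u f = 0" if "(\<Sum>e\<in>B. u e *\<^sub>R e) = 0" "f \<in> B" for u f
  proof -
    have "0 = ip f (\<Sum>e\<in>B. u e *\<^sub>R e)" using that by simp
    also have "\<dots> = (\<Sum>e\<in>B. u e * (if f = e then 1 else 0))"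
      unfolding metric_ip_linear using B that by (intro sum.cong) (auto simp: orthonormal_on_def)
    also have "\<dots> = u f" using fin that by (simp add: if_distrib cong: if_cong)
    finally show ?thesis by simp
  qed
  then show ind: "independent B"
    using fin by (auto simp: independent_explicit)
  show "card B \<le> dim V"
    using independent_card_le_dim[OF V(2) ind] .
qed

lemma residual_orthogonal:
  assumes B: "orthonormal_on A B" and f: "f \<in> B"
  shows "ip f (x - (\<Sum>e\<in>B. ip e x *\<^sub>R e)) = 0"
proof -
  have fin: "finite B" using B by (simp add: orthonormal_on_def)
  have "ip f (\<Sum>e\<in>B. ip e x *\<^sub>R e) = (\<Sum>e\<in>B. ip e x * (if f = e then 1 else 0))"
    unfolding metric_ip_linear using B f by (intro sum.cong) (auto simp: orthonormal_on_def)
  also have "\<dots> = ip f x" using fin f by (simp add: if_distrib cong: if_cong)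
  finally show ?thesis by (simp add: metric_ip_linear)
qed

text \<open>Gram-Schmidt, one vector at a time: with fewer than \<open>dim V\<close> vectors some
  element of \<open>V\<close> lies outside their span. This serves both the whole space and the
  tangent hyperplane of the boundary.\<close>

lemma orthonormal_extend:
  assumes V: "subspace V" and B0: "orthonormal_on A B0" "B0 \<subseteq> V"
  obtains B where "B0 \<subseteq> B" "B \<subseteq> V" "orthonormal_on A B" "card B = dim V"
proof -
  have "card B0 \<le> dim V" using orthonormal_card[OF B0(1) V B0(2)] by blast
  then have "\<exists>B. B0 \<subseteq> B \<and> B \<subseteq> V \<and> orthonormal_on A B \<and> card B = dim V"
  proof (induction rule: dec_induct)
    case base
    then show ?case using B0 by blast
  next
    case (step n)
    then obtain B where B: "B0 \<subseteq> B" "B \<subseteq> V" "orthonormal_on A B" "card B = n" by blast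
    have "\<not> V \<subseteq> span B"
    proof
      assume "V \<subseteq> span B"
      then have "dim V \<le> card B"
        using dim_le_card[of V B] B(3) by (simp add: orthonormal_on_def)
      then show False using B(4) step by simp
    qed
    then obtain x where x: "x \<in> V" "x \<notin> span B" by blast
    define y where "y = x - (\<Sum>e\<in>B. ip e x *\<^sub>R e)"
    have "(\<Sum>e\<in>B. ip e x *\<^sub>R e) \<in> span B"
      by (simp add: span_base span_scale span_sum)
    then have "y \<noteq> 0" using x by (auto simp: y_def)
    moreover have "ip e y = 0" if "e \<in> B" for e
      unfolding y_def by (rule residual_orthogonal[OF B(3) that])
    ultimately have ins: "orthonormal_on A (insert ((1 / sqrt (ip y y)) *\<^sub>R y) B)"
      "(1 / sqrt (ip y y)) *\<^sub>R y \<notin> B"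
      using orthonormal_insert[OF B(3)] by blast+
    have "(\<Sum>e\<in>B. ip e x *\<^sub>R e) \<in> V"
      using B(2) V by (auto intro!: subspace_sum subspace_scale)
    then have "(1 / sqrt (ip y y)) *\<^sub>R y \<in> V"
      using x(1) V by (auto simp: y_def intro!: subspace_scale subspace_diff)
    moreover have "finite B" using B(3) by (simp add: orthonormal_on_def)
    ultimately show ?case
      using ins B by (intro exI[of _ "insert ((1 / sqrt (ip y y)) *\<^sub>R y) B"]) auto
  qed
  then show ?thesis using that by blast
qed

context
  fixes B
  assumes B: "orthonormal_on A B" and card_B: "card B = CARD('n)"
begin

text \<open>A nonzero residual, once normalized, would enlarge the frame beyond the dimension of the
  space.\<close>

lemma frame_expansion: "(\<Sum>e\<in>B. ip e x *\<^sub>R e) = x"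
proof (rule ccontr)
  define y where "y = x - (\<Sum>e\<in>B. ip e x *\<^sub>R e)"
  assume "\<not> ?thesis"
  then have "y \<noteq> 0" by (auto simp: y_def)
  moreover have "ip e y = 0" if "e \<in> B" for e
    unfolding y_def by (rule residual_orthogonal[OF B that])
  ultimately have ins: "orthonormal_on A (insert ((1 / sqrt (ip y y)) *\<^sub>R y) B)"
      "(1 / sqrt (ip y y)) *\<^sub>R y \<notin> B"
    using orthonormal_insert[OF B] by blast+
  from orthonormal_card(2)[OF ins(1) subspace_UNIV] ins(2) B card_B show False
    by (simp add: orthonormal_on_def dim_UNIV)
qed

text \<open>This is the frame expansion of \<open>matrix_inv A *v axis j 1\<close>, whose product
  with \<open>e\<close> is the coordinate \<open>e $ j\<close>.\<close>

lemma frame_inverse: "(\<Sum>e\<in>B. e $ i * e $ j) = matrix_inv A $ i $ j"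
proof -
  let ?x = "matrix_inv A *v axis j 1"
  have "ip e ?x = e $ j" for e
    by (simp add: metric_ip_def mul_inv inner_axis)
  moreover have "?x $ i = matrix_inv A $ i $ j"
    by (simp add: matrix_vector_mul_component inner_axis)
  ultimately show ?thesis
    using arg_cong[OF frame_expansion[of ?x], of "\<lambda>v. v $ i"] by (simp add: ac_simps)
qed

text \<open>The trace of an endomorphism is the same in every frame; this links traces over
  orthonormal frames with coordinate sums such as the divergence.\<close>

lemma frame_trace: "(\<Sum>e\<in>B. ip (L *v e) e) = (\<Sum>i\<in>UNIV. L $ i $ i)"
proof -
  \<comment> \<open>The covectors \<open>A *v e\<close> are dual to the frame, so these sums form
    the identity matrix.\<close>
  have *: "(\<Sum>e\<in>B. e $ j * (\<Sum>m\<in>UNIV. A $ i $ m * e $ m)) = (if i = j then 1 else 0)" for i j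
  proof -
    have "(\<Sum>e\<in>B. e $ j * (\<Sum>m\<in>UNIV. A $ i $ m * e $ m)) = (\<Sum>m\<in>UNIV. A $ i $ m * (\<Sum>e\<in>B. e $ m * e $ j))"
      unfolding sum_distrib_left by (subst sum.swap) (simp add: ac_simps)
    then show ?thesis by (simp add: frame_inverse inverse_right_sum)
  qed
  have "(\<Sum>e\<in>B. ip (L *v e) e)
      = (\<Sum>e\<in>B. \<Sum>i\<in>UNIV. \<Sum>j\<in>UNIV. L $ i $ j * (e $ j * (\<Sum>m\<in>UNIV. A $ i $ m * e $ m)))"
    by (simp add: metric_ip_def inner_vec_def matrix_vector_mult_def sum_distrib_right mult.assoc)
  also have "\<dots> = (\<Sum>i\<in>UNIV. \<Sum>e\<in>B. \<Sum>j\<in>UNIV. L $ i $ j * (e $ j * (\<Sum>m\<in>UNIV. A $ i $ m * e $ m)))"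
    by (rule sum.swap)
  also have "\<dots> = (\<Sum>i\<in>UNIV. \<Sum>j\<in>UNIV. \<Sum>e\<in>B. L $ i $ j * (e $ j * (\<Sum>m\<in>UNIV. A $ i $ m * e $ m)))"
    by (rule sum.cong[OF refl], rule sum.swap)
  also have "\<dots> = (\<Sum>i\<in>UNIV. L $ i $ i)"
    by (simp flip: sum_distrib_left add: * if_distrib cong: if_cong)
  finally show ?thesis .
qed

end

lemma frame_exists: obtains B where "orthonormal_on A B" "card B = CARD('n)"
proof -
  have "orthonormal_on A {}" by (simp add: orthonormal_on_def)
  from orthonormal_extend[OF subspace_UNIV this] show ?thesis
    using that by (auto simp: dim_UNIV)
qed

text \<open>Complete the normalized eigenvector to an orthonormal frame. By self-adjointness the
  trace of the square is the sum of the squared lengths of the images, to which the eigenvector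
  alone contributes \<open>\<mu>\<^sup>2\<close>.\<close>

lemma trace_square_ge:
  assumes self: "\<And>x y. ip (L *v x) y = ip x (L *v y)"
    and eig: "L *v X = \<mu> *\<^sub>R X" and X: "X \<noteq> 0"
  shows "\<mu>\<^sup>2 \<le> (\<Sum>i\<in>UNIV. \<Sum>j\<in>UNIV. L $ i $ j * L $ j $ i)"
proof -
  define e0 where "e0 = (1 / sqrt (ip X X)) *\<^sub>R X"
  have e0: "ip e0 e0 = 1"
    using pos[OF X] by (simp add: e0_def metric_ip_linear)
  then have "orthonormal_on A {e0}" by (simp add: orthonormal_on_def)
  from orthonormal_extend[OF subspace_UNIV this] obtain B
    where B: "e0 \<in> B" "orthonormal_on A B" "card B = CARD('n)"
    by (auto simp: dim_UNIV)
  have fin: "finite B" using B by (simp add: orthonormal_on_def)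
  have "L *v e0 = \<mu> *\<^sub>R e0"
    by (simp add: e0_def matrix_vector_mult_scaleR eig)
  then have "\<mu>\<^sup>2 = ip (L *v e0) (L *v e0)"
    by (simp add: metric_ip_linear e0 power2_eq_square)
  also have "\<dots> \<le> (\<Sum>e\<in>B. ip (L *v e) (L *v e))"
    using B(1) fin nonneg by (intro member_le_sum) auto
  also have "\<dots> = (\<Sum>e\<in>B. ip ((L ** L) *v e) e)"
    by (simp flip: matrix_vector_mul_assoc add: self)
  also have "\<dots> = (\<Sum>i\<in>UNIV. (L ** L) $ i $ i)"
    by (rule frame_trace[OF B(2,3)])
  finally show ?thesis by (simp add: matrix_matrix_mult_def)
qed

text \<open>In an orthonormal frame the contraction with the inverse metric is a sum of values of
  the quadratic form. Applied to second partial derivatives it gives the sign of the Laplacian at a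
  critical maximum.\<close>

lemma inverse_trace_nonpos:
  assumes "\<And>X. (\<Sum>i\<in>UNIV. \<Sum>j\<in>UNIV. X $ i * X $ j * D i j) \<le> 0"
  shows "(\<Sum>i\<in>UNIV. \<Sum>j\<in>UNIV. matrix_inv A $ i $ j * D i j) \<le> 0"
proof -
  obtain B where B: "orthonormal_on A B" "card B = CARD('n)" by (rule frame_exists)
  have "(\<Sum>i\<in>UNIV. \<Sum>j\<in>UNIV. matrix_inv A $ i $ j * D i j)
      = (\<Sum>i\<in>UNIV. \<Sum>j\<in>UNIV. \<Sum>e\<in>B. e $ i * e $ j * D i j)"
    by (simp add: sum_distrib_right flip: frame_inverse[OF B])
  also have "\<dots> = (\<Sum>i\<in>UNIV. \<Sum>e\<in>B. \<Sum>j\<in>UNIV. e $ i * e $ j * D i j)"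
    by (rule sum.cong[OF refl], rule sum.swap)
  also have "\<dots> = (\<Sum>e\<in>B. \<Sum>i\<in>UNIV. \<Sum>j\<in>UNIV. e $ i * e $ j * D i j)"
    by (rule sum.swap)
  also have "\<dots> \<le> 0" by (rule sum_nonpos) (rule assms)
  finally show ?thesis .
qed

end

text \<open>The algebraic core of Bochner's formula at one point. \<open>dX l i\<close> stands for
  the \<open>i\<close>-th partial derivative of the \<open>l\<close>-th component,
  \<open>ddX l i m\<close> for its derivative in direction \<open>m\<close>,
  \<open>d\<Gamma> l i j m\<close> for that of \<open>\<Gamma> l i j\<close>, and \<open>A\<close>
  for the covariant derivative.\<close>

lemma bochner_sums:
  fixes X :: "'n::finite \<Rightarrow> real" and dX :: "'n \<Rightarrow> 'n \<Rightarrow> real" and ddX \<Gamma> :: "'n \<Rightarrow> 'n \<Rightarrow> 'n \<Rightarrow> real"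
    and d\<Gamma> :: "'n \<Rightarrow> 'n \<Rightarrow> 'n \<Rightarrow> 'n \<Rightarrow> real" and A Ric :: "'n \<Rightarrow> 'n \<Rightarrow> real"
  assumes ddX: "\<And>l i m. ddX l i m = ddX l m i" and \<Gamma>: "\<And>l i j. \<Gamma> l i j = \<Gamma> l j i"
    and A: "\<And>l i. A l i = dX l i + (\<Sum>m\<in>UNIV. \<Gamma> l i m * X m)"
    and Ric: "\<And>b j. Ric b j = (\<Sum>a\<in>UNIV. d\<Gamma> a b j a - d\<Gamma> a a j b
        + (\<Sum>m\<in>UNIV. \<Gamma> a a m * \<Gamma> m b j - \<Gamma> a b m * \<Gamma> m a j))"
  shows "(\<Sum>l\<in>UNIV. (\<Sum>i\<in>UNIV. (ddX l i l + (\<Sum>j\<in>UNIV. d\<Gamma> l i j l * X j + \<Gamma> l i j * dX j l)) * X i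
            + A l i * dX i l) + (\<Sum>m\<in>UNIV. \<Gamma> l l m * (\<Sum>i\<in>UNIV. A m i * X i)))
    = (\<Sum>l\<in>UNIV. \<Sum>i\<in>UNIV. A l i * A i l)
      + (\<Sum>i\<in>UNIV. X i * (\<Sum>l\<in>UNIV. ddX l l i + (\<Sum>m\<in>UNIV. d\<Gamma> l l m i * X m + \<Gamma> l l m * dX m i)))
      + (\<Sum>b\<in>UNIV. \<Sum>j\<in>UNIV. Ric b j * X b * X j)"
proof -
  let ?S2 = "\<lambda>f. \<Sum>a\<in>UNIV. \<Sum>b\<in>(UNIV::'n set). f a (b::'n) :: real"
  let ?S3 = "\<lambda>f. \<Sum>a\<in>UNIV. \<Sum>b\<in>UNIV. \<Sum>c\<in>(UNIV::'n set). f a (b::'n) (c::'n) :: real"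
  let ?S4 = "\<lambda>f. \<Sum>a\<in>UNIV. \<Sum>b\<in>UNIV. \<Sum>c\<in>UNIV. \<Sum>d\<in>(UNIV::'n set). f a (b::'n) (c::'n) (d::'n) :: real"
  \<comment> \<open>The left side expands into the six \<open>T\<close> and \<open>U\<close> sums.
    The right side yields the same six, while \<open>W1\<close> and \<open>W2\<close> cancel between
    its three terms.\<close>
  define T1 where "T1 = ?S2 (\<lambda>l i. ddX l i l * X i)"
  define T2 where "T2 = ?S3 (\<lambda>l i j. d\<Gamma> l i j l * X j * X i)"
  define T3 where "T3 = ?S3 (\<lambda>l i j. \<Gamma> l i j * dX j l * X i)"
  define T4 where "T4 = ?S2 (\<lambda>l i. A l i * dX i l)"
  define U1 where "U1 = ?S3 (\<lambda>l m i. \<Gamma> l l m * dX m i * X i)"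
  define U2 where "U2 = ?S4 (\<lambda>l m i j. \<Gamma> l l m * \<Gamma> m i j * X j * X i)"
  define W1 where "W1 = ?S4 (\<lambda>l i j m. \<Gamma> l i j * X j * \<Gamma> i l m * X m)"
  define W2 where "W2 = ?S3 (\<lambda>l i j. d\<Gamma> l l j i * X j * X i)"
  have lhs: "(\<Sum>l\<in>UNIV. (\<Sum>i\<in>UNIV. (ddX l i l + (\<Sum>j\<in>UNIV. d\<Gamma> l i j l * X j + \<Gamma> l i j * dX j l)) * X i
            + A l i * dX i l) + (\<Sum>m\<in>UNIV. \<Gamma> l l m * (\<Sum>i\<in>UNIV. A m i * X i)))
    = T1 + T2 + T3 + T4 + (U1 + U2)"
  proof -
    have "(\<Sum>l\<in>UNIV. \<Sum>m\<in>UNIV. \<Gamma> l l m * (\<Sum>i\<in>UNIV. A m i * X i)) = U1 + U2"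
      unfolding U1_def U2_def
      by (simp add: A sum.distrib sum_distrib_left sum_distrib_right algebra_simps)
    moreover have "(\<Sum>l\<in>UNIV. \<Sum>i\<in>UNIV. (ddX l i l + (\<Sum>j\<in>UNIV. d\<Gamma> l i j l * X j + \<Gamma> l i j * dX j l)) * X i
            + A l i * dX i l) = T1 + T2 + T3 + T4"
      unfolding T1_def T2_def T3_def T4_def
      by (simp add: sum.distrib sum_distrib_left sum_distrib_right algebra_simps)
    ultimately show ?thesis by (simp add: sum.distrib)
  qed
  have r1: "(\<Sum>l\<in>UNIV. \<Sum>i\<in>UNIV. A l i * A i l) = T4 + (T3 + W1)"
  proof -
    have "(\<Sum>l\<in>UNIV. \<Sum>i\<in>UNIV. A l i * A i l) = T4 + ?S2 (\<lambda>l i. A l i * (\<Sum>m\<in>UNIV. \<Gamma> i l m * X m))"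
      unfolding T4_def by (simp add: A[of _ _] algebra_simps sum.distrib)
    also have "?S2 (\<lambda>l i. A l i * (\<Sum>m\<in>UNIV. \<Gamma> i l m * X m))
        = ?S3 (\<lambda>l i m. \<Gamma> i l m * dX l i * X m) + ?S4 (\<lambda>l i m j. \<Gamma> l i j * X j * \<Gamma> i l m * X m)"
      by (simp add: A sum.distrib sum_distrib_left sum_distrib_right algebra_simps)
    also have "?S4 (\<lambda>l i m j. \<Gamma> l i j * X j * \<Gamma> i l m * X m) = W1"
      unfolding W1_def by (rule sum.cong[OF refl], rule sum.cong[OF refl], rule sum.swap)
    also have "?S3 (\<lambda>l i m. \<Gamma> i l m * dX l i * X m) = ?S3 (\<lambda>i l m. \<Gamma> i l m * dX l i * X m)"
      by (rule sum.swap)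
    also have "\<dots> = ?S3 (\<lambda>i m l. \<Gamma> i l m * dX l i * X m)"
      by (rule sum.cong[OF refl], rule sum.swap)
    also have "\<dots> = T3"
      unfolding T3_def by (simp add: \<Gamma>)
    finally show ?thesis .
  qed
  have r2: "(\<Sum>i\<in>UNIV. X i * (\<Sum>l\<in>UNIV. ddX l l i + (\<Sum>m\<in>UNIV. d\<Gamma> l l m i * X m + \<Gamma> l l m * dX m i)))
      = T1 + W2 + U1"
  proof -
    have "(\<Sum>i\<in>UNIV. X i * (\<Sum>l\<in>UNIV. ddX l l i + (\<Sum>m\<in>UNIV. d\<Gamma> l l m i * X m + \<Gamma> l l m * dX m i)))
      = ?S2 (\<lambda>i l. ddX l l i * X i) + ?S3 (\<lambda>i l m. d\<Gamma> l l m i * X m * X i)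
        + ?S3 (\<lambda>i l m. \<Gamma> l l m * dX m i * X i)"
      by (simp add: sum.distrib sum_distrib_left algebra_simps)
    also have "?S2 (\<lambda>i l. ddX l l i * X i) = T1"
      unfolding T1_def by (subst sum.swap) (simp add: ddX)
    also have "?S3 (\<lambda>i l m. d\<Gamma> l l m i * X m * X i) = W2"
      unfolding W2_def by (rule sum.swap)
    also have "?S3 (\<lambda>i l m. \<Gamma> l l m * dX m i * X i) = ?S3 (\<lambda>l i m. \<Gamma> l l m * dX m i * X i)"
      by (rule sum.swap)
    also have "\<dots> = U1"
      unfolding U1_def by (rule sum.cong[OF refl], rule sum.swap)
    finally show ?thesis .
  qed
  have r3: "(\<Sum>b\<in>UNIV. \<Sum>j\<in>UNIV. Ric b j * X b * X j) = T2 - W2 + U2 - W1"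
  proof -
    have e: "(\<Sum>b\<in>UNIV. \<Sum>j\<in>UNIV. Ric b j * X b * X j)
      = ?S3 (\<lambda>b j a. d\<Gamma> a b j a * X j * X b) - ?S3 (\<lambda>b j a. d\<Gamma> a a j b * X j * X b)
        + ?S4 (\<lambda>b j a m. \<Gamma> a a m * \<Gamma> m b j * X j * X b)
        - ?S4 (\<lambda>b j a m. \<Gamma> a b m * X b * \<Gamma> m a j * X j)"
      unfolding Ric
      by (simp add: sum.distrib sum_subtractf sum_distrib_left sum_distrib_right algebra_simps)
    have s3: "?S3 (\<lambda>b j a. f b j a) = ?S3 (\<lambda>a b j. f b j a)" for f
    proof -
      have "?S3 (\<lambda>b j a. f b j a) = ?S3 (\<lambda>b a j. f b j a)"
        by (rule sum.cong[OF refl], rule sum.swap)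
      also have "\<dots> = ?S3 (\<lambda>a b j. f b j a)" by (rule sum.swap)
      finally show ?thesis .
    qed
    have s4: "?S4 (\<lambda>b j a m. f b j a m) = ?S4 (\<lambda>a m b j. f b j a m)" for f
    proof -
      have "?S4 (\<lambda>b j a m. f b j a m) = ?S4 (\<lambda>a b j m. f b j a m)"
        using s3[of "\<lambda>b j a. \<Sum>m\<in>UNIV. f b j a m"] .
      also have "\<dots> = ?S4 (\<lambda>a m b j. f b j a m)"
        by (rule sum.cong[OF refl], rule s3)
      finally show ?thesis .
    qed
    have "?S3 (\<lambda>b j a. d\<Gamma> a b j a * X j * X b) = T2" unfolding T2_def by (rule s3)
    moreover have "?S3 (\<lambda>b j a. d\<Gamma> a a j b * X j * X b) = W2" unfolding W2_def by (rule s3)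
    moreover have "?S4 (\<lambda>b j a m. \<Gamma> a a m * \<Gamma> m b j * X j * X b) = U2" unfolding U2_def by (rule s4)
    moreover have "?S4 (\<lambda>b j a m. \<Gamma> a b m * X b * \<Gamma> m a j * X j) = W1"
      unfolding W1_def by (subst s4) (intro sum.cong refl, simp add: \<Gamma>)
    ultimately show ?thesis using e by linarith
  qed
  show ?thesis unfolding lhs r1 r2 r3 by simp
qed

section \<open>Levi-Civita calculus and the Bochner formula in a chart\<close>

text \<open>The covariant derivative of a field as an endomorphism of the tangent space; for a
  gradient field it is the Hessian with one index raised. The matrix form gives access to its trace,
  its square and its eigenvectors.\<close>

definition nabla ::
  "'n::finite \<Rightarrow> (real ^ 'n \<Rightarrow> real ^ 'n ^ 'n) \<Rightarrow> (real ^ 'n \<Rightarrow> real ^ 'n) \<Rightarrow> real ^ 'n \<Rightarrow> real ^ 'n ^ 'n" where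
  "nabla k G X y = (\<chi> l j. partial k j (\<lambda>z. X z $ l) y + (\<Sum>m\<in>UNIV. christoffel k G l j m y * X y $ m))"

lemma cov_deriv_nabla: "cov_deriv k G y V X = nabla k G X y *v V"
  by (simp add: cov_deriv_def nabla_def vec_eq_iff matrix_vector_mult_def mult.commute)

lemma divergence_nabla: "divergence k G X y = (\<Sum>i\<in>UNIV. nabla k G X y $ i $ i)"
  by (simp add: divergence_def cov_deriv_nabla matrix_vector_mul_component inner_axis)

lemma metric_ip_axis: "metric_ip A (axis a 1) Y = (A *v Y) $ a"
  by (simp add: metric_ip_def inner_axis')

locale riem_chart = half_chart k S for k :: "'n::finite" and S +
  fixes G :: "real ^ 'n \<Rightarrow> real ^ 'n ^ 'n"
  assumes smooth_metric: "\<And>i j. smooth (\<lambda>y. G y $ i $ j)"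
    and spd_metric: "\<And>y. y \<in> S \<Longrightarrow> sym_pos_def (G y)"
begin

abbreviation "\<Gamma> \<equiv> christoffel k G"

lemma pos_def_metric: "y \<in> S \<Longrightarrow> pos_def (G y)"
  using spd_metric by (simp add: pos_def_def)

lemma metric_sym: "y \<in> S \<Longrightarrow> G y $ i $ j = G y $ j $ i"
  using pos_def.sym[OF pos_def_metric] .

lemma pd_add: "smooth f \<Longrightarrow> smooth g \<Longrightarrow> y \<in> S \<Longrightarrow> pd i (\<lambda>z. f z + g z) y = pd i f y + pd i g y"
  by (simp add: partial_add S_sub smooth_differentiable)

lemma pd_mult: "smooth f \<Longrightarrow> smooth g \<Longrightarrow> y \<in> S \<Longrightarrow> pd i (\<lambda>z. f z * g z) y = pd i f y * g y + f y * pd i g y"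
  by (simp add: partial_mult S_sub smooth_differentiable)

lemma pd_sum: "(\<And>j. j \<in> J \<Longrightarrow> smooth (f j)) \<Longrightarrow> y \<in> S \<Longrightarrow> pd i (\<lambda>z. \<Sum>j\<in>J. f j z) y = (\<Sum>j\<in>J. pd i (f j) y)"
  by (simp add: partial_sum S_sub smooth_differentiable)

lemma smooth_det: "(\<And>i j. smooth (\<lambda>y. N y $ i $ j)) \<Longrightarrow> smooth (\<lambda>y. det (N y :: real ^ 'n ^ 'n))"
  unfolding det_def by (intro smooth_sum smooth_mult smooth_const smooth_prod)

text \<open>Cramer's rule writes each entry as a quotient of two determinants, which are polynomials
  in smooth functions.\<close>

lemma smooth_inverse_metric: "smooth (\<lambda>y. matrix_inv (G y) $ i $ j)"
proof -
  define N where "N y = (\<chi> a b. if b = i then (axis j 1 :: real ^ 'n) $ a else G y $ a $ b)" for y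
  have "smooth (\<lambda>y. det (N y) / det (G y))"
  proof (intro smooth_divide smooth_det smooth_metric)
    show "smooth (\<lambda>y. N y $ a $ b)" for a b
      using smooth_metric by (cases "b = i") (auto simp: N_def)
    show "det (G y) \<noteq> 0" if "y \<in> S" for y
      using pos_def.det_nz[OF pos_def_metric[OF that]] .
  qed
  moreover have "det (N y) / det (G y) = matrix_inv (G y) $ i $ j" if "y \<in> S" for y
  proof -
    interpret pos_def "G y" using pos_def_metric that .
    have "matrix_inv (G y) *v axis j 1 =
        (\<chi> k. det (\<chi> a b. if b = k then (axis j 1 :: real ^ 'n) $ a else G y $ a $ b) / det (G y))"
      using cramer[OF det_nz] mul_inv(1) by blast
    from arg_cong[OF this, of "\<lambda>x. x $ i"] show ?thesis
      by (simp add: N_def matrix_vector_mul_component inner_axis)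
  qed
  ultimately show ?thesis by (rule smooth_cong) auto
qed

lemma smooth_christoffel: "smooth (\<Gamma> l i j)"
  unfolding christoffel_def
  by (intro smooth_divide smooth_sum smooth_mult smooth_add smooth_diff smooth_inverse_metric
      smooth_partial smooth_metric smooth_const) simp

lemma christoffel_sym: "y \<in> S \<Longrightarrow> \<Gamma> l i j y = \<Gamma> l j i y"
proof -
  assume "y \<in> S"
  then have "pd m (\<lambda>z. G z $ i $ j) y = pd m (\<lambda>z. G z $ j $ i) y" for m
    by (intro partial_cong) (auto simp: metric_sym)
  then show ?thesis by (simp add: christoffel_def add.commute)
qed

text \<open>Contracting with the metric undoes the \<open>matrix_inv\<close> in the definition and
  leaves the Christoffel symbols of the first kind.\<close>

lemma lower_christoffel:
  assumes y: "y \<in> S"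
  shows "(\<Sum>l\<in>UNIV. G y $ n $ l * \<Gamma> l i j y) =
    (pd i (\<lambda>z. G z $ j $ n) y + pd j (\<lambda>z. G z $ i $ n) y - pd n (\<lambda>z. G z $ i $ j) y) / 2"
proof -
  interpret pos_def "G y" using pos_def_metric y .
  define D where "D m = pd i (\<lambda>z. G z $ j $ m) y + pd j (\<lambda>z. G z $ i $ m) y - pd m (\<lambda>z. G z $ i $ j) y" for m
  have "(\<Sum>l\<in>UNIV. G y $ n $ l * \<Gamma> l i j y)
      = (\<Sum>l\<in>UNIV. \<Sum>m\<in>UNIV. G y $ n $ l * matrix_inv (G y) $ l $ m * D m) / 2"
    by (simp add: christoffel_def D_def sum_divide_distrib sum_distrib_left mult.assoc)
  also have "\<dots> = (\<Sum>m\<in>UNIV. \<Sum>l\<in>UNIV. G y $ n $ l * matrix_inv (G y) $ l $ m * D m) / 2"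
    by (subst sum.swap) simp
  also have "\<dots> = (\<Sum>m\<in>UNIV. (if n = m then 1 else 0) * D m) / 2"
    by (simp flip: sum_distrib_right add: inverse_right_sum)
  finally show ?thesis by (simp add: D_def if_distrib if_distribR cong: if_cong)
qed

text \<open>The metric is parallel: in the sum of two symbols of the first kind all derivatives but
  the required one cancel.\<close>

lemma metric_compat:
  assumes y: "y \<in> S"
  shows "pd a (\<lambda>z. G z $ i $ j) y =
    (\<Sum>l\<in>UNIV. G y $ j $ l * \<Gamma> l a i y) + (\<Sum>l\<in>UNIV. G y $ i $ l * \<Gamma> l a j y)"
proof -
  have "pd m (\<lambda>z. G z $ i $ j) y = pd m (\<lambda>z. G z $ j $ i) y" for m i j
    using y by (intro partial_cong) (auto simp: metric_sym)
  then show ?thesis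
    using lower_christoffel[OF y, of j a i] lower_christoffel[OF y, of i a j] by simp
qed

lemma smooth_nabla:
  assumes "\<And>l. smooth (\<lambda>y. X y $ l)"
  shows "smooth (\<lambda>y. nabla k G X y $ l $ j)"
  by (simp add: nabla_def smooth_add smooth_partial smooth_sum smooth_mult smooth_christoffel assms)

lemma smooth_metric_ip:
  assumes "\<And>l. smooth (\<lambda>y. X y $ l)" "\<And>l. smooth (\<lambda>y. Y y $ l)"
  shows "smooth (\<lambda>y. metric_ip (G y) (X y) (Y y))"
  unfolding metric_ip_expand by (intro smooth_sum smooth_mult smooth_metric assms)

text \<open>Metric compatibility of the connection. \<open>U\<close> collects the terms with a
  differentiated component of \<open>X\<close>, \<open>W\<close> those with a Christoffel symbol; by
  symmetry of the metric each occurs twice.\<close>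

lemma partial_norm_sq:
  assumes X: "\<And>l. smooth (\<lambda>y. X y $ l)" and y: "y \<in> S"
  shows "pd a (\<lambda>y. metric_ip (G y) (X y) (X y)) y = 2 * metric_ip (G y) (nabla k G X y *v axis a 1) (X y)"
proof -
  let ?dX = "\<lambda>i. pd a (\<lambda>y. X y $ i) y" and ?X = "\<lambda>i. X y $ i"
  have nab: "(nabla k G X y *v axis a 1) $ i = ?dX i + (\<Sum>m\<in>UNIV. \<Gamma> i a m y * ?X m)" for i
    by (simp add: matrix_vector_mul_component inner_axis nabla_def)
  define U where "U = (\<Sum>i\<in>UNIV. \<Sum>j\<in>UNIV. G y $ i $ j * ?dX i * ?X j)"
  define W where "W = (\<Sum>i\<in>UNIV. \<Sum>j\<in>UNIV. \<Sum>m\<in>UNIV. G y $ i $ j * \<Gamma> i a m y * ?X m * ?X j)"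
  have rhs: "metric_ip (G y) (nabla k G X y *v axis a 1) (X y) = U + W"
    unfolding metric_ip_expand nab U_def W_def
    by (simp add: algebra_simps sum.distrib sum_distrib_left sum_distrib_right)
  have "(\<Sum>i\<in>UNIV. \<Sum>j\<in>UNIV. (\<Sum>l\<in>UNIV. G y $ j $ l * \<Gamma> l a i y) * ?X i * ?X j)
      = (\<Sum>i\<in>UNIV. \<Sum>j\<in>UNIV. \<Sum>l\<in>UNIV. G y $ l $ j * \<Gamma> l a i y * ?X i * ?X j)"
    using y by (simp add: sum_distrib_right metric_sym)
  also have "\<dots> = (\<Sum>i\<in>UNIV. \<Sum>l\<in>UNIV. \<Sum>j\<in>UNIV. G y $ l $ j * \<Gamma> l a i y * ?X i * ?X j)"
    by (rule sum.cong[OF refl], rule sum.swap)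
  also have "\<dots> = (\<Sum>l\<in>UNIV. \<Sum>i\<in>UNIV. \<Sum>j\<in>UNIV. G y $ l $ j * \<Gamma> l a i y * ?X i * ?X j)"
    by (rule sum.swap)
  also have "\<dots> = W"
    unfolding W_def by (rule sum.cong[OF refl], rule sum.swap)
  finally have W: "(\<Sum>i\<in>UNIV. \<Sum>j\<in>UNIV. (\<Sum>l\<in>UNIV. G y $ j $ l * \<Gamma> l a i y) * ?X i * ?X j) = W" .
  have W': "(\<Sum>i\<in>UNIV. \<Sum>j\<in>UNIV. (\<Sum>l\<in>UNIV. G y $ i $ l * \<Gamma> l a j y) * ?X i * ?X j) = W"
    unfolding W[symmetric] by (subst sum.swap) (simp add: ac_simps)
  have U': "(\<Sum>i\<in>UNIV. \<Sum>j\<in>UNIV. G y $ i $ j * ?X i * ?dX j) = U"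
    unfolding U_def using y by (subst sum.swap) (simp add: metric_sym ac_simps)
  have "pd a (\<lambda>y. metric_ip (G y) (X y) (X y)) y = (\<Sum>i\<in>UNIV. \<Sum>j\<in>UNIV.
      pd a (\<lambda>z. G z $ i $ j) y * ?X i * ?X j + G y $ i $ j * ?dX i * ?X j + G y $ i $ j * ?X i * ?dX j)"
    unfolding metric_ip_expand
    by (simp add: pd_sum pd_mult smooth_sum smooth_mult smooth_metric X y algebra_simps)
  also have "\<dots> = W + W' + U + U" if "W' = W" for W'
    unfolding metric_compat[OF y] that
    by (simp add: distrib_right sum.distrib W W' U' flip: U_def)
  finally show ?thesis using rhs by simp
qed

text \<open>Lowering the index turns the covariant derivative into \<open>pd j (pd i v)\<close>
  minus a Christoffel term, and both are symmetric in \<open>i\<close> and \<open>j\<close>.\<close>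

lemma nabla_gradient_sym:
  assumes v: "smooth v" and X: "\<And>l. smooth (\<lambda>y. X y $ l)"
    and grad: "\<And>y i. y \<in> S \<Longrightarrow> (G y *v X y) $ i = pd i v y" and y: "y \<in> S"
  shows "(G y ** nabla k G X y) $ i $ j = (G y ** nabla k G X y) $ j $ i"
proof -
  have "(G y ** nabla k G X y) $ i $ j = pd j (pd i v) y - (\<Sum>m\<in>UNIV. (\<Sum>l\<in>UNIV. G y $ m $ l * \<Gamma> l j i y) * X y $ m)"
    for i j
  proof -
    have "pd j (pd i v) y = pd j (\<lambda>z. \<Sum>l\<in>UNIV. G z $ i $ l * X z $ l) y"
      by (rule partial_cong[OF y]) (simp flip: grad add: matrix_vector_mult_def)
    also have "\<dots> = (\<Sum>l\<in>UNIV. pd j (\<lambda>z. G z $ i $ l) y * X y $ l + G y $ i $ l * pd j (\<lambda>z. X z $ l) y)"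
      by (simp add: pd_sum pd_mult smooth_mult smooth_metric X y)
    also have "\<dots> = (\<Sum>l\<in>UNIV. ((\<Sum>n\<in>UNIV. G y $ l $ n * \<Gamma> n j i y) + (\<Sum>n\<in>UNIV. G y $ i $ n * \<Gamma> n j l y)) * X y $ l
         + G y $ i $ l * pd j (\<lambda>z. X z $ l) y)"
      unfolding metric_compat[OF y] ..
    also have "\<dots> = (\<Sum>m\<in>UNIV. (\<Sum>l\<in>UNIV. G y $ m $ l * \<Gamma> l j i y) * X y $ m)
        + ((\<Sum>l\<in>UNIV. \<Sum>n\<in>UNIV. G y $ i $ n * \<Gamma> n j l y * X y $ l) + (\<Sum>l\<in>UNIV. G y $ i $ l * pd j (\<lambda>z. X z $ l) y))"
      by (simp add: sum.distrib distrib_right sum_distrib_right)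
    also have "(\<Sum>l\<in>UNIV. \<Sum>n\<in>UNIV. G y $ i $ n * \<Gamma> n j l y * X y $ l)
        = (\<Sum>n\<in>UNIV. \<Sum>l\<in>UNIV. G y $ i $ n * \<Gamma> n j l y * X y $ l)" by (rule sum.swap)
    also have "\<dots> + (\<Sum>l\<in>UNIV. G y $ i $ l * pd j (\<lambda>z. X z $ l) y) = (G y ** nabla k G X y) $ i $ j"
      by (simp add: matrix_matrix_mult_def nabla_def sum.distrib distrib_left sum_distrib_left mult.assoc)
    finally show ?thesis by simp
  qed
  then show ?thesis
    using partial_commute[OF v y, of i j] christoffel_sym[OF y] by simp
qed

lemma nabla_gradient_self_adjoint:
  assumes "smooth v" "\<And>l. smooth (\<lambda>y. X y $ l)"
    and "\<And>y i. y \<in> S \<Longrightarrow> (G y *v X y) $ i = pd i v y" and y: "y \<in> S"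
  shows "metric_ip (G y) (nabla k G X y *v x) x' = metric_ip (G y) x (nabla k G X y *v x')"
proof -
  interpret pos_def "G y" using pos_def_metric y .
  let ?M = "G y ** nabla k G X y"
  have "transpose ?M = ?M"
    using nabla_gradient_sym[OF assms] by (simp add: transpose_def vec_eq_iff)
  then have "x \<bullet> (?M *v x') = (?M *v x) \<bullet> x'"
    by (metis dot_lmul_matrix transpose_matrix_vector)
  then show ?thesis
    by (subst ip_sym) (simp add: metric_ip_def matrix_vector_mul_assoc inner_commute)
qed

text \<open>For a gradient field, \<open>nabla k G X z *v X z\<close> is half the gradient of the
  squared length of \<open>X\<close>, so this becomes the usual formula for the Laplacian of the
  squared gradient.\<close>

lemma bochner:
  assumes X: "\<And>l. smooth (\<lambda>y. X y $ l)" and y: "y \<in> S"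
  shows "divergence k G (\<lambda>z. nabla k G X z *v X z) y =
    (\<Sum>l\<in>UNIV. \<Sum>i\<in>UNIV. nabla k G X y $ l $ i * nabla k G X y $ i $ l)
    + (\<Sum>i\<in>UNIV. X y $ i * pd i (divergence k G X) y) + metric_ip (ricci k G y) (X y) (X y)"
proof -
  note sm = smooth_sum smooth_mult smooth_add smooth_christoffel smooth_partial X
  have A: "nabla k G X z $ l $ i = pd i (\<lambda>y. X y $ l) z + (\<Sum>m\<in>UNIV. \<Gamma> l i m z * X z $ m)" for l i z
    by (simp add: nabla_def)
  have dA: "pd m (\<lambda>z. nabla k G X z $ l $ i) y = pd m (pd i (\<lambda>y. X y $ l)) y
      + (\<Sum>j\<in>UNIV. pd m (\<Gamma> l i j) y * X y $ j + \<Gamma> l i j y * pd m (\<lambda>y. X y $ j) y)" for l i m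
    unfolding A by (subst pd_add) (simp_all add: pd_sum pd_mult sm y)
  have lhs: "divergence k G (\<lambda>z. nabla k G X z *v X z) y =
     (\<Sum>l\<in>UNIV. (\<Sum>i\<in>UNIV. (pd l (pd i (\<lambda>y. X y $ l)) y + (\<Sum>j\<in>UNIV. pd l (\<Gamma> l i j) y * X y $ j + \<Gamma> l i j y * pd l (\<lambda>y. X y $ j) y)) * X y $ i
            + nabla k G X y $ l $ i * pd l (\<lambda>y. X y $ i) y)
       + (\<Sum>m\<in>UNIV. \<Gamma> l l m y * (\<Sum>i\<in>UNIV. nabla k G X y $ m $ i * X y $ i)))"
  proof -
    have "pd l (\<lambda>z. (nabla k G X z *v X z) $ l) y = (\<Sum>i\<in>UNIV. pd l (\<lambda>z. nabla k G X z $ l $ i) y * X y $ i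
            + nabla k G X y $ l $ i * pd l (\<lambda>y. X y $ i) y)" for l
      by (simp add: matrix_vector_mult_def pd_sum pd_mult smooth_nabla smooth_mult X y)
    then show ?thesis
      unfolding divergence_nabla by (subst nabla_def) (simp add: dA, simp add: matrix_vector_mult_def)
  qed
  have rhs: "pd i (divergence k G X) y = (\<Sum>l\<in>UNIV. pd i (pd l (\<lambda>y. X y $ l)) y
      + (\<Sum>m\<in>UNIV. pd i (\<Gamma> l l m) y * X y $ m + \<Gamma> l l m y * pd i (\<lambda>y. X y $ m) y))" for i
    unfolding divergence_nabla by (subst pd_sum) (simp_all add: smooth_nabla X y dA)
  show ?thesis
    unfolding lhs rhs metric_ip_expand
  proof (rule bochner_sums)
    show "pd m (pd i (\<lambda>y. X y $ l)) y = pd i (pd m (\<lambda>y. X y $ l)) y" for l i m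
      using X y by (rule partial_commute)
    show "\<Gamma> l i j y = \<Gamma> l j i y" for l i j using christoffel_sym[OF y] .
    show "nabla k G X y $ l $ i = pd i (\<lambda>y. X y $ l) y + (\<Sum>m\<in>UNIV. \<Gamma> l i m y * X y $ m)" for l i
      by (rule A)
    show "ricci k G y $ b $ j = (\<Sum>a\<in>UNIV. pd a (\<Gamma> a b j) y - pd b (\<Gamma> a a j) y
        + (\<Sum>m\<in>UNIV. \<Gamma> a a m y * \<Gamma> m b j y - \<Gamma> a b m y * \<Gamma> m a j y))" for b j
      by (simp add: ricci_def riemann_def)
  qed
qed

end

section \<open>The maximum principle for the gradient\<close>

context half_chart
begin

text \<open>A short ray in direction \<open>i\<close> stays on the boundary, where \<open>u\<close>
  vanishes, and the derivative at the end of an interval is unique.\<close>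

lemma boundary_tangential_partial:
  assumes u: "u differentiable (at y within H)" and y: "y \<in> S" "y $ k = 0"
    and zero: "\<And>w. w \<in> S \<Longrightarrow> w $ k = 0 \<Longrightarrow> u w = 0" and i: "i \<noteq> k"
  shows "pd i u y = 0"
proof -
  have ax: "(axis i 1 :: real ^ 'n) $ k = 0" using i by (simp add: axis_def)
  obtain e where e: "0 < e" "\<And>t. 0 \<le> t \<Longrightarrow> t \<le> e \<Longrightarrow> y + t *\<^sub>R axis i 1 \<in> S"
    using line_in_S[OF y(1), of "axis i 1"] ax by auto
  have "((\<lambda>t. u (y + t *\<^sub>R axis i 1)) has_real_derivative
      (\<Sum>j\<in>UNIV. (axis i 1 :: real ^ 'n) $ j * pd j u (y + 0 *\<^sub>R axis i 1))) (at 0 within {0..e})"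
    by (rule line_derivative) (use u e S_sub in auto)
  then have "((\<lambda>t. u (y + t *\<^sub>R axis i 1)) has_real_derivative pd i u y) (at 0 within {0..e})"
    by (simp add: axis_def if_distrib if_distribR cong: if_cong)
  then have "((\<lambda>t. 0) has_real_derivative pd i u y) (at 0 within {0..e})"
    by (rule has_field_derivative_transform_within[where d = 1]) (use e zero y ax in auto)
  moreover have "((\<lambda>t. 0) has_real_derivative 0) (at 0 within {0..e})"
    by simp
  moreover have "at 0 within {0..e} \<noteq> bot"
    using e by (simp add: trivial_limit_within islimpt_Icc)
  ultimately show ?thesis
    using has_field_derivative_unique by blast
qed

end

text \<open>Leibniz rule. The last term is parallel to \<open>Y\<close>, hence disappears on pairing
  with a vector orthogonal to \<open>Y\<close>; on the boundary this lets the normal be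
  rescaled.\<close>

lemma cov_deriv_scale:
  assumes y: "y \<in> half_space k" and u: "u differentiable (at y within half_space k)"
    and Y: "\<And>l. (\<lambda>w. Y w $ l) differentiable (at y within half_space k)"
  shows "cov_deriv k G y e (\<lambda>w. u w *\<^sub>R Y w) =
    u y *\<^sub>R cov_deriv k G y e Y + (\<Sum>i\<in>UNIV. e $ i * partial k i u y) *\<^sub>R Y y"
  unfolding vec_eq_iff
  by (auto simp: cov_deriv_def partial_mult[OF y u Y] algebra_simps sum.distrib sum_distrib_left sum_distrib_right)

section \<open>Eigenfunctions in one chart\<close>

locale eigen_chart = riem_chart k S G for k :: "'n::finite" and S G +
  fixes v :: "real ^ 'n \<Rightarrow> real" and lam :: real
  assumes smooth_v: "smooth v" and eigen: "\<And>y. y \<in> S \<Longrightarrow> laplacian k G v y = - lam * v y"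
begin

abbreviation "X \<equiv> gradient k G v"
abbreviation "nab \<equiv> nabla k G X"

definition E where "E y = metric_ip (G y) (X y) (X y)"

lemma smooth_X: "smooth (\<lambda>y. X y $ l)"
  by (simp add: gradient_def matrix_vector_mult_def smooth_sum smooth_mult smooth_inverse_metric
      smooth_partial smooth_v)

lemma smooth_E: "smooth E"
  unfolding E_def[abs_def] by (intro smooth_metric_ip smooth_X)

lemma metric_X: "y \<in> S \<Longrightarrow> (G y *v X y) $ i = pd i v y"
  by (simp add: gradient_def pos_def.mul_inv[OF pos_def_metric])

lemma div_X: "y \<in> S \<Longrightarrow> divergence k G X y = - lam * v y"
  using eigen by (simp add: laplacian_def)

lemmas self_adjoint = nabla_gradient_self_adjoint[OF smooth_v smooth_X metric_X]

text \<open>Self-adjointness of the Hessian moves it onto \<open>X\<close>; thus the gradient of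
  \<open>E\<close> is twice \<open>nab y *v X y\<close>.\<close>

lemma partial_E: "y \<in> S \<Longrightarrow> pd a E y = 2 * (G y *v (nab y *v X y)) $ a"
  unfolding E_def[abs_def] by (simp add: partial_norm_sq smooth_X self_adjoint metric_ip_axis)

lemma derivative_v: "y \<in> S \<Longrightarrow> (\<Sum>i\<in>UNIV. V $ i * pd i v y) = metric_ip (G y) V (X y)"
  by (simp add: metric_ip_def inner_vec_def metric_X)

text \<open>As \<open>v\<close> vanishes on the boundary, its gradient there is a multiple
  \<open>f\<close> of the normal, and the Hessian on tangent vectors is \<open>f\<close> times the
  second fundamental form, with trace \<open>f\<close> times the mean curvature. The full trace
  \<open>- lam * v\<close> vanishes on the boundary, which leaves the normal entry.\<close>

lemma boundary_normal_derivative: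
  assumes y: "y \<in> S" "y $ k = 0" and bdry: "\<And>w. w \<in> S \<Longrightarrow> w $ k = 0 \<Longrightarrow> v w = 0"
  defines "N \<equiv> outward_normal k G y"
  obtains f where "X y = f *\<^sub>R N" "metric_ip (G y) (nab y *v N) N = - f * mean_curvature k G y"
proof -
  interpret pos_def "G y" using pos_def_metric y by blast
  \<comment> \<open>\<open>W\<close> is the gradient of the \<open>k\<close>-th coordinate and
    \<rho> the negative factor that turns it into the outward unit normal.\<close>
  define W where "W w = matrix_inv (G w) *v axis k 1" for w
  define \<rho> where "\<rho> w = - (1 / sqrt (matrix_inv (G w) $ k $ k))" for w
  define f where "f = pd k v y / \<rho> y"
  have N: "outward_normal k G = (\<lambda>w. \<rho> w *\<^sub>R W w)"
    by (rule ext) (simp add: outward_normal_def W_def \<rho>_def)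
  have Wk: "W y $ k = matrix_inv (G y) $ k $ k"
    by (simp add: W_def matrix_vector_mul_component inner_axis)
  have GW: "G y *v W y = axis k 1" by (simp add: W_def mul_inv)
  then have "W y \<noteq> 0" by (metis axis_eq_0_iff matrix_vector_mult_0_right zero_neq_one)
  from pos[OF this] have \<beta>: "0 < matrix_inv (G y) $ k $ k"
    by (simp add: metric_ip_def GW inner_axis Wk)
  then have \<rho>0: "\<rho> y \<noteq> 0" by (simp add: \<rho>_def)
  have "((\<lambda>s. - (1 / sqrt s)) has_real_derivative inverse (sqrt (matrix_inv (G y) $ k $ k)) / 2 / matrix_inv (G y) $ k $ k)
      (at (matrix_inv (G y) $ k $ k))"
    using \<beta> by (auto intro!: derivative_eq_intros simp: field_simps)
  then have \<rho>_diff: "\<rho> differentiable (at y within H)"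
    unfolding \<rho>_def[abs_def]
    using differentiable_compose_real[OF smooth_differentiable[OF smooth_inverse_metric y(1)]] by blast
  have smooth_W: "smooth (\<lambda>w. W w $ l)" for l
    by (simp add: W_def matrix_vector_mul_component inner_axis smooth_inverse_metric)
  note W_diff = smooth_differentiable[OF smooth_W y(1)]
  have pk: "pd k v differentiable (at y within H)"
    using smooth_differentiable[OF smooth_partial[OF smooth_v] y(1)] .
  have X_bdry: "X w = pd k v w *\<^sub>R W w" if w: "w \<in> S" "w $ k = 0" for w
  proof -
    have "pd i v w = 0" if "i \<noteq> k" for i
      using boundary_tangential_partial[OF smooth_differentiable[OF smooth_v] w(1) w(2) bdry that] w by blast
    then have "(\<chi> j. pd j v w) = pd k v w *\<^sub>R axis k 1"
      by (auto simp: vec_eq_iff axis_def)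
    then show ?thesis by (simp add: gradient_def W_def matrix_vector_mult_scaleR)
  qed
  have Xf: "X y = f *\<^sub>R N"
    using X_bdry[OF y] \<rho>0 by (simp add: N N_def f_def)
  have tang: "ip (nab y *v e) e = f * ip (cov_deriv k G y e (outward_normal k G)) e" if e: "e $ k = 0" for e
  proof -
    have ipW: "ip (W y) e = 0"
      using e by (subst ip_sym) (simp add: metric_ip_def GW inner_axis)
    have "nab y *v e = cov_deriv k G y e X" by (simp add: cov_deriv_nabla)
    also have "\<dots> = cov_deriv k G y e (\<lambda>w. pd k v w *\<^sub>R W w)"
    proof -
      \<comment> \<open>In directions tangent to the boundary only values on the boundary count, so
        the gradient may be replaced by a field that agrees with it there.\<close>
      have pp: "e $ i * pd i (\<lambda>z. X z $ l) y = e $ i * pd i (\<lambda>z. (pd k v z *\<^sub>R W z) $ l) y" for i l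
      proof (cases "i = k")
        case False
        have d1: "(\<lambda>z. X z $ l) differentiable (at y within H)"
          using smooth_differentiable[OF smooth_X y(1)] .
        have d2: "(\<lambda>z. (pd k v z *\<^sub>R W z) $ l) differentiable (at y within H)"
          using pk W_diff by simp
        have "pd i (\<lambda>z. X z $ l - (pd k v z *\<^sub>R W z) $ l) y = 0"
          by (rule boundary_tangential_partial[OF _ y _ False])
            (use d1 d2 X_bdry in \<open>auto intro: differentiable_diff\<close>)
        then show ?thesis
          using partial_diff[OF S_sub[OF y(1)] d1 d2] by simp
      qed (simp add: e)
      show ?thesis
        unfolding cov_deriv_def distrib_left pp by (simp add: X_bdry[OF y])
    qed
    finally have "ip (nab y *v e) e = pd k v y * ip (cov_deriv k G y e W) e"
      using cov_deriv_scale[OF S_sub[OF y(1)] pk W_diff] ipW by (simp add: metric_ip_linear)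
    moreover have "ip (cov_deriv k G y e (outward_normal k G)) e = \<rho> y * ip (cov_deriv k G y e W) e"
      unfolding N using cov_deriv_scale[OF S_sub[OF y(1)] \<rho>_diff W_diff] ipW by (simp add: metric_ip_linear)
    ultimately show ?thesis using \<rho>0 by (simp add: f_def)
  qed
  \<comment> \<open>An orthonormal basis of the tangent hyperplane shows that boundary frames exist,
    so the frame selected in \<open>mean_curvature\<close> really is one.\<close>
  define V where "V = {x :: real ^ 'n. axis k 1 \<bullet> x = 0}"
  have V: "subspace V" "dim V = CARD('n) - 1"
    unfolding V_def by (rule subspace_hyperplane) (simp add: dim_hyperplane)
  obtain B where B: "B \<subseteq> V" "orthonormal_on (G y) B" "card B = CARD('n) - 1"
    using orthonormal_extend[OF V(1), of "{}"] V(2) by (auto simp: orthonormal_on_def)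
  have "boundary_frame k G y B"
    using B unfolding boundary_frame_def orthonormal_on_def V_def by (auto simp: inner_axis')
  then have ex: "boundary_frame k G y (SOME E. boundary_frame k G y E)"
    by (rule someI)
  define F where "F = (SOME E. boundary_frame k G y E)"
  have frame: "boundary_frame k G y F"
    using ex by (simp only: F_def)
  note nrm = outward_normal[where G = G and y = y and k = k, OF spd_metric[OF y(1)]]
  have F: "finite F" "card F = CARD('n) - 1" "\<And>e. e \<in> F \<Longrightarrow> e $ k = 0" "orthonormal_on (G y) F"
    using frame unfolding boundary_frame_def orthonormal_on_def by blast+
  have NF: "N \<notin> F" using F(3) nrm(3) by (force simp: N_def)
  \<comment> \<open>Together with the normal the boundary frame is a full frame, over which the
    trace of the Hessian is the Laplacian.\<close>
  have "orthonormal_on (G y) (insert N F)"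
    unfolding N_def by (rule orthonormal_insert_unit[OF F(4) nrm(1) nrm(2)[OF F(3)]])
  moreover have "card (insert N F) = CARD('n)"
    using F NF by (simp add: Suc_pred)
  ultimately have "(\<Sum>e\<in>insert N F. ip (nab y *v e) e) = divergence k G X y"
    unfolding divergence_nabla by (rule frame_trace)
  then have "ip (nab y *v N) N + (\<Sum>e\<in>F. ip (nab y *v e) e) = 0"
    using F(1) NF div_X[OF y(1)] bdry[OF y] by simp
  moreover have "(\<Sum>e\<in>F. ip (nab y *v e) e) = f * mean_curvature k G y"
    unfolding mean_curvature_def F_def[symmetric] sum_distrib_left
    by (intro sum.cong refl tang F(3))
  ultimately show ?thesis using that[OF Xf] by simp
qed

text \<open>At a critical point the first-order terms of the Laplacian vanish.\<close>

lemma divergence_critical: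
  assumes y: "y \<in> S" and dP: "\<And>i. p i differentiable (at y within H)" and crit: "\<And>i. p i y = 0"
  shows "divergence k G (\<lambda>w. matrix_inv (G w) *v (\<chi> j. p j w)) y
    = (\<Sum>i\<in>UNIV. \<Sum>j\<in>UNIV. matrix_inv (G y) $ i $ j * pd i (p j) y)"
proof -
  have z: "(\<chi> j. p j y) = 0" using crit by (simp add: vec_eq_iff)
  have "pd i (\<lambda>w. \<Sum>j\<in>UNIV. matrix_inv (G w) $ i $ j * p j w) y
      = (\<Sum>j\<in>UNIV. matrix_inv (G y) $ i $ j * pd i (p j) y)" for i
    using smooth_differentiable[OF smooth_inverse_metric y] dP S_sub[OF y]
    by (simp add: partial_sum partial_mult crit)
  then show ?thesis
    unfolding divergence_nabla by (simp add: nabla_def z, simp add: matrix_vector_mult_def)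
qed

text \<open>The function \<open>E - \<alpha> z(v)\<close> is nonpositive and vanishes at
  \<open>y\<close>. The first-order condition there makes the gradient an eigenvector of the
  Hessian; Bochner's formula and the strict inequality then contradict the second-order
  condition.\<close>

lemma no_touching:
  fixes z z1 z2 :: "real \<Rightarrow> real"
  assumes y: "y \<in> S"
    and z: "\<And>w. w \<in> S \<Longrightarrow> (z has_real_derivative z1 (v w)) (at (v w))"
    and z1: "\<And>w. w \<in> S \<Longrightarrow> (z1 has_real_derivative z2 (v w)) (at (v w))"
    and z0: "z1 0 = 0" and zpos: "0 < z (v y)" and \<alpha>: "1 \<le> \<alpha>"
    and le: "\<And>w. w \<in> S \<Longrightarrow> E w \<le> \<alpha> * z (v w)" and touch: "E y = \<alpha> * z (v y)"
    and ric: "metric_ip (ricci k G y) (X y) (X y) \<ge> - c * E y"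
    and bdry: "\<And>w. w \<in> S \<Longrightarrow> w $ k = 0 \<Longrightarrow> v w = 0"
    and mean: "y $ k = 0 \<Longrightarrow> 0 \<le> mean_curvature k G y"
    and strict: "(lam + c + z2 (v y) / 2) * z (v y) < (z1 (v y))\<^sup>2 / 4 + lam * v y * z1 (v y) / 2"
    and concave: "2 * z (v y) * z2 (v y) \<le> (z1 (v y))\<^sup>2"
  shows False
proof -
  interpret pos_def "G y" using pos_def_metric y .
  note vd = smooth_differentiable[OF smooth_v] and Ed = smooth_differentiable[OF smooth_E]
  define P where "P w = E w - \<alpha> * z (v w)" for w
  \<comment> \<open>\<open>Q\<close> is the gradient of \<open>P\<close>, from the formula for
    \<open>pd j E\<close> and the chain rule.\<close>
  define Q where "Q w = 2 *\<^sub>R (nab w *v X w) - (\<alpha> * z1 (v w)) *\<^sub>R X w" for w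
  have zv: "(\<lambda>w. z (v w)) differentiable (at w within H)" if "w \<in> S" for w
    using differentiable_compose_real[OF vd[OF that] z[OF that]] .
  have z1v: "(\<lambda>w. z1 (v w)) differentiable (at y within H)"
    using differentiable_compose_real[OF vd[OF y] z1[OF y]] .
  have Pd: "P differentiable (at w within H)" if "w \<in> S" for w
    unfolding P_def[abs_def] using Ed[OF that] zv[OF that]
    by (intro differentiable_diff differentiable_mult) auto
  have pdP: "pd j P w = pd j E w - \<alpha> * (z1 (v w) * pd j v w)" if "w \<in> S" for j w
    unfolding P_def[abs_def]
    using partial_diff[OF S_sub[OF that] Ed[OF that], of "\<lambda>w. \<alpha> * z (v w)"] zv[OF that]
      partial_mult[OF S_sub[OF that] differentiable_const zv[OF that]]
      partial_compose[OF S_sub[OF that] vd[OF that] z[OF that]] S_sub[OF that]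
    by (simp add: differentiable_mult)
  have pdP_Q: "(\<chi> j. pd j P w) = G w *v Q w" if "w \<in> S" for w
    using that by (simp add: vec_eq_iff pdP partial_E Q_def matrix_vector_mult_diff_distrib
        matrix_vector_mult_scaleR metric_X)
  have DP: "(\<Sum>j\<in>UNIV. V $ j * pd j P y) = ip V (Q y)" for V
    using arg_cong[OF pdP_Q[OF y], of "\<lambda>u. V \<bullet> u"] by (simp add: metric_ip_def inner_vec_def)
  have Pmax: "P w \<le> P y" if "w \<in> S" for w
    using le[OF that] touch by (simp add: P_def)
  have first: "ip V (Q y) \<le> 0" if "0 < y $ k \<or> 0 \<le> V $ k" for V
    using max_first_order[OF y Pd[OF y] Pmax that] DP by simp
  have crit: "Q y = 0"
  proof (cases "y $ k = 0")
    case False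
    then have "0 < y $ k" using S_sub[OF y] by (simp add: half_space_def)
    then have "ip (Q y) (Q y) \<le> 0" using first by blast
    then show ?thesis using pos by force
  next
    case True
    let ?N = "outward_normal k G y"
    obtain f where f: "X y = f *\<^sub>R ?N" "ip (nab y *v ?N) ?N = - f * mean_curvature k G y"
      using boundary_normal_derivative[OF y True bdry] by blast
    \<comment> \<open>Since \<open>v\<close> vanishes on the boundary, \<open>z1 0 = 0\<close>
      removes the second term of \<open>Q\<close>.\<close>
    have "ip ?N (Q y) = 2 * (f * ip ?N (nab y *v ?N))"
      using z0 bdry[OF y True] by (simp add: Q_def f metric_ip_linear matrix_vector_mult_scaleR)
    also have "ip ?N (nab y *v ?N) = - f * mean_curvature k G y"
      using f(2) ip_sym by simp
    finally have "ip ?N (Q y) = - (2 * (f\<^sup>2 * mean_curvature k G y))"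
      by (simp add: power2_eq_square)
    also have "\<dots> \<le> 0" using mean[OF True] by simp
    finally have "ip ?N (Q y) \<le> 0" .
    moreover have Nk: "?N $ k < 0" using outward_normal(3)[where G = G and y = y and k = k, OF spd_metric[OF y]] .
    \<comment> \<open>The inward direction is admissible and gives the opposite inequality.\<close>
    then have "ip (- ?N) (Q y) \<le> 0" by (intro first) simp
    ultimately have N0: "ip ?N (Q y) = 0" by (simp add: metric_ip_linear)
    \<comment> \<open>Subtracting this multiple of the normal leaves the tangential part
      \<open>T\<close> of \<open>Q y\<close>, which is again admissible.\<close>
    define s where "s = Q y $ k / ?N $ k"
    define T where "T = Q y - s *\<^sub>R ?N"
    have "T $ k = 0" using Nk by (simp add: T_def s_def)
    then have "ip T (Q y) \<le> 0" by (intro first) simp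
    moreover have "ip (Q y) (Q y) = ip T (Q y)"
      using metric_ip_add_left[of "G y" T "s *\<^sub>R ?N" "Q y"] N0 by (simp add: T_def metric_ip_linear)
    ultimately show ?thesis using pos by force
  qed
  then have "(\<chi> j. pd j P y) = 0"
    using pdP_Q[OF y] by simp
  then have pd0: "pd j P y = 0" for j
    by (simp add: vec_eq_iff)
  have dP: "pd j P differentiable (at y within H)" for j
  proof (rule diff_cong[OF y])
    show "pd j E w - \<alpha> * (z1 (v w) * pd j v w) = pd j P w" if "w \<in> S" for w
      using pdP that by simp
    show "(\<lambda>w. pd j E w - \<alpha> * (z1 (v w) * pd j v w)) differentiable (at y within H)"
      using smooth_differentiable[OF smooth_partial[OF smooth_E] y]
        smooth_differentiable[OF smooth_partial[OF smooth_v] y] z1v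
      by (intro differentiable_diff differentiable_mult) auto
  qed
  have "divergence k G (\<lambda>w. matrix_inv (G w) *v (\<chi> j. pd j P w)) y \<le> 0"
    unfolding divergence_critical[OF y dP pd0]
  proof (rule inverse_trace_nonpos)
    show "(\<Sum>i\<in>UNIV. \<Sum>j\<in>UNIV. V $ i * V $ j * pd i (pd j P) y) \<le> 0" for V
      using max_second_order[OF y Pd dP pd0 Pmax, of V] by (subst sum.swap) (simp add: mult.commute)
  qed
  \<comment> \<open>The two fields are known to agree on \<open>S\<close> only, so their divergences
    are compared through local partial derivatives.\<close>
  moreover have "divergence k G (\<lambda>w. matrix_inv (G w) *v (\<chi> j. pd j P w)) y = divergence k G Q y"
  proof -
    have eq: "matrix_inv (G w) *v (\<chi> j. pd j P w) = Q w" if "w \<in> S" for w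
      using that pdP_Q pos_def.mul_inv(2)[OF pos_def_metric] by simp
    have "pd i (\<lambda>w. (matrix_inv (G w) *v (\<chi> j. pd j P w)) $ l) y = pd i (\<lambda>w. Q w $ l) y" for i l
      using eq by (intro partial_cong[OF y]) simp
    then show ?thesis
      unfolding divergence_nabla nabla_def by (simp add: eq[OF y])
  qed
  moreover have "divergence k G Q y = 2 * divergence k G (\<lambda>w. nab w *v X w) y
      - \<alpha> * (z1 (v y) * divergence k G X y + z2 (v y) * E y)"
  proof -
    define Y where "Y w = nab w *v X w" for w
    have Yd: "(\<lambda>w. Y w $ l) differentiable (at y within H)" for l
    proof -
      have "smooth (\<lambda>w. Y w $ l)"
        by (simp add: Y_def matrix_vector_mult_def smooth_sum smooth_mult smooth_nabla smooth_X)
      then show ?thesis using smooth_differentiable y by blast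
    qed
    have Xd: "(\<lambda>w. X w $ l) differentiable (at y within H)" for l
      using smooth_differentiable[OF smooth_X y] .
    have dQ: "pd i (\<lambda>w. Q w $ l) y = 2 * pd i (\<lambda>w. Y w $ l) y
        - \<alpha> * (z2 (v y) * pd i v y * X y $ l + z1 (v y) * pd i (\<lambda>w. X w $ l) y)" for i l
    proof -
      have zX: "(\<lambda>w. z1 (v w) * X w $ l) differentiable (at y within H)"
        using z1v Xd by (rule differentiable_mult)
      have "pd i (\<lambda>w. z1 (v w) * X w $ l) y = z2 (v y) * pd i v y * X y $ l + z1 (v y) * pd i (\<lambda>w. X w $ l) y"
        using partial_mult[OF S_sub[OF y] z1v Xd] partial_compose[OF S_sub[OF y] vd[OF y] z1[OF y]] by simp
      moreover have "(\<lambda>w. Q w $ l) = (\<lambda>w. 2 * Y w $ l - \<alpha> * (z1 (v w) * X w $ l))"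
        by (simp add: Q_def Y_def fun_eq_iff)
      ultimately show ?thesis
        using partial_diff[OF S_sub[OF y], of "\<lambda>w. 2 * Y w $ l" "\<lambda>w. \<alpha> * (z1 (v w) * X w $ l)"]
          partial_mult[OF S_sub[OF y] differentiable_const Yd, of _ 2 l]
          partial_mult[OF S_sub[OF y] differentiable_const zX, of _ \<alpha>] S_sub[OF y] Yd zX
        by (simp add: differentiable_mult)
    qed
    have Qy: "Q y $ m = 2 * Y y $ m - \<alpha> * z1 (v y) * X y $ m" for m
      by (simp add: Q_def Y_def)
    have nabQ: "nabla k G Q y $ i $ i = 2 * nabla k G Y y $ i $ i
        - \<alpha> * (z2 (v y) * (X y $ i * pd i v y) + z1 (v y) * nab y $ i $ i)" for i
      by (simp add: nabla_def dQ Qy algebra_simps sum_distrib_left sum_subtractf)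
    have "(\<Sum>i\<in>UNIV. X y $ i * pd i v y) = E y"
      using derivative_v[OF y, of "X y"] by (simp add: E_def)
    then show ?thesis
      unfolding divergence_nabla nabQ Y_def[abs_def, symmetric]
      by (simp add: sum_subtractf sum.distrib algebra_simps flip: sum_distrib_left)
  qed
  moreover have "divergence k G (\<lambda>w. nab w *v X w) y \<ge> (\<alpha> * z1 (v y) / 2)\<^sup>2 - lam * E y - c * E y"
  proof -
    have Ey: "0 < E y" using \<alpha> zpos touch by simp
    then have X0: "X y \<noteq> 0" by (auto simp: E_def)
    \<comment> \<open>\<open>Q y = 0\<close> is the eigenvector equation, with eigenvalue
      \<open>\<alpha> * z1 (v y) / 2\<close>.\<close>
    have "nab y *v X y = (\<alpha> * z1 (v y) / 2) *\<^sub>R X y"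
    proof -
      have "2 *\<^sub>R (nab y *v X y) = (\<alpha> * z1 (v y)) *\<^sub>R X y"
        using crit by (simp add: Q_def)
      then have "(1/2) *\<^sub>R (2 *\<^sub>R (nab y *v X y)) = (1/2) *\<^sub>R ((\<alpha> * z1 (v y)) *\<^sub>R X y)" by simp
      then show ?thesis by simp
    qed
    from trace_square_ge[OF self_adjoint[OF _ y] this X0]
    have "(\<alpha> * z1 (v y) / 2)\<^sup>2 \<le> (\<Sum>i\<in>UNIV. \<Sum>j\<in>UNIV. nab y $ i $ j * nab y $ j $ i)" by simp
    moreover have "pd i (divergence k G X) y = - lam * pd i v y" for i
    proof -
      have "pd i (divergence k G X) y = pd i (\<lambda>w. - lam * v w) y"
        by (rule partial_cong[OF y]) (rule div_X)
      then show ?thesis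
        using partial_mult[OF S_sub[OF y] differentiable_const vd[OF y], of i "- lam"] S_sub[OF y] by simp
    qed
    then have "(\<Sum>i\<in>UNIV. X y $ i * pd i (divergence k G X) y) = - lam * E y"
      using derivative_v[OF y, of "X y"] by (simp add: E_def mult.left_commute sum_negf flip: sum_distrib_left)
    ultimately show ?thesis
      using bochner[OF smooth_X y] ric by simp
  qed
  ultimately have "2 * ((\<alpha> * z1 (v y) / 2)\<^sup>2 - lam * E y - c * E y)
      - \<alpha> * (z1 (v y) * (- lam * v y) + z2 (v y) * E y) \<le> 0"
    using div_X[OF y] by simp
  \<comment> \<open>Substituting \<open>E y = \<alpha> * z (v y)\<close> exhibits a common positive
    factor \<alpha>.\<close>
  then have "\<alpha> * (\<alpha> * (z1 (v y))\<^sup>2 / 2 - 2 * (lam + c) * z (v y) + lam * v y * z1 (v y) - \<alpha> * z (v y) * z2 (v y)) \<le> 0"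
    unfolding touch by (simp add: algebra_simps power2_eq_square)
  then have 1: "\<alpha> * (z1 (v y))\<^sup>2 / 2 - 2 * (lam + c) * z (v y) + lam * v y * z1 (v y) - \<alpha> * z (v y) * z2 (v y) \<le> 0"
    using \<alpha> by (simp add: mult_le_0_iff)
  \<comment> \<open>\<open>strict\<close> contradicts the inequality for
    \<open>\<alpha> = 1\<close>; \<open>concave\<close> makes its left side nondecreasing in
    \<alpha>, which covers larger values.\<close>
  have "0 \<le> (\<alpha> - 1) * ((z1 (v y))\<^sup>2 - 2 * z (v y) * z2 (v y))"
    using \<alpha> concave by simp
  then show False using 1 strict by (simp add: algebra_simps)
qed

end

section \<open>One-dimensional comparison profiles\<close>

text \<open>
  For a profile \<open>\<phi>\<close> with \<open>\<phi>' = q\<close>, \<open>\<phi>(0) = 0\<close>, scaled by a constant \<open>C\<close>, take \<open>\<theta>(s) = \<phi>\<inverse>(s / C)\<close> and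
  \<open>z(s) = C\<^sup>2 q(\<theta>(s))\<^sup>2\<close>; \<open>z1\<close> and \<open>z2\<close> are the first two derivatives of \<open>z\<close>. The strict inequality says
  that \<open>H = - (\<phi>'' + lam \<phi>) / \<phi>'\<close> satisfies \<open>H' > c\<close>, the last one that \<open>q\<close> is log-concave.
\<close>

definition gradient_barrier ::
  "real \<Rightarrow> real \<Rightarrow> real \<Rightarrow> (real \<Rightarrow> real) \<Rightarrow> (real \<Rightarrow> real) \<Rightarrow> (real \<Rightarrow> real) \<Rightarrow> (real \<Rightarrow> real) \<Rightarrow> bool" where
  "gradient_barrier lam c V \<theta> z z1 z2 \<longleftrightarrow> \<theta> 0 = 0 \<and> z1 0 = 0 \<and> (\<forall>s. \<bar>s\<bar> \<le> V \<longrightarrow>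
     0 < z s \<and> (\<theta> has_real_derivative 1 / sqrt (z s)) (at s) \<and>
     (z has_real_derivative z1 s) (at s) \<and> (z1 has_real_derivative z2 s) (at s) \<and>
     (lam + c + z2 s / 2) * z s < (z1 s)\<^sup>2 / 4 + lam * s * z1 s / 2 \<and> 2 * z s * z2 s \<le> (z1 s)\<^sup>2)"

text \<open>The odd part of an antiderivative on \<open>{- R..R}\<close> has the same derivative,
  because \<open>q\<close> is even.\<close>

lemma odd_antiderivative:
  fixes q :: "real \<Rightarrow> real"
  assumes q: "continuous_on UNIV q" and even: "\<And>t. q (- t) = q t"
  obtains \<phi> where "\<And>t. \<bar>t\<bar> < R \<Longrightarrow> (\<phi> has_real_derivative q t) (at t)" "\<And>t. \<phi> (- t) = - \<phi> t"
proof -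
  obtain g where g: "\<And>x. x \<in> {- R..R} \<Longrightarrow> (g has_vector_derivative q x) (at x within {- R..R})"
    using antiderivative_continuous[of "- R" R q] q continuous_on_subset by blast
  have d: "(g has_real_derivative q t) (at t)" if "\<bar>t\<bar> < R" for t
  proof -
    have "at t within {- R..R} = at t"
      using that by (intro at_within_interior) auto
    then show ?thesis
      using g[of t] that by (simp add: has_real_derivative_iff_has_vector_derivative abs_less_iff)
  qed
  show ?thesis
  proof (rule that[of "\<lambda>t. (g t - g (- t)) / 2"])
    fix t assume "\<bar>t\<bar> < R"
    then have "(g has_real_derivative q t) (at t)" "((\<lambda>t. g (- t)) has_real_derivative q (- t) * (- 1)) (at t)"
      using d[of t] DERIV_chain2[where f = g and g = uminus and x = t and s = UNIV,
          OF d[of "- t"] DERIV_minus[OF DERIV_ident]] by simp_all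
    then show "((\<lambda>t. (g t - g (- t)) / 2) has_real_derivative q t) (at t)"
      using DERIV_cdivide[OF DERIV_diff, of g "q t" t UNIV "\<lambda>t. g (- t)" "- q t" 2] by (simp add: even)
  qed (simp add: field_simps)
qed

text \<open>The substitution \<open>s = C * \<phi> t\<close> identifies
  \<open>\<bar>s\<bar> \<le> V\<close> with \<open>\<bar>t\<bar> \<le> t0\<close>, inside the
  interval of the profile hypotheses. Up to rearrangement and positive factors the barrier
  inequalities are those of the profile.\<close>

lemma barrier_from_profile:
  fixes q q1 q2 \<phi> :: "real \<Rightarrow> real"
  assumes q: "\<And>t. (q has_real_derivative q1 t) (at t)" and q1: "\<And>t. (q1 has_real_derivative q2 t) (at t)"
    and \<phi>: "\<And>t. \<bar>t\<bar> < R \<Longrightarrow> (\<phi> has_real_derivative q t) (at t)" and odd: "\<And>t. \<phi> (- t) = - \<phi> t"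
    and q1_0: "q1 0 = 0" and pos: "\<And>t. \<bar>t\<bar> < R \<Longrightarrow> 0 < q t"
    and strict: "\<And>t. \<bar>t\<bar> < R \<Longrightarrow> (lam + c) * (q t)\<^sup>2 < (q1 t)\<^sup>2 - q t * q2 t + lam * \<phi> t * q1 t"
    and concave: "\<And>t. \<bar>t\<bar> < R \<Longrightarrow> q t * q2 t \<le> (q1 t)\<^sup>2"
    and t0: "0 < t0" "t0 < R" and V: "0 < V"
  shows "\<exists>\<theta> z z1 z2. gradient_barrier lam c V \<theta> z z1 z2 \<and> \<theta> V = t0 \<and> \<theta> (- V) = - t0"
proof -
  have mono: "\<phi> s < \<phi> t" if "- R < s" "s < t" "t < R" for s t
    by (rule DERIV_pos_imp_increasing[OF that(2)]) (use \<phi> pos that in force)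
  have \<phi>0: "\<phi> 0 = 0" using odd[of 0] by simp
  define I where "I = {- R<..<R}"
  define \<Theta> where "\<Theta> = inv_into I \<phi>"
  have inj: "inj_on \<phi> I"
    using mono by (auto simp: inj_on_def I_def) (metis less_irrefl linorder_neqE_linordered_idom)
  have \<Theta>: "\<Theta> (\<phi> t) = t" if "\<bar>t\<bar> < R" for t
    unfolding \<Theta>_def using inj that by (intro inv_into_f_f) (auto simp: I_def)
  have \<Theta>': "(\<Theta> has_real_derivative inverse (q t)) (at (\<phi> t))" if t: "\<bar>t\<bar> < R" for t
  proof -
    \<comment> \<open>Half the distance to the nearer end keeps a closed interval around
      \<open>t\<close> in the domain of \<phi>, where the inverse function rule applies.\<close>
    define d where "d = (R - \<bar>t\<bar>) / 2"
    have d: "\<bar>u\<bar> < R" if "\<bar>u - t\<bar> \<le> d" for u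
    proof -
      have "\<bar>u\<bar> \<le> \<bar>t\<bar> + \<bar>u - t\<bar>" using abs_triangle_ineq[of t "u - t"] by simp
      also have "\<dots> \<le> \<bar>t\<bar> + d" using that by simp
      also have "\<dots> < R" using t by (simp add: d_def field_simps)
      finally show ?thesis .
    qed
    have d0: "0 < d" using t by (simp add: d_def)
    have cont: "isCont \<phi> u" if "\<bar>u - t\<bar> \<le> d" for u
      using DERIV_isCont[OF \<phi>[OF d[OF that]]] .
    have "isCont \<Theta> (\<phi> t)"
      by (rule isCont_inverse_function[OF d0]) (use \<Theta> d cont in auto)
    moreover have "\<phi> (\<Theta> y) = y" if "\<phi> (t - d) < y" "y < \<phi> (t + d)" for y
    proof -
      have "\<exists>x\<ge>t - d. x \<le> t + d \<and> \<phi> x = y"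
        by (rule IVT) (use that d0 cont in auto)
      then obtain x where x: "t - d \<le> x" "x \<le> t + d" "\<phi> x = y" by blast
      then show ?thesis using \<Theta>[of x] d[of x] by auto
    qed
    moreover have "\<phi> (t - d) < \<phi> t" "\<phi> t < \<phi> (t + d)"
      using t d0 d[of "t - d"] d[of "t + d"] by (auto intro!: mono)
    ultimately show ?thesis
      using DERIV_inverse_function[of \<phi> "q t" \<Theta> "\<phi> t" "\<phi> (t - d)" "\<phi> (t + d)"] \<phi>[OF t] \<Theta>[OF t] pos[OF t]
      by auto
  qed
  have \<phi>t0: "0 < \<phi> t0" using mono[of 0 t0] t0 \<phi>0 by simp
  \<comment> \<open>This scaling makes \<open>V\<close> correspond to \<open>t0\<close>.\<close>
  define C where "C = V / \<phi> t0"
  have C: "0 < C" "V = C * \<phi> t0" using V \<phi>t0 by (auto simp: C_def)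
  define \<theta> where "\<theta> s = \<Theta> (s / C)" for s
  define z where "z s = C\<^sup>2 * (q (\<theta> s))\<^sup>2" for s
  define z1 where "z1 s = 2 * C * q1 (\<theta> s)" for s
  \<comment> \<open>The factor \<open>C\<close> of \<open>z1\<close> cancels because \<theta> has
    derivative \<open>1 / (C * q)\<close>.\<close>
  define z2 where "z2 s = 2 * q2 (\<theta> s) / q (\<theta> s)" for s
  have \<theta>V: "\<theta> V = t0" "\<theta> (- V) = - t0"
    using \<Theta>[of t0] \<Theta>[of "- t0"] t0 C odd by (auto simp: \<theta>_def)
  have \<theta>0: "\<theta> 0 = 0" using \<Theta>[of 0] t0 \<phi>0 by (simp add: \<theta>_def)
  have "gradient_barrier lam c V \<theta> z z1 z2"
    unfolding gradient_barrier_def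
  proof (intro conjI allI impI)
    show "\<theta> 0 = 0" by (rule \<theta>0)
    show "z1 0 = 0" by (simp add: z1_def \<theta>0 q1_0)
    fix s assume s: "\<bar>s\<bar> \<le> V"
    have "\<exists>t\<ge>- t0. t \<le> t0 \<and> \<phi> t = s / C"
      by (rule IVT) (use s C odd t0 \<phi> DERIV_isCont in \<open>force simp: field_simps abs_le_iff\<close>)+
    then obtain t where t: "- t0 \<le> t" "t \<le> t0" "\<phi> t = s / C" by blast
    then have tR: "\<bar>t\<bar> < R" using t0 by auto
    have \<theta>s: "\<theta> s = t" using \<Theta>[OF tR] t by (simp add: \<theta>_def)
    have sC: "s = C * \<phi> t" using t C by simp
    note qp = pos[OF tR]
    have d\<theta>: "(\<theta> has_real_derivative inverse (q t) * (1 / C)) (at s)"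
      unfolding \<theta>_def[abs_def] using \<Theta>'[OF tR] C
      by (intro DERIV_chain2[of \<Theta>]) (auto simp: t(3) intro!: derivative_eq_intros)
    have q\<theta>: "((\<lambda>s. q (\<theta> s)) has_real_derivative q1 t * (inverse (q t) * (1 / C))) (at s)"
      using DERIV_chain2[OF q d\<theta>] by (simp add: \<theta>s)
    have q1\<theta>: "((\<lambda>s. q1 (\<theta> s)) has_real_derivative q2 t * (inverse (q t) * (1 / C))) (at s)"
      using DERIV_chain2[OF q1 d\<theta>] by (simp add: \<theta>s)
    show "0 < z s" using qp C by (simp add: z_def \<theta>s)
    have "sqrt (z s) = C * q t" using qp C by (simp add: z_def \<theta>s real_sqrt_mult)
    then show "(\<theta> has_real_derivative 1 / sqrt (z s)) (at s)"
      using d\<theta> by (simp add: field_simps)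
    have "(z has_real_derivative C\<^sup>2 * (2 * q t * (q1 t * (inverse (q t) * (1 / C))))) (at s)"
      unfolding z_def[abs_def] by (rule derivative_eq_intros q\<theta> refl)+ (simp add: \<theta>s)
    then show "(z has_real_derivative z1 s) (at s)"
      using qp C by (simp add: z1_def \<theta>s power2_eq_square field_simps)
    have "(z1 has_real_derivative 2 * C * (q2 t * (inverse (q t) * (1 / C)))) (at s)"
      unfolding z1_def[abs_def] by (rule DERIV_cmult[OF q1\<theta>])
    then show "(z1 has_real_derivative z2 s) (at s)"
      using qp C by (simp add: z2_def \<theta>s field_simps)
    have "C\<^sup>2 * ((lam + c) * (q t)\<^sup>2) < C\<^sup>2 * ((q1 t)\<^sup>2 - q t * q2 t + lam * \<phi> t * q1 t)"
      using strict[OF tR] C by simp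
    moreover have "(lam + c + z2 s / 2) * z s = C\<^sup>2 * ((lam + c) * (q t)\<^sup>2) + C\<^sup>2 * (q t * q2 t)"
      using qp by (simp add: z_def z2_def \<theta>s field_simps power2_eq_square)
    moreover have "(z1 s)\<^sup>2 / 4 + lam * s * z1 s / 2 = C\<^sup>2 * ((q1 t)\<^sup>2 + lam * \<phi> t * q1 t)"
      unfolding z1_def \<theta>s unfolding sC by (simp add: power2_eq_square algebra_simps)
    ultimately show "(lam + c + z2 s / 2) * z s < (z1 s)\<^sup>2 / 4 + lam * s * z1 s / 2"
      by (simp add: algebra_simps)
    have "C\<^sup>2 * (q t * q2 t) \<le> C\<^sup>2 * (q1 t)\<^sup>2"
      using concave[OF tR] by (intro mult_left_mono) auto
    then show "2 * z s * z2 s \<le> (z1 s)\<^sup>2"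
      using qp by (simp add: z_def z1_def z2_def \<theta>s power2_eq_square ac_simps)
  qed
  then show ?thesis using \<theta>V by blast
qed

text \<open>A Gaussian profile works on every interval: \<open>(q1 t)\<^sup>2 - q t * q2 t\<close>
  equals \<open>b * (q t)\<^sup>2\<close>, and the term with \<open>lam\<close> is nonnegative
  because \<phi> has the sign of \<open>t\<close> and \<open>q1\<close> the opposite one.\<close>

lemma barrier_nonpositive:
  assumes lam: "lam \<le> 0" and c: "0 \<le> c" and t0: "0 < t0" and V: "0 < V"
  shows "\<exists>\<theta> z z1 z2. gradient_barrier lam c V \<theta> z z1 z2 \<and> \<theta> V = t0 \<and> \<theta> (- V) = - t0"
proof -
  \<comment> \<open>Exceeding \<open>lam + c\<close> makes the inequality strict.\<close>
  define b where "b = c + 1"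
  define q where "q t = exp (- (b * t\<^sup>2 / 2))" for t :: real
  define q1 where "q1 t = - b * t * q t" for t
  define q2 where "q2 t = (b\<^sup>2 * t\<^sup>2 - b) * q t" for t
  have q: "(q has_real_derivative q1 t) (at t)" for t
    unfolding q_def[abs_def] q1_def by (auto intro!: derivative_eq_intros)
  have q1: "(q1 has_real_derivative q2 t) (at t)" for t
    unfolding q1_def[abs_def] q2_def by (auto intro!: derivative_eq_intros q simp: q1_def algebra_simps power2_eq_square)
  have "continuous_on UNIV q"
    using q DERIV_isCont continuous_at_imp_continuous_on by blast
  then obtain \<phi> where \<phi>: "\<And>t. \<bar>t\<bar> < t0 + 1 \<Longrightarrow> (\<phi> has_real_derivative q t) (at t)" "\<And>t. \<phi> (- t) = - \<phi> t"
    by (rule odd_antiderivative[where R = "t0 + 1"]) (auto simp: q_def)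
  have pos: "0 < q t" for t by (simp add: q_def)
  have \<phi>_nonneg: "0 \<le> \<phi> t" if "0 \<le> t" "t < t0 + 1" for t
  proof -
    have "\<phi> 0 \<le> \<phi> t"
      by (rule DERIV_nonneg_imp_nondecreasing[OF that(1)]) (use \<phi>(1) pos that in \<open>force intro: less_imp_le\<close>)
    then show ?thesis using \<phi>(2)[of 0] by simp
  qed
  have sgn: "0 \<le> t * \<phi> t" if "\<bar>t\<bar> < t0 + 1" for t
    using \<phi>_nonneg[of t] \<phi>_nonneg[of "- t"] \<phi>(2)[of t] that by (cases "0 \<le> t") (auto simp: mult_nonpos_nonpos)
  have diff: "(q1 t)\<^sup>2 - q t * q2 t = b * (q t)\<^sup>2" for t
    by (simp add: q1_def q2_def power2_eq_square algebra_simps)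
  show ?thesis
  proof (rule barrier_from_profile[where q = q and \<phi> = \<phi> and R = "t0 + 1"])
    fix t :: real assume t: "\<bar>t\<bar> < t0 + 1"
    have "lam * \<phi> t * q1 t = (- lam) * b * q t * (t * \<phi> t)"
      by (simp add: q1_def)
    also have "\<dots> \<ge> 0"
    proof -
      have "0 \<le> (- lam) * b" using lam c by (intro mult_nonneg_nonneg) (simp_all add: b_def)
      from mult_nonneg_nonneg[OF mult_nonneg_nonneg[OF this less_imp_le[OF pos[of t]]] sgn[OF t]]
      show ?thesis .
    qed
    finally have "0 \<le> lam * \<phi> t * q1 t" .
    moreover have "(lam + c) * (q t)\<^sup>2 < b * (q t)\<^sup>2"
      using pos[of t] lam by (intro mult_strict_right_mono) (auto simp: b_def)
    ultimately show "(lam + c) * (q t)\<^sup>2 < (q1 t)\<^sup>2 - q t * q2 t + lam * \<phi> t * q1 t"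
      using diff[of t] by simp
    have "0 \<le> b * (q t)\<^sup>2" using c by (simp add: b_def)
    then show "q t * q2 t \<le> (q1 t)\<^sup>2" using diff[of t] by simp
  next
    show "q1 0 = 0" by (simp add: q1_def)
  qed (use q q1 \<phi> pos t0 V in auto)
qed

text \<open>
  The profile has derivative \<open>q(t) = exp(- c t\<^sup>2 / 4) cos(a t)\<close>: for the solution of
  \<open>\<phi>'' + c t \<phi>' + \<mu> \<phi> = 0\<close> the function \<open>exp(c t\<^sup>2 / 4) \<phi>'\<close> solves a Schroedinger equation with
  potential \<open>c\<^sup>2 t\<^sup>2 / 4 - c / 2\<close>; dropping the quadratic term leaves \<open>cos(a t)\<close> with \<open>\<mu> = a\<^sup>2 - c / 2\<close>.
\<close>

lemma barrier_positive:
  assumes lam: "0 \<le> lam" and c: "0 \<le> c" and a: "0 < a" "lam + c / 2 < a\<^sup>2"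
    and t0: "0 < t0" "t0 < pi / (2 * a)" and V: "0 < V"
  shows "\<exists>\<theta> z z1 z2. gradient_barrier lam c V \<theta> z z1 z2 \<and> \<theta> V = t0 \<and> \<theta> (- V) = - t0"
proof -
  \<comment> \<open>The first positive zero of the cosine factor.\<close>
  define R where "R = pi / (2 * a)"
  define e where "e t = exp (- (c * t\<^sup>2 / 4))" for t :: real
  define q where "q t = e t * cos (a * t)" for t
  define q1 where "q1 t = - e t * (c * t / 2 * cos (a * t) + a * sin (a * t))" for t
  define q2 where "q2 t = e t * ((c\<^sup>2 * t\<^sup>2 / 4 - c / 2 - a\<^sup>2) * cos (a * t) + c * t * a * sin (a * t))" for t
  have e: "(e has_real_derivative - (c * t / 2) * e t) (at t)" for t
    unfolding e_def[abs_def] by (auto intro!: derivative_eq_intros)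
  have q: "(q has_real_derivative q1 t) (at t)" for t
    unfolding q_def[abs_def] q1_def by (auto intro!: derivative_eq_intros e simp: algebra_simps)
  have q1: "(q1 has_real_derivative q2 t) (at t)" for t
    unfolding q1_def[abs_def] q2_def
    by (auto intro!: derivative_eq_intros e simp: field_simps power2_eq_square)
  have "continuous_on UNIV q"
    using q DERIV_isCont continuous_at_imp_continuous_on by blast
  then obtain \<phi> where \<phi>: "\<And>t. \<bar>t\<bar> < R \<Longrightarrow> (\<phi> has_real_derivative q t) (at t)" "\<And>t. \<phi> (- t) = - \<phi> t"
    by (rule odd_antiderivative[where R = R]) (auto simp: q_def e_def)
  have epos: "0 < e t" for t by (simp add: e_def)
  have cospos: "0 < cos (a * t)" if "\<bar>t\<bar> < R" for t
  proof (rule cos_gt_zero_pi)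
    have "\<bar>a * t\<bar> < pi / 2"
      using that a by (simp add: R_def abs_mult field_simps)
    then show "- (pi / 2) < a * t" "a * t < pi / 2" by auto
  qed
  \<comment> \<open>Where \<open>q\<close> is positive this is \<open>(q t)\<^sup>2\<close> times
    minus the second derivative of \<open>ln q\<close>; the exponential contributes
    \<open>c / 2\<close>, the cosine \<open>a\<^sup>2 / cos\<^sup>2\<close>.\<close>
  have diff: "(q1 t)\<^sup>2 - q t * q2 t = (e t)\<^sup>2 * (c / 2 * (cos (a * t))\<^sup>2 + a\<^sup>2)" for t
  proof -
    have "(- E * (c * t / 2 * K + a * Z))\<^sup>2
        - E * K * (E * ((c\<^sup>2 * t\<^sup>2 / 4 - c / 2 - a\<^sup>2) * K + c * t * a * Z))
        = E\<^sup>2 * (c / 2 * K\<^sup>2 + a\<^sup>2 * (Z\<^sup>2 + K\<^sup>2))" for E K Z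
      by (simp add: power2_eq_square field_simps)
    from this[of "e t" "cos (a * t)" "sin (a * t)"] show ?thesis
      by (simp add: q1_def q_def q2_def)
  qed
  define \<mu> where "\<mu> = a\<^sup>2 - c / 2"
  have \<mu>: "lam < \<mu>" using a by (simp add: \<mu>_def)
  \<comment> \<open>Up to sign \<psi> is the defect
    \<open>\<phi>'' + c t \<phi>' + \<mu> \<phi>\<close> of the differential equation. Its
    derivative is the dropped quadratic term times \<open>q\<close>, which is nonnegative while the
    cosine is positive.\<close>
  define \<psi> where "\<psi> t = e t * (a * sin (a * t) - c * t / 2 * cos (a * t)) - \<mu> * \<phi> t" for t
  have \<psi>: "(\<psi> has_real_derivative e t * cos (a * t) * (c\<^sup>2 * t\<^sup>2 / 4)) (at t)" if "\<bar>t\<bar> < R" for t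
    unfolding \<psi>_def[abs_def]
    by (auto intro!: derivative_eq_intros e \<phi> that
        simp: \<mu>_def q_def algebra_simps add_divide_distrib diff_divide_distrib power2_eq_square)
  have \<psi>_nonneg: "0 \<le> \<psi> t" if "0 \<le> t" "t < R" for t
  proof -
    have "\<psi> 0 \<le> \<psi> t"
    proof (rule DERIV_nonneg_imp_nondecreasing[OF that(1)])
      fix x assume x: "0 \<le> x" "x \<le> t"
      then have "\<bar>x\<bar> < R" using that by simp
      then show "\<exists>y. (\<psi> has_real_derivative y) (at x) \<and> 0 \<le> y"
        using \<psi>[of x] mult_nonneg_nonneg[OF mult_nonneg_nonneg[OF less_imp_le[OF epos[of x]]
              less_imp_le[OF cospos[of x]]], of "c\<^sup>2 * x\<^sup>2 / 4"] by auto
    qed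
    then show ?thesis using \<phi>(2)[of 0] by (simp add: \<psi>_def)
  qed
  have \<phi>_nonneg: "0 \<le> \<phi> t" if "0 \<le> t" "t < R" for t
  proof -
    have "\<phi> 0 \<le> \<phi> t"
    proof (rule DERIV_nonneg_imp_nondecreasing[OF that(1)])
      fix x assume x: "0 \<le> x" "x \<le> t"
      then have "\<bar>x\<bar> < R" using that by simp
      then show "\<exists>y. (\<phi> has_real_derivative y) (at x) \<and> 0 \<le> y"
        using \<phi>(1) epos[of x] cospos[of x] by (intro exI conjI) (auto simp: q_def)
    qed
    then show ?thesis using \<phi>(2)[of 0] by simp
  qed
  have main: "(lam + c) * (q t)\<^sup>2 < (q1 t)\<^sup>2 - q t * q2 t + lam * \<phi> t * q1 t" if t: "0 \<le> t" "t < R" for t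
  proof -
    let ?k = "cos (a * t)" and ?s = "sin (a * t)"
    have k: "0 < ?k" using cospos t by simp
    have "a * t < pi / 2" using t a by (simp add: R_def field_simps)
    then have "a * t \<le> pi" using pi_gt_zero by linarith
    then have s: "0 \<le> ?s" using t a by (intro sin_ge_zero) auto
    \<comment> \<open>This expression is \<open>- q1 t\<close>, so the bound for
      \<open>lam * \<phi> t\<close> can be multiplied by it.\<close>
    have w: "0 \<le> e t * (c * t / 2 * ?k + a * ?s)"
      using epos[of t] c t k s a by (auto intro!: mult_nonneg_nonneg add_nonneg_nonneg less_imp_le)
    have "lam * \<phi> t \<le> \<mu> * \<phi> t" using \<mu> \<phi>_nonneg[OF t] by (intro mult_right_mono) auto
    also have "\<dots> \<le> e t * (a * ?s - c * t / 2 * ?k)"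
      using \<psi>_nonneg[OF t] by (simp add: \<psi>_def)
    finally have "lam * \<phi> t * (e t * (c * t / 2 * ?k + a * ?s))
        \<le> e t * (a * ?s - c * t / 2 * ?k) * (e t * (c * t / 2 * ?k + a * ?s))"
      using w by (rule mult_right_mono)
    also have "\<dots> = (e t)\<^sup>2 * (a\<^sup>2 * ?s\<^sup>2 - c\<^sup>2 * t\<^sup>2 / 4 * ?k\<^sup>2)"
      by (simp add: power2_eq_square algebra_simps)
    finally have 1: "lam * \<phi> t * q1 t \<ge> - ((e t)\<^sup>2 * (a\<^sup>2 * ?s\<^sup>2 - c\<^sup>2 * t\<^sup>2 / 4 * ?k\<^sup>2))"
      by (simp add: q1_def)
    \<comment> \<open>The bound on \<open>a\<close> yields
      \<open>lam + c < a\<^sup>2 + c / 2\<close>; the further quadratic term matches the one left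
      over from the preceding estimate.\<close>
    have "(lam + c) * ((e t)\<^sup>2 * ?k\<^sup>2) < (a\<^sup>2 + c / 2 + c\<^sup>2 * t\<^sup>2 / 4) * ((e t)\<^sup>2 * ?k\<^sup>2)"
    proof (rule mult_strict_right_mono)
      have "0 \<le> c\<^sup>2 * t\<^sup>2 / 4" by simp
      then show "lam + c < a\<^sup>2 + c / 2 + c\<^sup>2 * t\<^sup>2 / 4" using a(2) by linarith
    qed (use epos[of t] k in simp)
    also have "\<dots> = (e t)\<^sup>2 * (c / 2 * ?k\<^sup>2 + a\<^sup>2) - (e t)\<^sup>2 * (a\<^sup>2 * ?s\<^sup>2 - c\<^sup>2 * t\<^sup>2 / 4 * ?k\<^sup>2)"
      unfolding sin_squared_eq by (simp add: algebra_simps)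
    finally show ?thesis
      using 1 diff[of t] by (simp add: q_def power_mult_distrib)
  qed
  show ?thesis
  proof (rule barrier_from_profile[where q = q and \<phi> = \<phi> and R = R])
    fix t assume t: "\<bar>t\<bar> < R"
    show "(lam + c) * (q t)\<^sup>2 < (q1 t)\<^sup>2 - q t * q2 t + lam * \<phi> t * q1 t"
    proof (cases "0 \<le> t")
      \<comment> \<open>Reflection: \<open>q\<close> and \<open>q2\<close> are even,
        \<open>q1\<close> and \<phi> are odd.\<close>
      case False
      then have "(lam + c) * (q (- t))\<^sup>2 < (q1 (- t))\<^sup>2 - q (- t) * q2 (- t) + lam * \<phi> (- t) * q1 (- t)"
        using main[of "- t"] t by simp
      moreover have "q (- t) = q t" "q1 (- t) = - q1 t" "q2 (- t) = q2 t"
        by (simp_all add: q_def q1_def q2_def e_def algebra_simps)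
      ultimately show ?thesis using \<phi>(2) by simp
    qed (use main t in auto)
    have "0 \<le> (e t)\<^sup>2 * (c / 2 * (cos (a * t))\<^sup>2 + a\<^sup>2)" using c by simp
    then show "q t * q2 t \<le> (q1 t)\<^sup>2" using diff[of t] by simp
    show "0 < q t" using epos[of t] cospos[OF t] by (simp add: q_def)
  next
    show "q1 0 = 0" by (simp add: q1_def)
  qed (use q q1 \<phi> t0 V in \<open>auto simp: R_def\<close>)
qed

section \<open>From charts to the manifold\<close>

lemma (in pos_def) cauchy_schwarz: "(ip V X)\<^sup>2 \<le> ip V V * ip X X"
proof (cases "X = 0")
  case False
  define t where "t = ip V X / ip X X"
  have X: "0 < ip X X" using pos[OF False] .
  have "ip V X = t * ip X X" using X by (simp add: t_def)
  moreover have "0 \<le> ip (V - t *\<^sub>R X) (V - t *\<^sub>R X)" by (rule nonneg)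
  then have "0 \<le> ip V V - 2 * t * ip V X + t * t * ip X X"
    using metric_ip_add_left[of A V "- (t *\<^sub>R X)" "V - t *\<^sub>R X"]
    by (simp add: metric_ip_linear ip_sym[of X V] algebra_simps)
  ultimately have "t * t * ip X X \<le> ip V V" by simp
  then have "t * t * ip X X * ip X X \<le> ip V V * ip X X"
    using X by (intro mult_right_mono) auto
  then show ?thesis
    unfolding \<open>ip V X = t * ip X X\<close> by (simp add: power2_eq_square ac_simps)
qed simp

text \<open>\<open>u\<close> and \<open>u'\<close> are the components of one covector in two
  coordinate systems with Jacobian matrix \<open>J\<close>. Invertibility of \<open>A\<close> forces
  that of \<open>J\<close>, which maps the gradient vector \<open>X\<close> to
  \<open>X'\<close>.\<close>

lemma energy_transform:
  fixes J A A' :: "real ^ 'n ^ 'n::finite"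
  assumes A: "sym_pos_def A" and A': "sym_pos_def A'" and J: "A = transpose J ** A' ** J"
    and u: "u = transpose J *v u'"
  shows "metric_ip A (matrix_inv A *v u) (matrix_inv A *v u)
    = metric_ip A' (matrix_inv A' *v u') (matrix_inv A' *v u')"
proof -
  interpret A: pos_def A using A by unfold_locales
  interpret A': pos_def A' using A' by unfold_locales
  define X where "X = matrix_inv A *v u"
  define X' where "X' = matrix_inv A' *v u'"
  have AX: "A *v X = u" "A' *v X' = u'" by (simp_all add: X_def X'_def A.mul_inv A'.mul_inv)
  have "x = 0" if "J *v x = 0" for x
  proof -
    have "A *v x = 0" using that by (simp add: J flip: matrix_vector_mul_assoc)
    then show ?thesis using A.mul_inv(2)[of x] by simp
  qed
  then have "invertible J"
    using matrix_left_invertible_ker invertible_left_inverse by blast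
  then obtain K where "J ** K = mat 1" unfolding invertible_def by blast
  then have K: "transpose K ** transpose J = mat 1"
    by (metis matrix_transpose_mul transpose_mat)
  have "transpose J *v (A' *v (J *v X)) = transpose J *v (A' *v X')"
    using AX u by (simp add: J matrix_vector_mul_assoc matrix_mul_assoc)
  moreover have "transpose K *v (transpose J *v w) = w" for w
    by (simp only: matrix_vector_mul_assoc K matrix_vector_mul_lid)
  ultimately have "A' *v (J *v X) = A' *v X'"
    by metis
  then have JX: "J *v X = X'"
    using A'.mul_inv(2) by metis
  have "metric_ip A X X = X \<bullet> (transpose J *v (A' *v (J *v X)))"
    by (simp add: metric_ip_def J matrix_vector_mul_assoc matrix_mul_assoc)
  also have "\<dots> = metric_ip A' (J *v X) (J *v X)"
    by (metis dot_lmul_matrix metric_ip_def transpose_matrix_vector transpose_transpose)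
  finally have "metric_ip A X X = metric_ip A' X' X'" unfolding JX .
  then show ?thesis unfolding X_def X'_def .
qed

section \<open>Functions on the manifold through their chart expressions\<close>

locale compact_manifold =
  fixes M :: "('m, 'n::finite) riem_structure"
  assumes manifold: "compact_riemannian_manifold_with_boundary M"
begin

abbreviation "k \<equiv> idx M"
abbreviation "T \<equiv> mtop M"

lemma chart: "c \<in> atlas M \<Longrightarrow> is_chart T k c"
  using manifold by (simp add: compact_riemannian_manifold_with_boundary_def)

lemma cover: "(\<Union>c\<in>atlas M. source c) = topspace T"
  using manifold by (simp add: compact_riemannian_manifold_with_boundary_def)

lemma riem_chart: "c \<in> atlas M \<Longrightarrow> riem_chart k (target c) (metric M c)"
  using manifold chart
  by unfold_locales (auto simp: compact_riemannian_manifold_with_boundary_def is_chart_def)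

context
  fixes c assumes c: "c \<in> atlas M"
begin

lemma inj_coord: "inj_on (coord c) (source c)"
proof -
  have "source c \<subseteq> topspace T" using c cover by blast
  then have "topspace (subtopology T (source c)) = source c" by auto
  then show ?thesis
    using chart[OF c] homeomorphic_imp_injective_map unfolding is_chart_def by metis
qed

lemma param_coord: "p \<in> source c \<Longrightarrow> param c (coord c p) = p"
  by (simp add: param_def inj_coord)

lemma coord_param: "y \<in> target c \<Longrightarrow> coord c (param c y) = y"
  by (simp add: param_def target_def f_inv_into_f)

lemma param_source: "y \<in> target c \<Longrightarrow> param c y \<in> source c"
  by (simp add: param_def target_def inv_into_into)

lemma coord_target: "p \<in> source c \<Longrightarrow> coord c p \<in> target c"
  by (simp add: target_def)

lemma param_bdry: "y \<in> target c \<Longrightarrow> y $ k = 0 \<Longrightarrow> param c y \<in> bdry M"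
  using c coord_param param_source unfolding bdry_def by (auto intro!: bexI[of _ c])

lemma overlap_open:
  assumes c': "c' \<in> atlas M"
  shows "openin (top_of_set (half_space k)) (coord c ` (source c \<inter> source c'))"
proof -
  have "openin T (source c \<inter> source c')"
    using chart[OF c] chart[OF c'] by (auto simp: is_chart_def)
  then have "openin (subtopology T (source c)) (source c \<inter> source c')"
    by (auto simp: openin_subtopology)
  moreover have "open_map (subtopology T (source c)) (top_of_set (target c)) (coord c)"
    using chart[OF c] homeomorphic_imp_open_map by (auto simp: is_chart_def)
  ultimately have "openin (top_of_set (target c)) (coord c ` (source c \<inter> source c'))"
    by (simp add: open_map_def)
  then show ?thesis
    using chart[OF c] openin_trans by (auto simp: is_chart_def)
qed

end

text \<open>The squared length of the gradient at a point of the manifold, with the chart as an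
  argument until independence of it is established.\<close>

definition energy :: "('m \<Rightarrow> real) \<Rightarrow> ('m, 'n) chart \<Rightarrow> 'm \<Rightarrow> real" where
  "energy v c p = (let X = gradient k (metric M c) (v \<circ> param c) (coord c p)
     in metric_ip (metric M c (coord c p)) X X)"

text \<open>The transformation law of the metric and the chain rule for the differential of
  \<open>v\<close> reduce this to linear algebra at one point.\<close>

lemma energy_invariant:
  assumes v: "smooth_function M v" and c: "c \<in> atlas M" "c' \<in> atlas M"
    and p: "p \<in> source c" "p \<in> source c'"
  shows "energy v c p = energy v c' p"
proof -
  define S where "S = coord c ` (source c \<inter> source c')"
  define \<tau> where "\<tau> = coord c' \<circ> param c"
  define y where "y = coord c p"
  define J where "J = matrix (frechet_derivative \<tau> (at y within half_space k))"
  interpret C: riem_chart k "target c" "metric M c" using riem_chart[OF c(1)] .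
  interpret C': riem_chart k "target c'" "metric M c'" using riem_chart[OF c(2)] .
  have opS: "openin (top_of_set (half_space k)) S"
    unfolding S_def by (rule overlap_open[OF c])
  have yS: "y \<in> S" using p by (simp add: S_def y_def)
  have y: "y \<in> target c" using coord_target[OF c(1) p(1)] by (simp add: y_def)
  have \<tau>y: "\<tau> y = coord c' p" using param_coord[OF c(1) p(1)] by (simp add: \<tau>_def y_def)
  have y': "\<tau> y \<in> target c'" using coord_target[OF c(2) p(2)] by (simp add: \<tau>y)
  have trans: "(\<forall>a. smooth_on k S (\<lambda>y. \<tau> y $ a)) \<and>
      (\<forall>y\<in>S. let J = matrix (frechet_derivative \<tau> (at y within half_space k))
         in metric M c y = transpose J ** metric M c' (\<tau> y) ** J)"
    using manifold c unfolding compact_riemannian_manifold_with_boundary_def S_def \<tau>_def Let_def by blast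
  then have J: "metric M c y = transpose J ** metric M c' (\<tau> y) ** J"
    using yS by (simp add: J_def Let_def)
  have S\<tau>: "\<tau> z \<in> half_space k" if z: "z \<in> S" for z
  proof -
    obtain p' where p': "p' \<in> source c" "p' \<in> source c'" "z = coord c p'" using z by (auto simp: S_def)
    then have "\<tau> z = coord c' p'" using param_coord[OF c(1)] by (simp add: \<tau>_def)
    then show ?thesis using coord_target[OF c(2) p'(2)] C'.S_sub by simp
  qed
  have "(\<lambda>y. \<tau> y $ a) differentiable (at y within half_space k)" for a
    using trans yS unfolding smooth_on_def by (metis Ck_on.simps(2))
  then have "\<tau> differentiable (at y within half_space k)"
    by (subst differentiable_componentwise_within) (auto simp: Basis_vec_def inner_axis)
  then have D\<tau>: "(\<tau> has_derivative frechet_derivative \<tau> (at y within half_space k)) (at y within half_space k)"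
    using frechet_derivative_works by blast
  then have lin: "linear (frechet_derivative \<tau> (at y within half_space k))"
    by (rule has_derivative_linear)
  have frJ: "frechet_derivative \<tau> (at y within half_space k) x = J *v x" for x
    unfolding J_def using lin by (simp add: matrix_works scalar_mult_eq_scaleR[abs_def])
  have DJ: "(\<tau> has_derivative (\<lambda>x. J *v x)) (at y within half_space k)"
    using D\<tau> frJ by (simp add: frJ[abs_def])
  \<comment> \<open>The transition map \<tau> is known to take values in the half-space only on
    \<open>S\<close>, so the chain rule is applied within this relative neighbourhood of
    \<open>y\<close>.\<close>
  have at_eq: "at y within half_space k = at y within S"
  proof -
    obtain U where U: "open U" "S = half_space k \<inter> U" using opS by (auto simp: openin_open)
    then show ?thesis using yS by (intro at_within_nhd[of _ U]) auto
  qed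
  have smv: "C.smooth (v \<circ> param c)" "C'.smooth (v \<circ> param c')"
    using v c by (auto simp: smooth_function_def)
  have D': "((v \<circ> param c') has_derivative (\<lambda>X. \<Sum>i\<in>UNIV. X $ i * partial k i (v \<circ> param c') (\<tau> y)))
      (at (\<tau> y) within half_space k)"
    by (rule has_derivative_partial[OF C'.smooth_differentiable[OF smv(2) y']])
  have chain: "((\<lambda>z. (v \<circ> param c') (\<tau> z)) has_derivative
      (\<lambda>x. \<Sum>i\<in>UNIV. (J *v x) $ i * partial k i (v \<circ> param c') (\<tau> y))) (at y within half_space k)"
  proof -
    have 1: "(\<tau> has_derivative (*v) J) (at y within S)" using DJ at_eq by simp
    have 2: "((v \<circ> param c') has_derivative (\<lambda>X. \<Sum>i\<in>UNIV. X $ i * partial k i (v \<circ> param c') (\<tau> y)))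
        (at (\<tau> y) within \<tau> ` S)"
      by (rule has_derivative_subset[OF D']) (use S\<tau> in auto)
    show ?thesis unfolding at_eq using has_derivative_in_compose[OF 1 2] .
  qed
  have eqv: "(v \<circ> param c') (\<tau> z) = (v \<circ> param c) z" if "z \<in> S" for z
    using that param_coord[OF c(1)] param_coord[OF c(2)] by (auto simp: S_def \<tau>_def)
  have "((v \<circ> param c) has_derivative
      (\<lambda>x. \<Sum>i\<in>UNIV. (J *v x) $ i * partial k i (v \<circ> param c') (\<tau> y))) (at y within half_space k)"
    by (rule differentiable_cong_open[OF opS yS eqv chain])
  then have "partial k j (v \<circ> param c) y = (\<Sum>i\<in>UNIV. (J *v axis j 1) $ i * partial k i (v \<circ> param c') (\<tau> y))" for j
    using C.S_sub[OF y] by (rule partial_eq)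
  then have "(\<chi> j. partial k j (v \<circ> param c) y) = transpose J *v (\<chi> i. partial k i (v \<circ> param c') (\<tau> y))"
    by (simp add: vec_eq_iff matrix_vector_mul_component inner_axis del: transpose_matrix_vector)
      (simp add: inner_vec_def transpose_def)
  from energy_transform[OF C.spd_metric[OF y] C'.spd_metric[OF y'] J this]
  show ?thesis by (simp add: energy_def gradient_def Let_def \<tau>y flip: y_def)
qed

text \<open>The chart domains form an open cover, so continuity may be checked on coordinate
  expressions and pasted.\<close>

lemma continuous_from_charts:
  assumes "\<And>c. c \<in> atlas M \<Longrightarrow> continuous_on (target c) (f c)"
    and "\<And>c p. c \<in> atlas M \<Longrightarrow> p \<in> source c \<Longrightarrow> u p = f c (coord c p)"
  shows "continuous_map T euclideanreal u"
proof (rule pasting_lemma[where I = "atlas M" and T = source and f = "\<lambda>_. u"])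
  fix c assume c: "c \<in> atlas M"
  show "openin T (source c)" using chart[OF c] by (simp add: is_chart_def)
  have "continuous_map (subtopology T (source c)) (top_of_set (target c)) (coord c)"
    using chart[OF c] homeomorphic_imp_continuous_map by (auto simp: is_chart_def)
  moreover have "continuous_map (top_of_set (target c)) euclideanreal (f c)"
    using assms(1)[OF c] by simp
  ultimately have "continuous_map (subtopology T (source c)) euclideanreal (f c \<circ> coord c)"
    by (rule continuous_map_compose)
  then show "continuous_map (subtopology T (source c)) euclideanreal u"
    by (rule continuous_map_eq) (use assms(2)[OF c] in auto)
qed (use cover in auto)

lemma attains_max:
  assumes u: "continuous_map T euclideanreal u" and ne: "topspace T \<noteq> {}"
  obtains p where "p \<in> topspace T" "\<And>q. q \<in> topspace T \<Longrightarrow> u q \<le> u p"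
proof -
  have "compactin T (topspace T)"
    using manifold by (simp add: compact_riemannian_manifold_with_boundary_def compact_space_def)
  then have "compact (u ` topspace T)"
    using image_compactin[OF _ u] by auto
  then obtain s where "s \<in> u ` topspace T" "\<forall>t\<in>u ` topspace T. t \<le> s"
    using compact_attains_sup[of "u ` topspace T"] ne by blast
  then show ?thesis using that by auto
qed

end

section \<open>Global gradient estimate and lower bounds for the inradius\<close>

locale eigenfunction = compact_manifold M for M :: "('m, 'n::finite) riem_structure" +
  fixes v :: "'m \<Rightarrow> real" and lam cc :: real
  assumes mean: "nonneg_mean_curvature M" and ric: "ricci_ge M (- cc)"
    and v_smooth: "smooth_function M v"
    and v_eigen: "\<And>c p. c \<in> atlas M \<Longrightarrow> p \<in> source c \<Longrightarrow>
       laplacian (idx M) (metric M c) (v \<circ> param c) (coord c p) = - lam * v p"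
    and v_bdry: "\<And>p. p \<in> bdry M \<Longrightarrow> v p = 0"
begin

lemma eigen_chart: "c \<in> atlas M \<Longrightarrow> eigen_chart k (target c) (metric M c) (v \<circ> param c) lam"
proof -
  assume c: "c \<in> atlas M"
  interpret riem_chart k "target c" "metric M c" using riem_chart[OF c] .
  show ?thesis
  proof
    show "smooth (v \<circ> param c)" using v_smooth c by (simp add: smooth_function_def)
    show "laplacian k (metric M c) (v \<circ> param c) y = - lam * (v \<circ> param c) y" if "y \<in> target c" for y
      using v_eigen[OF c param_source[OF c that]] coord_param[OF c that] by simp
  qed
qed

lemma v_continuous: "continuous_map T euclideanreal v"
proof (rule continuous_from_charts[where f = "\<lambda>c. v \<circ> param c"])
  fix c assume c: "c \<in> atlas M"
  interpret eigen_chart k "target c" "metric M c" "v \<circ> param c" lam using eigen_chart[OF c] .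
  show "continuous_on (target c) (v \<circ> param c)" by (rule smooth_continuous[OF smooth_v])
  show "v p = (v \<circ> param c) (coord c p)" if "p \<in> source c" for p
    using param_coord[OF c that] by simp
qed

context
  fixes V :: real and \<theta> z z1 z2 :: "real \<Rightarrow> real"
  assumes bound: "\<And>p. p \<in> topspace T \<Longrightarrow> \<bar>v p\<bar> \<le> V"
    and barrier: "gradient_barrier lam cc V \<theta> z z1 z2"
begin

lemma chart_bound: "c \<in> atlas M \<Longrightarrow> y \<in> target c \<Longrightarrow> \<bar>(v \<circ> param c) y\<bar> \<le> V"
  using bound param_source cover by fastforce

lemma z_pos: "\<bar>s\<bar> \<le> V \<Longrightarrow> 0 < z s"
  and \<theta>_deriv: "\<bar>s\<bar> \<le> V \<Longrightarrow> (\<theta> has_real_derivative 1 / sqrt (z s)) (at s)"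
  and z_deriv: "\<bar>s\<bar> \<le> V \<Longrightarrow> (z has_real_derivative z1 s) (at s)"
  and z1_deriv: "\<bar>s\<bar> \<le> V \<Longrightarrow> (z1 has_real_derivative z2 s) (at s)"
  and strict: "\<bar>s\<bar> \<le> V \<Longrightarrow> (lam + cc + z2 s / 2) * z s < (z1 s)\<^sup>2 / 4 + lam * s * z1 s / 2"
  and concave: "\<bar>s\<bar> \<le> V \<Longrightarrow> 2 * z s * z2 s \<le> (z1 s)\<^sup>2"
  using barrier unfolding gradient_barrier_def by blast+

text \<open>The quotient \<open>F\<close> of squared gradient and \<open>z(v)\<close> is continuous
  on a compact space. Were its maximum at least 1, \<open>no_touching\<close> would apply at a
  maximum point with this maximum as \<alpha>.\<close>

lemma gradient_estimate:
  assumes c: "c \<in> atlas M" and y: "y \<in> target c"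
  shows "metric_ip (metric M c y) (gradient k (metric M c) (v \<circ> param c) y)
    (gradient k (metric M c) (v \<circ> param c) y) < z (v (param c y))"
proof -
  \<comment> \<open>Choosing some chart at each point makes \<open>F\<close> a function on the
    manifold; invariance of the energy removes the dependence on the choice.\<close>
  define pick where "pick p = (SOME c. c \<in> atlas M \<and> p \<in> source c)" for p
  define F where "F p = energy v (pick p) p / z (v p)" for p
  have F: "F p = energy v c p / z (v p)" if "c \<in> atlas M" "p \<in> source c" for c p
  proof -
    have "pick p \<in> atlas M \<and> p \<in> source (pick p)"
      unfolding pick_def by (rule someI[of _ c]) (use that in blast)
    then show ?thesis
      using energy_invariant[OF v_smooth, of "pick p" c p] that by (simp add: F_def)
  qed
  have chartF: "F (param c w) = eigen_chart.E k (metric M c) (v \<circ> param c) w / z ((v \<circ> param c) w)"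
    if "c \<in> atlas M" "w \<in> target c" for c w
    using F[OF that(1) param_source[OF that]] coord_param[OF that]
      eigen_chart.E_def[OF eigen_chart[OF that(1)], of w]
    by (simp add: energy_def Let_def)
  have "continuous_map T euclideanreal F"
  proof (rule continuous_from_charts)
    fix c assume c: "c \<in> atlas M"
    interpret eigen_chart k "target c" "metric M c" "v \<circ> param c" lam using eigen_chart[OF c] .
    have "continuous_on (target c) (\<lambda>w. z ((v \<circ> param c) w))"
    proof (rule continuous_on_compose2[of "{- V..V}" z])
      show "continuous_on {- V..V} z"
        by (intro continuous_at_imp_continuous_on ballI DERIV_isCont[OF z_deriv]) auto
      show "(v \<circ> param c) ` target c \<subseteq> {- V..V}"
        using chart_bound[OF c] by (force simp: abs_le_iff)
    qed (rule smooth_continuous[OF smooth_v])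
    then show "continuous_on (target c) (\<lambda>w. E w / z ((v \<circ> param c) w))"
      using z_pos[OF chart_bound[OF c]]
      by (intro continuous_on_divide smooth_continuous[OF smooth_E]) force+
    show "F p = E (coord c p) / z ((v \<circ> param c) (coord c p))" if "p \<in> source c" for p
      using chartF[OF c coord_target[OF c that]] param_coord[OF c that] by simp
  qed
  moreover have pc: "param c y \<in> topspace T" using param_source[OF c y] c cover by blast
  ultimately obtain p0 where p0: "p0 \<in> topspace T" "\<And>q. q \<in> topspace T \<Longrightarrow> F q \<le> F p0"
    using attains_max[of F] by blast
  have "F p0 < 1"
  proof (rule ccontr)
    assume "\<not> F p0 < 1"
    then have A: "1 \<le> F p0" by simp
    obtain c0 where c0: "c0 \<in> atlas M" "p0 \<in> source c0" using p0(1) cover by blast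
    define y0 where "y0 = coord c0 p0"
    have y0: "y0 \<in> target c0" using coord_target[OF c0] by (simp add: y0_def)
    have p0y0: "param c0 y0 = p0" using param_coord[OF c0] by (simp add: y0_def)
    interpret eigen_chart k "target c0" "metric M c0" "v \<circ> param c0" lam using eigen_chart[OF c0(1)] .
    note b = chart_bound[OF c0(1)]
    show False
    proof (rule no_touching[where y = y0 and z = z and ?z1.0 = z1 and ?z2.0 = z2 and \<alpha> = "F p0" and c = cc])
      show "y0 \<in> target c0" by (rule y0)
      show "(z has_real_derivative z1 ((v \<circ> param c0) w)) (at ((v \<circ> param c0) w))"
        "(z1 has_real_derivative z2 ((v \<circ> param c0) w)) (at ((v \<circ> param c0) w))" if "w \<in> target c0" for w
        using z_deriv[OF b[OF that]] z1_deriv[OF b[OF that]] by auto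
      show "z1 0 = 0" using barrier by (simp add: gradient_barrier_def)
      show "0 < z ((v \<circ> param c0) y0)" by (rule z_pos[OF b[OF y0]])
      show "1 \<le> F p0" by (rule A)
      show "E w \<le> F p0 * z ((v \<circ> param c0) w)" if w: "w \<in> target c0" for w
      proof -
        have "F (param c0 w) \<le> F p0" using p0(2) param_source[OF c0(1) w] c0(1) cover by blast
        then show ?thesis
          using z_pos[OF b[OF w]] by (simp add: chartF[OF c0(1) w] pos_divide_le_eq)
      qed
      show "E y0 = F p0 * z ((v \<circ> param c0) y0)"
        using z_pos[OF b[OF y0]] chartF[OF c0(1) y0] p0y0 by simp
      show "- cc * E y0 \<le> metric_ip (ricci k (metric M c0) y0) (X y0) (X y0)"
        unfolding E_def using ric c0(1) y0 unfolding ricci_ge_def by blast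
      show "(v \<circ> param c0) w = 0" if "w \<in> target c0" "w $ k = 0" for w
        using v_bdry[OF param_bdry[OF c0(1) that]] by simp
      show "0 \<le> mean_curvature k (metric M c0) y0" if "y0 $ k = 0"
      proof -
        have "p0 \<in> bdry M" using param_bdry[OF c0(1) y0 that] p0y0 by simp
        then show ?thesis using mean c0 unfolding nonneg_mean_curvature_def y0_def by blast
      qed
      show "(lam + cc + z2 ((v \<circ> param c0) y0) / 2) * z ((v \<circ> param c0) y0)
          < (z1 ((v \<circ> param c0) y0))\<^sup>2 / 4 + lam * (v \<circ> param c0) y0 * z1 ((v \<circ> param c0) y0) / 2"
        by (rule strict[OF b[OF y0]])
      show "2 * z ((v \<circ> param c0) y0) * z2 ((v \<circ> param c0) y0) \<le> (z1 ((v \<circ> param c0) y0))\<^sup>2"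
        by (rule concave[OF b[OF y0]])
    qed
  qed
  then have "F (param c y) < 1" using p0(2)[OF pc] by simp
  then show ?thesis
    using z_pos[OF chart_bound[OF c y]] eigen_chart.E_def[OF eigen_chart[OF c], of y]
    by (simp add: chartF[OF c y])
qed

text \<open>By the gradient estimate \<open>\<theta>(v)\<close> has gradient of length below 1, so
  along each piece of the curve it changes by at most the length of that piece.\<close>

lemma curve_estimate: "is_curve_length M p q L \<Longrightarrow> \<bar>\<theta> (v q) - \<theta> (v p)\<bar> \<le> L"
proof (induction rule: is_curve_length.induct)
  case (const p)
  then show ?case by simp
next
  case (append p q L c \<gamma>)
  note c = append(2) and \<gamma>_in = append(4)
  interpret eigen_chart k "target c" "metric M c" "v \<circ> param c" lam using eigen_chart[OF c] .
  obtain D where D: "\<And>t. t \<in> {0..1} \<Longrightarrow> (\<gamma> has_vector_derivative D t) (at t)" "continuous_on {0..1} D"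
    using append(3) unfolding C1_differentiable_on_def by blast
  define f where "f y = \<theta> ((v \<circ> param c) y)" for y
  define h' where "h' t = (\<Sum>i\<in>UNIV. D t $ i * pd i f (\<gamma> t))" for t
  define s where "s t = sqrt (metric_ip (metric M c (\<gamma> t)) (D t) (D t))" for t
  have \<gamma>t: "\<gamma> t \<in> target c" if "t \<in> {0..1}" for t using \<gamma>_in that by blast
  have fd: "f differentiable (at y within H)" if "y \<in> target c" for y
    unfolding f_def[abs_def]
    by (rule differentiable_compose_real[OF smooth_differentiable[OF smooth_v that] \<theta>_deriv[OF chart_bound[OF c that]]])
  have h: "((\<lambda>t. f (\<gamma> t)) has_vector_derivative h' t) (at t within {0..1})" if t: "t \<in> {0..1}" for t
  proof -
    have "(\<gamma> has_derivative (\<lambda>x. x *\<^sub>R D t)) (at t within {0..1})"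
      using D(1)[OF t] has_derivative_at_withinI by (auto simp: has_vector_derivative_def)
    moreover have "(f has_derivative (\<lambda>X. \<Sum>i\<in>UNIV. X $ i * pd i f (\<gamma> t))) (at (\<gamma> t) within \<gamma> ` {0..1})"
      by (rule has_derivative_subset[OF has_derivative_partial[OF fd[OF \<gamma>t[OF t]]]])
        (use \<gamma>_in S_sub in blast)
    ultimately have "((\<lambda>t. f (\<gamma> t)) has_derivative (\<lambda>x. \<Sum>i\<in>UNIV. (x *\<^sub>R D t) $ i * pd i f (\<gamma> t))) (at t within {0..1})"
      by (rule has_derivative_in_compose)
    then show ?thesis
      by (simp add: has_vector_derivative_def h'_def sum_distrib_left mult.assoc)
  qed
  \<comment> \<open>Cauchy-Schwarz bounds the derivative of \<open>v\<close> along the curve by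
    speed times gradient length; the factor \<open>1 / sqrt z\<close> from \<theta> absorbs the
    latter.\<close>
  have speed: "\<bar>h' t\<bar> \<le> s t" if t: "t \<in> {0..1}" for t
  proof -
    let ?y = "\<gamma> t"
    note y = \<gamma>t[OF t]
    interpret P: pos_def "metric M c ?y" using pos_def_metric[OF y] .
    let ?z = "z ((v \<circ> param c) ?y)"
    have z0: "0 < ?z" by (rule z_pos[OF chart_bound[OF c y]])
    have "pd i f ?y = 1 / sqrt ?z * pd i (v \<circ> param c) ?y" for i
      unfolding f_def[abs_def]
      by (rule partial_compose[OF S_sub[OF y] smooth_differentiable[OF smooth_v y] \<theta>_deriv[OF chart_bound[OF c y]]])
    then have "h' t = 1 / sqrt ?z * (\<Sum>i\<in>UNIV. D t $ i * pd i (v \<circ> param c) ?y)"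
      by (simp add: h'_def sum_distrib_left mult.left_commute)
    then have "h' t = 1 / sqrt ?z * P.ip (D t) (X ?y)"
      by (simp add: derivative_v[OF y])
    then have "(h' t)\<^sup>2 = (P.ip (D t) (X ?y))\<^sup>2 / ?z"
      using z0 by (simp add: power_mult_distrib power_divide)
    also have "\<dots> \<le> P.ip (D t) (D t) * P.ip (X ?y) (X ?y) / ?z"
      using z0 P.cauchy_schwarz by (intro divide_right_mono) auto
    also have "\<dots> \<le> P.ip (D t) (D t) * ?z / ?z"
      using z0 gradient_estimate[OF c y] P.nonneg
      by (intro divide_right_mono mult_left_mono) auto
    also have "\<dots> = P.ip (D t) (D t)" using z0 by simp
    finally show ?thesis by (simp add: s_def real_le_rsqrt)
  qed
  have int_h: "(h' has_integral f (\<gamma> 1) - f (\<gamma> 0)) {0..1}"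
    by (rule fundamental_theorem_of_calculus) (use h in auto)
  have cont_\<gamma>: "continuous_on {0..1} \<gamma>"
    by (intro continuous_at_imp_continuous_on ballI has_vector_derivative_continuous[OF D(1)])
  have cont_metric: "continuous_on {0..1} (\<lambda>t. metric M c (\<gamma> t) $ i $ j)" for i j
    by (rule continuous_on_compose2[OF smooth_continuous[OF smooth_metric] cont_\<gamma> \<gamma>_in])
  have "continuous_on {0..1} s"
    unfolding s_def[abs_def] metric_ip_expand
    by (intro continuous_on_real_sqrt continuous_on_sum continuous_on_mult cont_metric
        continuous_on_component D(2))
  then have int_s: "s integrable_on {0..1}" by (rule integrable_continuous_interval)
  have "\<bar>f (\<gamma> 1) - f (\<gamma> 0)\<bar> = norm (integral {0..1} h')"
    using int_h by (simp add: integral_unique)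
  also have "\<dots> \<le> integral {0..1} s"
    by (rule integral_norm_bound_integral) (use int_h int_s speed in \<open>auto simp: integrable_on_def\<close>)
  also have "\<dots> = integral {0..1} (\<lambda>t. let V = vector_derivative \<gamma> (at t) in sqrt (metric_ip (metric M c (\<gamma> t)) V V))"
    using D(1) by (intro integral_cong) (simp add: s_def Let_def vector_derivative_at[OF D(1)])
  finally have "\<bar>\<theta> (v (param c (\<gamma> 1))) - \<theta> (v q)\<bar> \<le>
      integral {0..1} (\<lambda>t. let V = vector_derivative \<gamma> (at t) in sqrt (metric_ip (metric M c (\<gamma> t)) V V))"
    by (simp add: f_def append(5))
  then show ?case
    using append.IH abs_triangle_ineq[of "\<theta> (v (param c (\<gamma> 1))) - \<theta> (v q)" "\<theta> (v q) - \<theta> (v p)"]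
    by simp
qed

text \<open>\<open>\<theta>(v)\<close> vanishes on the boundary, so no curve from \<open>p\<close>
  to the boundary is shorter than \<open>t0\<close>. Infima over empty sets are infinite and satisfy
  the bound as well.\<close>

lemma inradius_ge:
  assumes r: "is_inradius M r" and p: "p \<in> topspace T" "\<bar>\<theta> (v p)\<bar> = t0"
  shows "t0 \<le> r"
proof -
  have "\<theta> 0 = 0" using barrier by (simp add: gradient_barrier_def)
  then have "t0 \<le> L" if "q \<in> bdry M" "is_curve_length M p q L" for q L
    using curve_estimate[OF that(2)] v_bdry[OF that(1)] p(2) by simp
  then have "ereal t0 \<le> dist_to_bdry M p"
    unfolding dist_to_bdry_def riem_dist_def by (intro INF_greatest) auto
  also have "\<dots> \<le> ereal r" using r p(1) by (simp add: is_inradius_def)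
  finally show ?thesis by simp
qed

end

text \<open>The barrier is taken with \<open>V\<close> the maximum of \<open>\<bar>v\<bar>\<close>;
  the two prescribed values of \<theta> cover either sign of \<open>v\<close> at a maximum
  point.\<close>

lemma inradius_ge_barrier:
  assumes nz: "\<exists>p\<in>topspace T. v p \<noteq> 0" and r: "is_inradius M r"
    and barrier: "\<And>V. 0 < V \<Longrightarrow>
      \<exists>\<theta> z z1 z2. gradient_barrier lam cc V \<theta> z z1 z2 \<and> \<theta> V = t0 \<and> \<theta> (- V) = - t0"
  shows "t0 \<le> r"
proof -
  have "continuous_map T euclideanreal (\<lambda>p. \<bar>v p\<bar>)"
    using v_continuous by (rule continuous_map_real_abs)
  then obtain p where p: "p \<in> topspace T" "\<And>q. q \<in> topspace T \<Longrightarrow> \<bar>v q\<bar> \<le> \<bar>v p\<bar>"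
    using attains_max nz by blast
  have "0 < \<bar>v p\<bar>" using nz p(2) by fastforce
  then obtain \<theta> z z1 z2 where b: "gradient_barrier lam cc \<bar>v p\<bar> \<theta> z z1 z2"
    "\<theta> \<bar>v p\<bar> = t0" "\<theta> (- \<bar>v p\<bar>) = - t0"
    using barrier by blast
  have "\<bar>\<theta> (v p)\<bar> = \<bar>t0\<bar>" using b(2,3) by (cases "0 \<le> v p") auto
  then show ?thesis using inradius_ge[OF p(2) b(1) r p(1)] by fastforce
qed

end

section \<open>From inradius bounds to eigenvalue bounds\<close>

theorem theorem1:
  fixes M :: "('m, 'n::finite) riem_structure" and \<kappa> r d ev :: real
  assumes "compact_riemannian_manifold_with_boundary M"
    and "nonneg_mean_curvature M"
    and "ricci_ge M ((real CARD('n) - 1) * \<kappa>)"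
    and "\<kappa> < 0"
    and "is_inradius M r"
    and "d = 2 * r"
    and "first_dirichlet_eigenvalue M ev"
  shows "ev \<ge> 1 / (1 - (real CARD('n) - 1) * \<kappa> / (2 * ev)) * (pi\<^sup>2 / d\<^sup>2) \<and>
    1 / (1 - (real CARD('n) - 1) * \<kappa> / (2 * ev)) * (pi\<^sup>2 / d\<^sup>2) > 0 \<and>
    ev \<ge> 1 / 2 * (real CARD('n) - 1) * \<kappa> + pi\<^sup>2 / d\<^sup>2"
proof -
  define c where "c = - ((real CARD('n) - 1) * \<kappa>)"
  \<comment> \<open>In dimension one \<open>c\<close> is zero, so only nonnegativity is
    available.\<close>
  have "1 \<le> real CARD('n)" by (simp add: Suc_leI)
  then have c: "0 \<le> c"
    using assms(4) by (simp add: c_def mult_nonneg_nonpos)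
  obtain v where v: "smooth_function M v" "\<exists>p\<in>topspace (mtop M). v p \<noteq> 0"
    "\<And>c p. c \<in> atlas M \<Longrightarrow> p \<in> source c \<Longrightarrow> laplacian (idx M) (metric M c) (v \<circ> param c) (coord c p) = - ev * v p"
    "\<And>p. p \<in> bdry M \<Longrightarrow> v p = 0"
    using assms(7) unfolding first_dirichlet_eigenvalue_def dirichlet_eigenvalue_def by blast
  interpret eigenfunction M v ev c
    by unfold_locales (use assms v in \<open>auto simp: c_def\<close>)
  note radius = inradius_ge_barrier[OF v(2) assms(5)]
  have ev: "0 < ev"
  proof (rule ccontr)
    assume "\<not> 0 < ev"
    \<comment> \<open>For \<open>ev \<le> 0\<close> every positive \<open>t0\<close> bounds the
      inradius from below, in particular one exceeding \<open>r\<close>.\<close>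
    then have "\<bar>r\<bar> + 1 \<le> r"
      by (intro radius barrier_nonpositive c) auto
    then show False by simp
  qed
  have rad: "pi / (2 * a) \<le> r" if a: "0 < a" "ev + c / 2 < a\<^sup>2" for a
  proof (rule ccontr)
    assume less: "\<not> pi / (2 * a) \<le> r"
    \<comment> \<open>A positive number strictly between \<open>r\<close> and
      \<open>pi / (2 * a)\<close>; the maximum with 0 is taken since the sign of \<open>r\<close> is
      still open.\<close>
    define t0 where "t0 = (max r 0 + pi / (2 * a)) / 2"
    have pos: "0 < pi / (2 * a)" using a by simp
    then have t0: "0 < t0" "t0 < pi / (2 * a)" "r < t0"
      using less by (auto simp: t0_def max_def field_simps)
    have "t0 \<le> r"
      using ev c a t0 by (intro radius barrier_positive) auto
    then show False using t0 by simp
  qed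
  define a0 where "a0 = sqrt (ev + c / 2)"
  have a0: "0 < a0" "a0\<^sup>2 = ev + c / 2" using ev c by (auto simp: a0_def)
  have r: "0 < r"
  proof -
    \<comment> \<open>Every \<open>a\<close> above \<open>a0\<close> forces \<open>r\<close> to be
      positive; \<open>a0 + 1\<close> is one such value.\<close>
    have "0 < pi / (2 * (a0 + 1))" using a0 by simp
    also have "\<dots> \<le> r" using a0(1) by (intro rad) (auto simp: a0(2)[symmetric] power2_eq_square algebra_simps)
    finally show ?thesis .
  qed
  have "pi / (2 * r) \<le> a0"
  proof (rule ccontr)
    assume less: "\<not> pi / (2 * r) \<le> a0"
    \<comment> \<open>\<open>rad\<close> holds only for \<open>a\<close> strictly above
      \<open>a0\<close>, so the limiting bound is reached through the midpoint.\<close>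
    define a where "a = (a0 + pi / (2 * r)) / 2"
    have a: "a0 < a" "a < pi / (2 * r)" using less by (auto simp: a_def)
    have "pi / (2 * a) \<le> r"
      using a a0(1) by (intro rad) (auto simp: a0(2)[symmetric] intro!: power_strict_mono)
    then show False using a a0(1) r by (simp add: field_simps)
  qed
  then have "(pi / (2 * r))\<^sup>2 \<le> a0\<^sup>2" using r by (intro power_mono) auto
  then have main: "pi\<^sup>2 / d\<^sup>2 \<le> ev + c / 2"
    by (simp add: a0(2) assms(6) power_divide)
  have d: "0 < pi\<^sup>2 / d\<^sup>2" using r assms(6) by simp
  \<comment> \<open>In this form the first bound reads
    \<open>ev * (pi\<^sup>2 / d\<^sup>2) / (ev + c / 2) \<le> ev\<close>, which follows from
    \<open>main\<close>.\<close>
  have eq: "1 - (real CARD('n) - 1) * \<kappa> / (2 * ev) = (ev + c / 2) / ev"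
    using ev by (simp add: c_def field_simps)
  show ?thesis
  proof (intro conjI)
    have "0 < ev + c / 2" using ev c by simp
    then show "1 / (1 - (real CARD('n) - 1) * \<kappa> / (2 * ev)) * (pi\<^sup>2 / d\<^sup>2) > 0"
      unfolding eq using ev by (intro mult_pos_pos d) simp
    have "1 / ((ev + c / 2) / ev) * (pi\<^sup>2 / d\<^sup>2) = ev * (pi\<^sup>2 / d\<^sup>2) / (ev + c / 2)" by simp
    also have "\<dots> \<le> ev"
      using mult_left_mono[OF main, of ev] ev \<open>0 < ev + c / 2\<close> by (subst pos_divide_le_eq) auto
    finally show "ev \<ge> 1 / (1 - (real CARD('n) - 1) * \<kappa> / (2 * ev)) * (pi\<^sup>2 / d\<^sup>2)"
      unfolding eq .
    show "ev \<ge> 1 / 2 * (real CARD('n) - 1) * \<kappa> + pi\<^sup>2 / d\<^sup>2"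
      using main by (simp add: c_def)
  qed
qed

end
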